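(* Let $F$ be a field of characteristic $0$, let $H$ be a finite dimensional (co)semisimple Hopf algebra over $F$, and let $L$ be a finite dimensional $H$-module Lie algebra over $F$. Then the solvable radical $R$ of $L$ and the nilpotent radical $N$ of $L$ are $H$-invariant, i.e. they are $H$-submodules of $L$.
   Context: Sweedler notation: $\Delta(h)=h_{(1)}\otimes h_{(2)}$ for the comultiplication of $H$. A Lie algebra $L$ over $F$ that is a left $H$-module is an $H$-module Lie algebra if $h[a,b]=[h_{(1)}a,h_{(2)}b]$ for all $h\in H$, $a,b\in L$. The solvable radical is the largest solvable ideal of $L$; the nilpotent radical is the largest nilpotent ideal of $L$. For a finite dimensional Hopf algebra over a field of characteristic $0$, semisimplicity and cosemisimplicity are equivalent (Larson--Radford); "(co)semisimple" means that these equivalent conditions hold. *)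

theory Defs
  imports Complex_Main "HOL-Library.Poly_Mapping"
begin

text \<open>
  The tensor powers \<open>V \<otimes> V\<close> and \<open>V \<otimes> V \<otimes> V\<close> are the usual quotients of the free vector space on
  \<open>V \<times> V\<close>, resp. \<open>V \<times> V \<times> V\<close>, by the subspace of multilinearity relations. The scalar action
  is a term and not part of a type, so the quotient cannot be a type: tensors are written as elements
  of the free vector space (the generator \<open>a \<otimes> b\<close> is \<open>Poly_Mapping.single (a, b) 1\<close>), and
  equality of tensors is congruence modulo the relations.
\<close>

definition free_scale :: "'f::field \<Rightarrow> ('k \<Rightarrow>\<^sub>0 'f) \<Rightarrow> ('k \<Rightarrow>\<^sub>0 'f)" where
  "free_scale c p = Poly_Mapping.map (\<lambda>x. c * x) p"

text \<open>\<open>lin_ext scale f\<close> is the linear extension of \<open>f\<close> from generators to the free vector space; for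
  bilinear \<open>f\<close>, \<open>lin_ext scale (\<lambda>(x, y). f x y) (\<Delta> h)\<close> is Sweedler's \<open>f h\<^sub>(\<^sub>1\<^sub>) h\<^sub>(\<^sub>2\<^sub>)\<close>.\<close>

definition lin_ext :: "('f::field \<Rightarrow> 'v::ab_group_add \<Rightarrow> 'v) \<Rightarrow> ('k \<Rightarrow> 'v) \<Rightarrow> ('k \<Rightarrow>\<^sub>0 'f) \<Rightarrow> 'v" where
  "lin_ext scale f p =
    (\<Sum>k\<in>Poly_Mapping.keys p. scale (Poly_Mapping.lookup p k) (f k))"

abbreviation tens2 :: "'a \<Rightarrow> 'b \<Rightarrow> ('a \<times> 'b \<Rightarrow>\<^sub>0 'f::field)" where
  "tens2 a b \<equiv> Poly_Mapping.single (a, b) 1"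

abbreviation tens3 :: "'a \<Rightarrow> 'b \<Rightarrow> 'c \<Rightarrow> ('a \<times> 'b \<times> 'c \<Rightarrow>\<^sub>0 'f::field)" where
  "tens3 a b c \<equiv> Poly_Mapping.single (a, b, c) 1"

definition tensor2_relations ::
  "('f::field \<Rightarrow> 'v::ab_group_add \<Rightarrow> 'v) \<Rightarrow> ('v \<times> 'v \<Rightarrow>\<^sub>0 'f) set" where
  "tensor2_relations scale = module.span free_scale
    ( {tens2 (a + a') b - tens2 a b - tens2 a' b |a a' b. True}
    \<union> {tens2 a (b + b') - tens2 a b - tens2 a b' |a b b'. True}
    \<union> {tens2 (scale r a) b - free_scale r (tens2 a b) |r a b. True}
    \<union> {tens2 a (scale r b) - free_scale r (tens2 a b) |r a b. True})"

definition tensor3_relations ::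
  "('f::field \<Rightarrow> 'v::ab_group_add \<Rightarrow> 'v) \<Rightarrow> ('v \<times> 'v \<times> 'v \<Rightarrow>\<^sub>0 'f) set" where
  "tensor3_relations scale = module.span free_scale
    ( {tens3 (a + a') b c - tens3 a b c - tens3 a' b c |a a' b c. True}
    \<union> {tens3 a (b + b') c - tens3 a b c - tens3 a b' c |a b b' c. True}
    \<union> {tens3 a b (c + c') - tens3 a b c - tens3 a b c' |a b c c'. True}
    \<union> {tens3 (scale r a) b c - free_scale r (tens3 a b c) |r a b c. True}
    \<union> {tens3 a (scale r b) c - free_scale r (tens3 a b c) |r a b c. True}
    \<union> {tens3 a b (scale r c) - free_scale r (tens3 a b c) |r a b c. True})"

definition tensor2_eq ::
  "('f::field \<Rightarrow> 'v::ab_group_add \<Rightarrow> 'v) \<Rightarrow> ('v \<times> 'v \<Rightarrow>\<^sub>0 'f) \<Rightarrow> ('v \<times> 'v \<Rightarrow>\<^sub>0 'f) \<Rightarrow> bool" where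
  "tensor2_eq scale p q \<longleftrightarrow> p - q \<in> tensor2_relations scale"

definition tensor3_eq ::
  "('f::field \<Rightarrow> 'v::ab_group_add \<Rightarrow> 'v)
    \<Rightarrow> ('v \<times> 'v \<times> 'v \<Rightarrow>\<^sub>0 'f) \<Rightarrow> ('v \<times> 'v \<times> 'v \<Rightarrow>\<^sub>0 'f) \<Rightarrow> bool" where
  "tensor3_eq scale p q \<longleftrightarrow> p - q \<in> tensor3_relations scale"

definition finite_dimensional :: "('f::field \<Rightarrow> 'v::ab_group_add \<Rightarrow> 'v) \<Rightarrow> bool" where
  "finite_dimensional scale \<longleftrightarrow> (\<exists>B. finite_dimensional_vector_space scale B)"

locale unital_algebra = vector_space scale
  for scale :: "'f::field \<Rightarrow> 'h::ab_group_add \<Rightarrow> 'h" +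
  fixes mult :: "'h \<Rightarrow> 'h \<Rightarrow> 'h" and one :: 'h
  assumes mult_linear_right: "\<And>x. Vector_Spaces.linear scale scale (\<lambda>y. mult x y)"
    and mult_linear_left: "\<And>y. Vector_Spaces.linear scale scale (\<lambda>x. mult x y)"
    and mult_assoc: "\<And>x y z. mult (mult x y) z = mult x (mult y z)"
    and mult_one_left: "\<And>x. mult one x = x"
    and mult_one_right: "\<And>x. mult x one = x"
begin

definition left_ideal :: "'h set \<Rightarrow> bool" where
  "left_ideal I \<longleftrightarrow> subspace I \<and> (\<forall>x. \<forall>y\<in>I. mult x y \<in> I)"

text \<open>The left regular module is semisimple: every submodule is a direct summand.\<close>

definition semisimple_algebra :: bool where
  "semisimple_algebra \<longleftrightarrow>
    (\<forall>I. left_ideal I \<longrightarrow>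
      (\<exists>J. left_ideal J \<and> I \<inter> J = {0} \<and> {x + y |x y. x \<in> I \<and> y \<in> J} = UNIV))"

end

text \<open>\<open>comult h\<close> is a chosen representative of \<open>\<Delta>(h) \<in> H \<otimes> H\<close>, so that even linearity of \<open>\<Delta>\<close> is
  required only up to equality of tensors. Every condition on \<open>comult\<close> here and below depends only
  on the tensors represented.\<close>

locale coalgebra = vector_space scale
  for scale :: "'f::field \<Rightarrow> 'h::ab_group_add \<Rightarrow> 'h" +
  fixes comult :: "'h \<Rightarrow> ('h \<times> 'h \<Rightarrow>\<^sub>0 'f)" and counit :: "'h \<Rightarrow> 'f"
  assumes comult_add: "\<And>x y. tensor2_eq scale (comult (x + y)) (comult x + comult y)"
    and comult_scale: "\<And>r x. tensor2_eq scale (comult (scale r x)) (free_scale r (comult x))"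
    and counit_linear: "Vector_Spaces.linear scale (*) counit"
    and coassoc: "\<And>h. tensor3_eq scale
      (lin_ext free_scale (\<lambda>(a, b). lin_ext free_scale (\<lambda>(x, y). tens3 x y b) (comult a)) (comult h))
      (lin_ext free_scale (\<lambda>(a, b). lin_ext free_scale (\<lambda>(x, y). tens3 a x y) (comult b)) (comult h))"
    and counit_left: "\<And>h. lin_ext scale (\<lambda>(a, b). scale (counit a) b) (comult h) = h"
    and counit_right: "\<And>h. lin_ext scale (\<lambda>(a, b). scale (counit b) a) (comult h) = h"
begin

text \<open>\<open>\<Delta>(C) \<subseteq> C \<otimes> C\<close>: each \<open>\<Delta>(c)\<close> has a representative supported on \<open>C \<times> C\<close>.\<close>

definition subcoalgebra :: "'h set \<Rightarrow> bool" where
  "subcoalgebra C \<longleftrightarrow> subspace C \<and>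
    (\<forall>c\<in>C. \<exists>p. Poly_Mapping.keys p \<subseteq> C \<times> C \<and> tensor2_eq scale (comult c) p)"

definition simple_subcoalgebra :: "'h set \<Rightarrow> bool" where
  "simple_subcoalgebra C \<longleftrightarrow> subcoalgebra C \<and> C \<noteq> {0} \<and>
    (\<forall>D. subcoalgebra D \<and> D \<subseteq> C \<longrightarrow> D = {0} \<or> D = C)"

text \<open>The coalgebra is the sum of its simple subcoalgebras, i.e. it equals its coradical.\<close>

definition cosemisimple_coalgebra :: bool where
  "cosemisimple_coalgebra \<longleftrightarrow> span (\<Union>{C. simple_subcoalgebra C}) = UNIV"

end

locale hopf_algebra =
  unital_algebra scale mult one + coalgebra scale comult counit
  for scale :: "'f::field \<Rightarrow> 'h::ab_group_add \<Rightarrow> 'h"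
    and mult :: "'h \<Rightarrow> 'h \<Rightarrow> 'h" and one :: 'h
    and comult :: "'h \<Rightarrow> ('h \<times> 'h \<Rightarrow>\<^sub>0 'f)" and counit :: "'h \<Rightarrow> 'f" +
  fixes antipode :: "'h \<Rightarrow> 'h"
  assumes comult_mult: "\<And>x y. tensor2_eq scale (comult (mult x y))
      (lin_ext free_scale
        (\<lambda>(a, b). lin_ext free_scale (\<lambda>(c, d). tens2 (mult a c) (mult b d)) (comult y)) (comult x))"
    and comult_one: "tensor2_eq scale (comult one) (tens2 one one)"
    and counit_mult: "\<And>x y. counit (mult x y) = counit x * counit y"
    and counit_one: "counit one = 1"
    and antipode_linear: "Vector_Spaces.linear scale scale antipode"
    and antipode_left:
      "\<And>h. lin_ext scale (\<lambda>(a, b). mult (antipode a) b) (comult h) = scale (counit h) one"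
    and antipode_right:
      "\<And>h. lin_ext scale (\<lambda>(a, b). mult a (antipode b)) (comult h) = scale (counit h) one"

locale lie_algebra = vector_space scale
  for scale :: "'f::field \<Rightarrow> 'l::ab_group_add \<Rightarrow> 'l" +
  fixes bracket :: "'l \<Rightarrow> 'l \<Rightarrow> 'l"
  assumes bracket_linear_right: "\<And>a. Vector_Spaces.linear scale scale (\<lambda>b. bracket a b)"
    and bracket_linear_left: "\<And>b. Vector_Spaces.linear scale scale (\<lambda>a. bracket a b)"
    and bracket_self: "\<And>a. bracket a a = 0"
    and jacobi:
      "\<And>a b c. bracket a (bracket b c) + bracket b (bracket c a) + bracket c (bracket a b) = 0"
begin

definition lie_ideal :: "'l set \<Rightarrow> bool" where
  "lie_ideal I \<longleftrightarrow> subspace I \<and> (\<forall>a. \<forall>b\<in>I. bracket a b \<in> I)"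

definition bracket_span :: "'l set \<Rightarrow> 'l set \<Rightarrow> 'l set" where
  "bracket_span A B = span {bracket a b |a b. a \<in> A \<and> b \<in> B}"

primrec derived_series :: "'l set \<Rightarrow> nat \<Rightarrow> 'l set" where
  "derived_series I 0 = I"
| "derived_series I (Suc n) = bracket_span (derived_series I n) (derived_series I n)"

primrec lower_central_series :: "'l set \<Rightarrow> nat \<Rightarrow> 'l set" where
  "lower_central_series I 0 = I"
| "lower_central_series I (Suc n) = bracket_span I (lower_central_series I n)"

definition solvable_ideal :: "'l set \<Rightarrow> bool" where
  "solvable_ideal I \<longleftrightarrow> lie_ideal I \<and> (\<exists>n. derived_series I n = {0})"

definition nilpotent_ideal :: "'l set \<Rightarrow> bool" where
  "nilpotent_ideal I \<longleftrightarrow> lie_ideal I \<and> (\<exists>n. lower_central_series I n = {0})"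

text \<open>\<open>GREATEST\<close> is taken with respect to inclusion; both greatest elements exist when the algebra is
  finite dimensional.\<close>

definition solvable_radical :: "'l set" where
  "solvable_radical = (GREATEST I. solvable_ideal I)"

definition nilpotent_radical :: "'l set" where
  "nilpotent_radical = (GREATEST I. nilpotent_ideal I)"

end

locale module_lie_algebra =
  H: hopf_algebra scaleH mult one comult counit antipode + L: lie_algebra scaleL bracket
  for scaleH :: "'f::field \<Rightarrow> 'h::ab_group_add \<Rightarrow> 'h"
    and mult :: "'h \<Rightarrow> 'h \<Rightarrow> 'h" and one :: 'h
    and comult :: "'h \<Rightarrow> ('h \<times> 'h \<Rightarrow>\<^sub>0 'f)" and counit :: "'h \<Rightarrow> 'f"
    and antipode :: "'h \<Rightarrow> 'h"
    and scaleL :: "'f \<Rightarrow> 'l::ab_group_add \<Rightarrow> 'l"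
    and bracket :: "'l \<Rightarrow> 'l \<Rightarrow> 'l" +
  fixes act :: "'h \<Rightarrow> 'l \<Rightarrow> 'l"
  assumes act_linear_right: "\<And>h. Vector_Spaces.linear scaleL scaleL (\<lambda>a. act h a)"
    and act_linear_left: "\<And>a. Vector_Spaces.linear scaleH scaleL (\<lambda>h. act h a)"
    and act_one: "\<And>a. act one a = a"
    and act_mult: "\<And>h k a. act (mult h k) a = act h (act k a)"
    and act_bracket: "\<And>h a b.
      act h (bracket a b) = lin_ext scaleL (\<lambda>(x, y). bracket (act x a) (act y b)) (comult h)"
begin

definition H_submodule :: "'l set \<Rightarrow> bool" where
  "H_submodule M \<longleftrightarrow> L.subspace M \<and> (\<forall>h. \<forall>a\<in>M. act h a \<in> M)"

end

end

theory Submission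
  imports Defs "HOL-Algebra.Algebraic_Closure_Type" "HOL-Library.Function_Algebras"
begin

text \<open>
  The first half is the theorem of Larson and Radford that the antipode is an involution. Let \<open>t\<close> be
  an integral of \<open>H\<close> with \<open>\<epsilon>(t) = 1\<close> (in the cosemisimple case, of the dual Hopf algebra). The trace
  \<open>\<mu>(h)\<close> of \<open>x \<mapsto> h S\<^sup>-\<^sup>2(x)\<close> is an integral of the dual, and
  \<open>u = S(t\<^sub>(\<^sub>2\<^sub>)) t\<^sub>(\<^sub>1\<^sub>)\<close> is invertible and implements \<open>S\<^sup>2\<close>, so \<open>\<mu>(1)\<close> is the trace of \<open>u\<^sup>-\<^sup>1\<close> in the
  regular representation. Since \<open>S\<^sup>2\<close> has finite order, some \<open>u\<^sup>M\<close> is central, and on each eigenspace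
  of \<open>u\<^sup>M\<close> the trace of \<open>u\<close> is the dimension; a positivity argument then gives \<open>\<mu>(1) \<noteq> 0\<close>. From this
  first \<open>S\<^sup>4 = id\<close> and then, comparing \<open>\<mu>(1)\<close> with multiples of \<open>dim H\<close>, \<open>S\<^sup>2 = id\<close> follows.

  For the second half, the nilpotent radical \<open>N\<close> of \<open>L\<close> consists of the \<open>a\<close> such that
  \<open>tr (ad a \<circ> w) = 0\<close> for all products \<open>w\<close> of adjoint operators, and the solvable radical of the \<open>a\<close>
  with \<open>[a, L] \<subseteq> N\<close>. As \<open>ad (h a) = h\<^sub>(\<^sub>1\<^sub>) ad a S(h\<^sub>(\<^sub>2\<^sub>))\<close>, the trace of \<open>ad (h a) \<circ> w\<close> is the trace of
  \<open>ad a \<circ> S(h\<^sub>(\<^sub>2\<^sub>)) w h\<^sub>(\<^sub>1\<^sub>)\<close>. Moving \<open>S(h\<^sub>(\<^sub>2\<^sub>))\<close> through \<open>w\<close> and using \<open>S(h\<^sub>(\<^sub>2\<^sub>)) h\<^sub>(\<^sub>1\<^sub>) = \<epsilon>(h)\<close>, which is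
  where \<open>S\<^sup>2 = id\<close> enters, one arrives at a combination of traces of the same kind.
\<close>

section \<open>Traces and eigenvalues\<close>

text \<open>For an ideal \<open>I\<close>, the span of all \<open>act h a\<close> with
  \<open>a\<close> in \<open>I\<close> is again an ideal; its solvability or nilpotency is the
  obstacle, since a general \<open>h\<close> acts neither by automorphisms nor by derivations.
  Describing the radicals by vanishing traces avoids this question: only linear conditions remain to
  be transported along \<open>h\<close>. Equality of tensors is a congruence, and the field is an
  arbitrary one of characteristic 0. Hence Sweedler identities are computed with scalar valued
  bilinear forms and tested against linear functionals, and eigenvalues live in the algebraic
  closure, without order or conjugation. The dual Hopf algebra is placed on the type of
  \<open>H\<close> itself by making a basis its own dual basis, so the cosemisimple case is an
  instance of the same locale. The finite order of \<open>S^2\<close> comes from Radford's formula: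
  \<open>S^4\<close> is conjugation by a grouplike element \<open>g\<close>, and distinct grouplike
  elements are linearly independent, so the powers of \<open>g\<close> repeat. Once \<mu>(1) is
  nonzero, evaluating the translation formula for \<mu> at \<open>one\<close> gives
  \<open>g = one\<close>, hence \<open>S^4 = id\<close>.\<close>

locale trace_space = vector_space scale
  for scale :: "'a::field \<Rightarrow> 'b::ab_group_add \<Rightarrow> 'b" (infixr \<open>*s\<close> 75)
begin

abbreviation lin :: "('b \<Rightarrow> 'b) \<Rightarrow> bool" where
  "lin \<equiv> Vector_Spaces.linear scale scale"

lemma lin_iff: "lin f \<longleftrightarrow> (\<forall>x y. f (x + y) = f x + f y) \<and> (\<forall>c x. f (c *s x) = c *s f x)"
  unfolding Vector_Spaces.linear_iff using vector_space_axioms by simp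

lemma lin_0: "lin f \<Longrightarrow> f 0 = 0"
  unfolding lin_iff by (metis scale_zero_left)

lemma lin_add: "lin f \<Longrightarrow> f (x + y) = f x + f y"
  by (simp add: lin_iff)

lemma lin_scale: "lin f \<Longrightarrow> f (c *s x) = c *s f x"
  by (simp add: lin_iff)

lemma lin_id: "lin (\<lambda>x. x)"
  by (simp add: lin_iff)

lemma lin_compose: "lin f \<Longrightarrow> lin g \<Longrightarrow> lin (\<lambda>x. f (g x))"
  by (simp add: lin_iff)

lemma lin_sum: "lin f \<Longrightarrow> f (\<Sum>i\<in>A. g i) = (\<Sum>i\<in>A. f (g i))"
  by (induction A rule: infinite_finite_induct) (simp_all add: lin_0 lin_add)

text \<open>The trace of the map induced on the subspace with basis \<open>E\<close>. Keeping the
  basis as an argument lets invariant subspaces be treated without types of their own.\<close>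

definition trc :: "'b set \<Rightarrow> ('b \<Rightarrow> 'b) \<Rightarrow> 'a" where
  "trc E f = (\<Sum>b\<in>E. representation E (f b) b)"

lemma sum_representation:
  assumes "finite E" "independent E" "v \<in> span E"
  shows "(\<Sum>b\<in>E. representation E v b *s b) = v"
  using sum_representation_eq[OF assms(2,3) assms(1) order_refl] .

text \<open>Two bases of possibly different subspaces are allowed, so that cyclicity, independence
  of the basis and passage to a subspace containing the image are all instances.\<close>

lemma trc_compose_commute:
  assumes E: "finite E" "independent E" and E': "finite E'" "independent E'"
    and f: "lin f" "f ` span E \<subseteq> span E'"
    and g: "lin g" "g ` span E' \<subseteq> span E"
  shows "trc E (\<lambda>x. g (f x)) = trc E' (\<lambda>x. f (g x))"
proof -
  interpret f: Vector_Spaces.linear scale scale f by fact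
  interpret g: Vector_Spaces.linear scale scale g by fact
  have 1: "representation E (g v) b = (\<Sum>c\<in>E'. representation E' v c * representation E (g c) b)"
    if v: "v \<in> span E'" for v b
  proof -
    have "g v = (\<Sum>c\<in>E'. representation E' v c *s g c)"
      using sum_representation[OF E' v] by (metis (no_types, lifting) g.scale g.sum sum.cong)
    moreover have "representation E (\<Sum>c\<in>E'. representation E' v c *s g c) =
        (\<lambda>b. \<Sum>c\<in>E'. representation E (representation E' v c *s g c) b)"
      using g(2) by (intro representation_sum E) (blast intro: span_scale span_base)
    ultimately show ?thesis
      using g(2) E by (auto intro!: sum.cong simp: representation_scale span_base image_subset_iff)
  qed
  have 2: "representation E' (f v) b = (\<Sum>c\<in>E. representation E v c * representation E' (f c) b)"
    if v: "v \<in> span E" for v b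
  proof -
    have "f v = (\<Sum>c\<in>E. representation E v c *s f c)"
      using sum_representation[OF E v] by (metis (no_types, lifting) f.scale f.sum sum.cong)
    moreover have "representation E' (\<Sum>c\<in>E. representation E v c *s f c) =
        (\<lambda>b. \<Sum>c\<in>E. representation E' (representation E v c *s f c) b)"
      using f(2) by (intro representation_sum E') (blast intro: span_scale span_base)
    ultimately show ?thesis
      using f(2) E' by (auto intro!: sum.cong simp: representation_scale span_base image_subset_iff)
  qed
  have "trc E (\<lambda>x. g (f x)) = (\<Sum>b\<in>E. \<Sum>c\<in>E'. representation E' (f b) c * representation E (g c) b)"
    unfolding trc_def using f(2) by (intro sum.cong refl 1) (auto simp: span_base)
  also have "\<dots> = (\<Sum>c\<in>E'. \<Sum>b\<in>E. representation E (g c) b * representation E' (f b) c)"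
    by (subst sum.swap) (simp add: mult.commute)
  also have "\<dots> = trc E' (\<lambda>x. f (g x))"
    unfolding trc_def using g(2) by (intro sum.cong refl 2[symmetric]) (auto simp: span_base)
  finally show ?thesis .
qed

text \<open>Cyclicity for \<open>f\<close> and the inclusion of \<open>span E'\<close> into
  \<open>span E\<close>.\<close>

lemma trc_restrict:
  assumes E: "finite E" "independent E" and E': "finite E'" "independent E'"
    and f: "lin f" "f ` span E \<subseteq> span E'" and "span E' \<subseteq> span E"
  shows "trc E f = trc E' f"
  using trc_compose_commute[OF E E' f lin_id] assms(7) by simp

lemma trc_cong: "(\<And>b. b \<in> E \<Longrightarrow> f b = g b) \<Longrightarrow> trc E f = trc E g"
  by (simp add: trc_def)

lemma finite_basis_of_subspace:
  assumes "finite E" "subspace W" "W \<subseteq> span E"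
  obtains C where "finite C" "independent C" "span C = W"
proof -
  obtain C where C: "C \<subseteq> W" "independent C" "W \<subseteq> span C" by (meson basis_exists)
  have "span C = W" using C assms(2) by (metis span_minimal subset_antisym)
  moreover have "finite C"
    using independent_span_bound[OF assms(1) C(2)] C(1) assms(3) by auto
  ultimately show ?thesis using C that by blast
qed

text \<open>The trace may be computed on the image, where \<open>e\<close> is the identity.\<close>

lemma trc_idempotent:
  assumes E: "finite E" "independent E" and e: "lin e" "e ` span E \<subseteq> span E"
    and id: "\<And>x. x \<in> span E \<Longrightarrow> e (e x) = e x"
  shows "trc E e = of_nat (dim (e ` span E))"
proof -
  interpret e: Vector_Spaces.linear scale scale e by fact
  have "subspace (e ` span E)" by (intro e.subspace_image subspace_span)
  then obtain C where C: "finite C" "independent C" "span C = e ` span E"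
    using finite_basis_of_subspace[OF E(1) _ e(2)] by blast
  have "trc E e = trc C e" using trc_restrict[OF E C(1,2) e(1)] C(3) e(2) by simp
  also have "\<dots> = (\<Sum>b\<in>C. 1)"
    unfolding trc_def
  proof (intro sum.cong refl)
    fix b assume b: "b \<in> C"
    then have "b \<in> e ` span E" using C(3) span_base by blast
    then have "e b = b" using id by auto
    then show "representation C (e b) b = 1" using b C(2) by (simp add: representation_basis)
  qed
  also have "\<dots> = of_nat (dim (e ` span E))"
    using C by (metis dim_span_eq_card_independent of_nat_eq_1_iff of_nat_sum sum_constant mult.right_neutral)
  finally show ?thesis .
qed

text \<open>The trace is unchanged on passing to the image of \<open>f\<close>, where one power less
  annihilates.\<close>

lemma trc_nilpotent:
  assumes "finite E" "independent E" and f: "lin f" and "f ` span E \<subseteq> span E"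
    and "\<And>x. x \<in> span E \<Longrightarrow> (f ^^ k) x = 0"
  shows "trc E f = 0"
  using assms
proof (induction k arbitrary: E)
  case 0
  then have "span E \<subseteq> {0}" by auto
  then have "E \<subseteq> {0}" using span_superset by blast
  then have "E = {}" using 0 dependent_zero by (metis subset_singletonD insertI1)
  then show ?case by (simp add: trc_def)
next
  case (Suc k)
  interpret f: Vector_Spaces.linear scale scale f by fact
  have "subspace (f ` span E)" by (intro f.subspace_image subspace_span)
  then obtain C where C: "finite C" "independent C" "span C = f ` span E"
    using finite_basis_of_subspace[OF Suc(2) _ Suc(5)] by blast
  have "trc E f = trc C f" using trc_restrict[OF Suc(2,3) C(1,2) f(1)] C(3) Suc(5) by simp
  moreover have "(f ^^ k) x = 0" if "x \<in> span C" for x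
    using that C(3) Suc(6) by (metis (no_types, lifting) comp_apply funpow_Suc_right imageE)
  moreover have "f ` span C \<subseteq> span C" using C(3) Suc(5) by blast
  ultimately show ?case using Suc.IH[OF C(1,2) f] by simp
qed

lemma trc_add:
  assumes "independent E" "f ` E \<subseteq> span E" "g ` E \<subseteq> span E"
  shows "trc E (\<lambda>x. f x + g x) = trc E f + trc E g"
  unfolding trc_def sum.distrib[symmetric] using assms
  by (intro sum.cong refl) (simp add: representation_add image_subset_iff)

lemma trc_scale:
  assumes "independent E" "f ` E \<subseteq> span E"
  shows "trc E (\<lambda>x. c *s f x) = c * trc E f"
  unfolding trc_def sum_distrib_left using assms
  by (intro sum.cong refl) (simp add: representation_scale image_subset_iff)

lemma trc_sum:
  assumes "independent E" "\<And>i. i \<in> A \<Longrightarrow> f i ` E \<subseteq> span E"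
  shows "trc E (\<lambda>x. \<Sum>i\<in>A. f i x) = (\<Sum>i\<in>A. trc E (f i))"
proof -
  have "trc E (\<lambda>x. \<Sum>i\<in>A. f i x) = (\<Sum>b\<in>E. \<Sum>i\<in>A. representation E (f i b) b)"
    unfolding trc_def using assms
    by (intro sum.cong refl) (subst representation_sum, auto simp: image_subset_iff)
  then show ?thesis unfolding trc_def by (subst (asm) sum.swap)
qed

section \<open>Polynomials in a linear operator\<close>

definition poly_act :: "('b \<Rightarrow> 'b) \<Rightarrow> 'a poly \<Rightarrow> 'b \<Rightarrow> 'b" where
  "poly_act f p v = (\<Sum>i\<le>degree p. coeff p i *s (f ^^ i) v)"

lemma poly_act_bound:
  assumes "degree p \<le> n"
  shows "poly_act f p v = (\<Sum>i\<le>n. coeff p i *s (f ^^ i) v)"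
  unfolding poly_act_def using assms by (intro sum.mono_neutral_left) (auto simp: coeff_eq_0)

lemma poly_act_add: "poly_act f (p + q) v = poly_act f p v + poly_act f q v"
proof -
  define n where "n = max (degree p) (degree q)"
  have "degree (p + q) \<le> n" "degree p \<le> n" "degree q \<le> n"
    by (auto simp: n_def degree_add_le)
  then show ?thesis
    by (simp add: poly_act_bound[where n=n] scale_left_distrib sum.distrib)
qed

lemma poly_act_0 [simp]: "poly_act f 0 v = 0"
  by (simp add: poly_act_def)

lemma poly_act_1 [simp]: "poly_act f 1 v = v"
  by (simp add: poly_act_def)

lemma poly_act_smult: "poly_act f (Polynomial.smult c p) v = c *s poly_act f p v"
  by (simp add: poly_act_bound[where n="degree p"] degree_smult_le scale_sum_right)

context
  fixes f assumes f: "lin f"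
begin

interpretation f: Vector_Spaces.linear scale scale f by fact

lemma poly_act_pCons: "poly_act f (pCons a p) v = a *s v + f (poly_act f p v)"
proof -
  have "poly_act f (pCons a p) v = (\<Sum>i\<le>Suc (degree p). coeff (pCons a p) i *s (f ^^ i) v)"
    by (rule poly_act_bound) (simp add: degree_pCons_le)
  also have "\<dots> = a *s v + (\<Sum>i\<le>degree p. coeff p i *s f ((f ^^ i) v))"
    by (subst sum.atMost_Suc_shift) simp
  also have "(\<Sum>i\<le>degree p. coeff p i *s f ((f ^^ i) v)) = f (poly_act f p v)"
    by (simp add: poly_act_def f.sum f.scale)
  finally show ?thesis .
qed

lemma linear_funpow: "lin (f ^^ i)"
proof (induction i)
  case 0
  then show ?case using lin_id by (simp add: id_def)
next
  case (Suc i)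
  then show ?case using lin_compose[OF f] by (simp add: o_def)
qed

lemma linear_poly_act: "lin (poly_act f p)"
proof -
  have "lin (\<lambda>v. \<Sum>i\<le>degree p. coeff p i *s (f ^^ i) v)"
    using linear_funpow
    by (simp add: lin_iff scale_right_distrib sum.distrib scale_sum_right mult.commute)
  then show ?thesis by (simp add: poly_act_def[abs_def])
qed

lemma poly_act_mult: "poly_act f (p * q) v = poly_act f p (poly_act f q v)"
  by (induction p arbitrary: v)
    (simp_all add: mult_pCons_left poly_act_add poly_act_smult poly_act_pCons)

lemma poly_act_funpow: "poly_act f (monom 1 n) v = (f ^^ n) v"
  by (induction n) (simp_all add: monom_0 monom_Suc poly_act_pCons flip: one_pCons)

lemma poly_act_in_span:
  assumes "f ` span E \<subseteq> span E" "v \<in> span E"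
  shows "poly_act f p v \<in> span E"
  by (induction p) (use assms in \<open>auto simp: poly_act_pCons intro!: span_add span_scale span_zero\<close>)

lemma funpow_in_span:
  assumes "f ` span E \<subseteq> span E" "v \<in> span E"
  shows "(f ^^ i) v \<in> span E"
  by (induction i) (use assms in auto)

text \<open>Dependence is a property of sets, so the powers applied to \<open>v\<close> are first
  assumed distinct; a coincidence of two of them gives the binomial \<open>X^i - X^j\<close>
  instead.\<close>

lemma annihilating_poly_vector:
  assumes "finite E" "f ` span E \<subseteq> span E" "v \<in> span E"
  shows "\<exists>p. p \<noteq> 0 \<and> poly_act f p v = 0"
proof (cases "inj_on (\<lambda>i. (f ^^ i) v) {..card E}")
  case True
  let ?S = "(\<lambda>i. (f ^^ i) v) ` {..card E}"
  have "card ?S = Suc (card E)" using True by (simp add: card_image)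
  moreover have "?S \<subseteq> span E" using funpow_in_span[OF assms(2,3)] by auto
  ultimately have "dependent ?S" using independent_span_bound[OF assms(1)] by fastforce
  then obtain u w where u: "(\<Sum>w\<in>?S. u w *s w) = 0" "w \<in> ?S" "u w \<noteq> 0"
    by (auto simp: dependent_finite)
  define p where "p = (\<Sum>i\<le>card E. monom (u ((f ^^ i) v)) i)"
  have c: "coeff p i = (if i \<le> card E then u ((f ^^ i) v) else 0)" for i
    by (simp add: p_def coeff_sum)
  then have "degree p \<le> card E" by (intro degree_le) auto
  then have "poly_act f p v = (\<Sum>i\<le>card E. u ((f ^^ i) v) *s (f ^^ i) v)"
    by (simp add: poly_act_bound c)
  also have "\<dots> = 0" using u(1) by (simp add: sum.reindex[OF True])
  finally have "poly_act f p v = 0" .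
  moreover obtain i where "i \<le> card E" "w = (f ^^ i) v" using u(2) by auto
  then have "p \<noteq> 0" using c[of i] u(3) by auto
  ultimately show ?thesis by blast
next
  case False
  then obtain i j where ij: "i \<noteq> j" "(f ^^ i) v = (f ^^ j) v" by (auto simp: inj_on_def)
  have "poly_act f (monom 1 i + Polynomial.smult (-1) (monom 1 j)) v = 0"
    unfolding poly_act_add poly_act_smult poly_act_funpow using ij by simp
  moreover have "coeff (monom 1 i + Polynomial.smult (-1) (monom 1 j)) i \<noteq> (0::'a)"
    using ij by simp
  then have "monom 1 i + Polynomial.smult (-1) (monom 1 j) \<noteq> (0::'a poly)" by (metis coeff_0)
  ultimately show ?thesis by blast
qed

lemma annihilating_poly:
  assumes "finite E" "f ` span E \<subseteq> span E"
  obtains p where "p \<noteq> 0" "\<And>v. v \<in> span E \<Longrightarrow> poly_act f p v = 0"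
proof -
  obtain P where P: "\<And>b. b \<in> E \<Longrightarrow> P b \<noteq> 0 \<and> poly_act f (P b) b = 0"
    using annihilating_poly_vector[OF assms] span_base by metis
  define p where "p = (\<Prod>b\<in>E. P b)"
  have b: "poly_act f p b = 0" if "b \<in> E" for b
  proof -
    have "p = (\<Prod>c\<in>E - {b}. P c) * P b"
      unfolding p_def using assms(1) that by (simp add: prod.remove mult.commute)
    then show ?thesis
      using P[OF that] lin_0[OF linear_poly_act] by (simp add: poly_act_mult)
  qed
  have "poly_act f p v = 0" if "v \<in> span E" for v
    using that
  proof (induction rule: module.span_induct_alt[OF module_axioms, consumes 1, case_names base step])
    case base
    show ?case by (rule lin_0[OF linear_poly_act])
  next
    case (step c x y)
    then show ?case
      using b by (simp add: lin_add[OF linear_poly_act] lin_scale[OF linear_poly_act])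
  qed
  moreover have "p \<noteq> 0" using P assms(1) by (simp add: p_def)
  ultimately show ?thesis using that by blast
qed

lemma trc_poly_act:
  assumes "independent E" "f ` span E \<subseteq> span E"
  shows "trc E (poly_act f p) = (\<Sum>i\<le>degree p. coeff p i * trc E (f ^^ i))"
proof -
  have *: "(f ^^ i) ` E \<subseteq> span E" for i using funpow_in_span[OF assms(2)] span_base by blast
  have "trc E (poly_act f p) = trc E (\<lambda>v. \<Sum>i\<le>degree p. coeff p i *s (f ^^ i) v)"
    by (simp add: poly_act_def[abs_def])
  also have "\<dots> = (\<Sum>i\<le>degree p. coeff p i * trc E (f ^^ i))"
    using * assms(1) by (subst trc_sum) (auto simp: trc_scale intro!: span_scale)
  finally show ?thesis .
qed

end

text \<open>Fitting decomposition by polynomials. If \<open>X^k q\<close> annihilates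
  \<open>f\<close> and \<open>q\<close> is a multiple of \<open>1 - X s\<close>, then
  \<open>(X s)^m\<close> evaluated at \<open>f\<close> is the projection onto the part where
  \<open>f\<close> is invertible. It is a combination of positive powers of \<open>f\<close>, so its
  trace is 0; the trace is the rank, and the rank is 0 by characteristic 0.\<close>

lemma nilpotent_if_trc_powers_0:
  fixes f :: "'b \<Rightarrow> 'b"
  assumes E: "finite E" "independent E" and f: "lin f" "f ` span E \<subseteq> span E"
    and tr: "\<And>k. k > 0 \<Longrightarrow> trc E (f ^^ k) = 0"
    and char0: "\<And>n. of_nat n = (0::'a) \<Longrightarrow> n = 0"
  obtains m where "\<And>x. x \<in> span E \<Longrightarrow> (f ^^ m) x = 0"
proof -
  note mult = poly_act_mult[OF f(1)]
  obtain p where p: "p \<noteq> 0" "\<And>v. v \<in> span E \<Longrightarrow> poly_act f p v = 0"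
    using annihilating_poly[OF f(1) E(1) f(2)] by blast
  obtain q where q: "p = [:-0, 1:] ^ order 0 p * q" "\<not> [:-0, 1:] dvd q"
    using order_decomp[OF p(1), of 0] by auto
  \<comment> \<open>The successor makes \<open>m\<close> positive, so that the polynomial defining
    \<open>e\<close> has no constant term; \<open>tr\<close> says nothing about the trace of the
    identity.\<close>
  define m where "m = Suc (order 0 p)"
  obtain c r where cr: "q = pCons c r" by (cases q)
  have c: "c \<noteq> 0" using q(2) poly_eq_0_iff_dvd[of q 0] by (simp add: cr)
  define Y :: "'a poly" where "Y = [:0, 1:]"
  define s where "s = Polynomial.smult (- inverse c) r"
  have q': "q = Polynomial.smult c (1 - Y * s)"
    using c by (simp add: Y_def s_def cr smult_diff_right one_pCons)
  have Y0: "poly_act f (Y ^ m * (1 - Y * s)) v = 0" if "v \<in> span E" for v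
  proof -
    have "poly_act f (Polynomial.smult c (Y ^ m * (1 - Y * s))) v = poly_act f (Y * p) v"
      using q' q(1) by (simp add: m_def Y_def ac_simps)
    also have "\<dots> = 0" using p(2)[OF that] lin_0[OF linear_poly_act[OF f(1)]] by (simp add: mult)
    finally show ?thesis using c by (simp add: poly_act_smult)
  qed
  \<comment> \<open>On the image of \<open>Y ^ m\<close> the factor \<open>Y * s\<close> acts as the
    identity.\<close>
  have Yk: "poly_act f (Y ^ m * (Y * s) ^ k) v = poly_act f (Y ^ m) v" if v: "v \<in> span E" for v k
  proof (induction k)
    case (Suc k)
    have "Y ^ m * (Y * s) ^ k = Y ^ m * (Y * s) ^ Suc k + (Y * s) ^ k * (Y ^ m * (1 - Y * s))"
      by (simp add: algebra_simps)
    then have "poly_act f (Y ^ m * (Y * s) ^ k) v = poly_act f (Y ^ m * (Y * s) ^ Suc k) v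
        + poly_act f ((Y * s) ^ k) (poly_act f (Y ^ m * (1 - Y * s)) v)"
      by (simp only: poly_act_add flip: mult)
    then show ?case using Suc Y0[OF v] lin_0[OF linear_poly_act[OF f(1)]] by simp
  qed simp
  define e where "e = poly_act f ((Y * s) ^ m)"
  have le: "lin e" unfolding e_def by (rule linear_poly_act[OF f(1)])
  have eE: "e ` span E \<subseteq> span E" using poly_act_in_span[OF f] by (auto simp: e_def)
  have ee: "e (e v) = e v" if "v \<in> span E" for v
  proof -
    have "e (e v) = poly_act f ((s ^ m) * (Y ^ m * (Y * s) ^ m)) v"
      unfolding e_def by (simp add: power_mult_distrib ac_simps flip: mult)
    also have "\<dots> = poly_act f (s ^ m) (poly_act f (Y ^ m) v)" unfolding mult[of "s ^ m"] Yk[OF that] ..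
    also have "\<dots> = e v" unfolding e_def by (simp add: power_mult_distrib ac_simps flip: mult)
    finally show ?thesis .
  qed
  have "coeff ((Y * s) ^ m) 0 = 0" by (simp add: Y_def m_def)
  then have "trc E e = 0"
    unfolding e_def trc_poly_act[OF f(1) E(2) f(2)] using tr
    by (intro sum.neutral ballI) (metis mult_eq_0_iff neq0_conv)
  then have "of_nat (dim (e ` span E)) = (0::'a)" using trc_idempotent[OF E le eE ee] by simp
  then have d: "dim (e ` span E) = 0" by (rule char0)
  have "e v = 0" if v: "v \<in> span E" for v
  proof (rule ccontr)
    assume "e v \<noteq> 0"
    interpret e: Vector_Spaces.linear scale scale e by fact
    have "subspace (e ` span E)" by (intro e.subspace_image subspace_span)
    then obtain C where C: "finite C" "independent C" "span C = e ` span E"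
      using finite_basis_of_subspace[OF E(1) _ eE] by blast
    then have "C = {}" using d by (metis card_0_eq dim_span_eq_card_independent)
    then show False using C(3) \<open>e v \<noteq> 0\<close> v by auto
  qed
  then have "poly_act f (Y ^ m) v = 0" if "v \<in> span E" for v
    using Yk[OF that, of m] that lin_0[OF linear_poly_act[OF f(1)]] by (simp add: mult e_def)
  moreover have "Y ^ m = monom 1 m" by (simp add: Y_def monom_altdef)
  ultimately show ?thesis using that[of m] poly_act_funpow[OF f(1)] by simp
qed

lemma exists_lin_extension:
  assumes "independent C"
  obtains p where "lin p" "\<And>b. b \<in> C \<Longrightarrow> p b = h b"
proof -
  interpret pr: vector_space_pair scale scale by unfold_locales
  show ?thesis using pr.linear_independent_extend[OF assms, of h] that by blast
qed

text \<open>Deflation: \<open>E\<close> is exchanged for a basis containing \<open>w\<close>, and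
  \<open>g\<close> is the compression of \<open>f\<close>, along \<open>w\<close>, to the span of
  the remaining vectors \<open>C\<close>. It represents \<open>f\<close> on the quotient by the line
  of \<open>w\<close>; hence its powers are the compressions of the powers of
  \<open>f\<close>.\<close>

lemma trc_funpow_split_eigenvector:
  assumes E: "finite E" "independent E" and f: "lin f" "f ` span E \<subseteq> span E"
    and w: "w \<in> span E" "w \<noteq> 0" "f w = a *s w"
  obtains C g where "finite C" "independent C" "card E = Suc (card C)" "lin g"
    "g ` span C \<subseteq> span C" "\<And>k. trc E (f ^^ k) = a ^ k + trc C (g ^^ k)"
proof -
  have "independent {w}" using w by simp
  then obtain E' where E': "{w} \<subseteq> E'" "E' \<subseteq> span E" "independent E'" "span E \<subseteq> span E'"
    using maximal_independent_subset_extend[of "{w}" "span E"] w by auto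
  have sp: "span E' = span E" using E'(2,4) by (metis span_minimal subspace_span subset_antisym)
  have fin: "finite E'" using independent_span_bound[OF E(1) E'(3,2)] by simp
  have card: "card E' = card E"
    using sp E(2) E'(3) by (metis dim_span_eq_card_independent)
  define C where "C = E' - {w}"
  have C: "finite C" "independent C" "w \<notin> C" "E' = insert w C"
    using fin E'(1,3) by (auto simp: C_def dest: independent_mono)
  then have card_C: "card E = Suc (card C)" by (metis card card_insert_disjoint)
  obtain p where p: "lin p" "\<And>b. b \<in> E' \<Longrightarrow> p b = (if b = w then 0 else b)"
    using exists_lin_extension[OF E'(3), of "\<lambda>b. if b = w then 0 else b"] by blast
  have px: "p x = (\<Sum>b\<in>C. representation E' x b *s b)" if x: "x \<in> span E'" for x
  proof -
    have "p x = p (\<Sum>b\<in>E'. representation E' x b *s b)"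
      using sum_representation[OF fin E'(3) x] by simp
    also have "\<dots> = (\<Sum>b\<in>E'. representation E' x b *s p b)"
      by (simp add: Vector_Spaces.linear.axioms module_hom.sum[OF Vector_Spaces.linear.axioms(3)[OF p(1)]] lin_scale[OF p(1)])
    also have "\<dots> = (\<Sum>b\<in>C. representation E' x b *s b)"
      using C p(2) by (simp add: E'(1)) (intro sum.cong, auto)
    finally show ?thesis .
  qed
  have pC: "p x \<in> span C" if "x \<in> span E'" for x
    unfolding px[OF that] by (intro span_sum span_scale span_base)
  have repC: "representation C (p x) b = representation E' x b" if "x \<in> span E'" "b \<in> C" for x b
  proof -
    have "representation C (p x) = (\<lambda>c. \<Sum>b\<in>C. representation C (representation E' x b *s b) c)"
      unfolding px[OF that(1)] by (intro representation_sum C span_scale span_base)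
    then show ?thesis
      using that(2) C(1,2) by (simp add: representation_scale representation_basis span_base if_distrib cong: if_cong)
  qed
  have pdiff: "\<exists>c. x = p x + c *s w" if x: "x \<in> span E'" for x
  proof -
    have "x = (\<Sum>b\<in>E'. representation E' x b *s b)" using sum_representation[OF fin E'(3) x] by simp
    also have "\<dots> = p x + representation E' x w *s w"
      using C px[OF x] by (simp add: add.commute)
    finally show ?thesis by blast
  qed
  have spC: "span C \<subseteq> span E'" using C(4) by (intro span_mono) auto
  have fE': "f ` span E' \<subseteq> span E'" using f(2) sp by simp
  have pid: "p x = x" if "x \<in> span C" for x
    using that
  proof (induction rule: module.span_induct_alt[OF module_axioms, consumes 1, case_names base step])
    case base
    then show ?case using lin_0[OF p(1)] .
  next
    case (step c x y)
    moreover have "p x = x" using p(2) step C by auto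
    ultimately show ?case by (simp add: lin_add[OF p(1)] lin_scale[OF p(1)])
  qed
  have pw: "p w = 0" using p(2) C by simp
  define g where "g = (\<lambda>x. p (f x))"
  have g: "lin g" "g ` span C \<subseteq> span C"
    unfolding g_def using lin_compose[OF p(1) f(1)] fE' spC pC by auto
  have pow: "p ((f ^^ k) x) = (g ^^ k) x" if x: "x \<in> span C" for k x
  proof (induction k)
    case 0
    then show ?case using pid[OF x] by simp
  next
    case (Suc k)
    have z: "(f ^^ k) x \<in> span E'" using funpow_in_span[OF f(1) fE'] x spC by blast
    then obtain c where c: "(f ^^ k) x = p ((f ^^ k) x) + c *s w" using pdiff by blast
    have "p ((f ^^ Suc k) x) = p (f (p ((f ^^ k) x) + c *s w))" using c by simp
    also have "\<dots> = g (p ((f ^^ k) x))"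
      by (simp add: lin_add[OF f(1)] lin_scale[OF f(1)] lin_add[OF p(1)] lin_scale[OF p(1)] w(3) pw g_def)
    finally show ?case using Suc by simp
  qed
  have fw: "(f ^^ k) w = a ^ k *s w" for k
    by (induction k) (simp_all add: lin_scale[OF f(1)] w(3) mult.commute)
  have "trc E (f ^^ k) = a ^ k + trc C (g ^^ k)" for k
  proof -
    have sub: "(f ^^ k) ` span E \<subseteq> span E'" using funpow_in_span[OF f] sp by auto
    have "trc E (f ^^ k) = trc E' (f ^^ k)"
      using trc_restrict[OF E fin E'(3) linear_funpow[OF f(1)] sub] sp by simp
    also have "\<dots> = representation E' ((f ^^ k) w) w + (\<Sum>b\<in>C. representation E' ((f ^^ k) b) b)"
      unfolding trc_def using C by simp
    also have "representation E' ((f ^^ k) w) w = a ^ k"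
      using E'(1,3) by (simp add: fw representation_scale representation_basis span_base)
    also have "(\<Sum>b\<in>C. representation E' ((f ^^ k) b) b) = trc C (g ^^ k)"
      unfolding trc_def
    proof (intro sum.cong refl)
      fix b assume b: "b \<in> C"
      have "(f ^^ k) b \<in> span E'"
        using funpow_in_span[OF f(1) fE'] b spC span_base[of b C] by blast
      then show "representation E' ((f ^^ k) b) b = representation C ((g ^^ k) b) b"
        using repC b pow[OF span_base[OF b]] by metis
    qed
    finally show ?thesis .
  qed
  then show ?thesis using that C card_C g by blast
qed

end

section \<open>Eigenvalues over an algebraically closed field and scalar extension\<close>

lemma sum_fun_apply: "(\<Sum>a\<in>A. f a) x = (\<Sum>a\<in>A. f a x)"
  by (induction A rule: infinite_finite_induct) simp_all

text \<open>A linear factor \<open>X - a\<close> is split off an annihilator of \<open>v\<close>;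
  the quotient either sends \<open>v\<close> to an eigenvector or is an annihilator of smaller
  degree.\<close>

lemma exists_eigenvector:
  fixes scale :: "'a::alg_closed_field \<Rightarrow> 'b::ab_group_add \<Rightarrow> 'b"
  assumes "trace_space scale" and E: "finite E" and f: "Vector_Spaces.linear scale scale f"
    and fE: "f ` module.span scale E \<subseteq> module.span scale E" and v: "v \<in> module.span scale E" "v \<noteq> 0"
  obtains a w where "w \<in> module.span scale E" "w \<noteq> 0" "f w = scale a w"
proof -
  interpret trace_space scale by fact
  obtain p where p: "p \<noteq> 0" "poly_act f p v = 0"
    using annihilating_poly_vector[OF f E fE v(1)] by blast
  have "\<exists>a w. w \<in> span E \<and> w \<noteq> 0 \<and> f w = scale a w"
    using p v
  proof (induction "degree p" arbitrary: p v)
    case 0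
    then obtain c where "p = [:c:]" using degree_eq_zeroE by metis
    then show ?case using 0 by (simp add: poly_act_pCons[OF f] lin_0[OF f])
  next
    case (Suc n)
    then obtain a where "poly p a = 0" using alg_closed_imp_poly_has_root[of p] by auto
    then obtain q where q: "p = [:- a, 1:] * q" by (metis dvdE poly_eq_0_iff_dvd)
    then have q0: "q \<noteq> 0" using Suc by auto
    then have dq: "n = degree q"
      using Suc(2) unfolding q by (subst (asm) degree_mult_eq) auto
    define w where "w = poly_act f q v"
    have wE: "w \<in> span E" using poly_act_in_span[OF f fE] Suc by (simp add: w_def)
    have "f w - scale a w = 0"
      using Suc(4) unfolding q poly_act_mult[OF f] w_def[symmetric]
      by (simp add: poly_act_pCons[OF f] lin_0[OF f])
    then show ?case using Suc(1)[OF dq q0 _ Suc(5,6)] wE w_def by (cases "w = 0") auto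
  qed
  then show ?thesis using that by blast
qed

lemma trc_funpow_eq_power_sums:
  fixes scale :: "'a::alg_closed_field \<Rightarrow> 'b::ab_group_add \<Rightarrow> 'b"
  assumes "trace_space scale" and "finite E" "\<not> module.dependent scale E"
    and "Vector_Spaces.linear scale scale f" "f ` module.span scale E \<subseteq> module.span scale E"
  shows "\<exists>as. \<forall>k. trace_space.trc scale E (f ^^ k) = (\<Sum>a\<leftarrow>as. a ^ k)"
proof -
  interpret trace_space scale by fact
  show ?thesis
    using assms(2-)
  proof (induction "card E" arbitrary: E f)
    case 0
    then show ?case by (intro exI[of _ "[]"]) (simp add: trc_def)
  next
    case (Suc n)
    then have "E \<noteq> {}" by auto
    then obtain v where "v \<in> E" by blast
    then have "v \<in> span E" "v \<noteq> 0" using span_base Suc dependent_zero by blast+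
    then obtain a w where w: "w \<in> span E" "w \<noteq> 0" "f w = scale a w"
      using exists_eigenvector[OF assms(1) Suc(3,5,6)] by blast
    obtain C g where C: "finite C" "independent C" "card E = Suc (card C)" "lin g"
      "g ` span C \<subseteq> span C" "\<And>k. trc E (f ^^ k) = a ^ k + trc C (g ^^ k)"
      using trc_funpow_split_eigenvector[OF Suc(3,4,5,6) w] by blast
    then have "n = card C" using Suc(2) by simp
    from Suc(1)[OF this C(1,2,4,5)] obtain as where "\<forall>k. trc C (g ^^ k) = (\<Sum>a\<leftarrow>as. a ^ k)" by blast
    then have "\<forall>k. trc E (f ^^ k) = (\<Sum>a\<leftarrow>a # as. a ^ k)" using C(6) by simp
    then show ?case by blast
  qed
qed

text \<open>Scalar extension without tensor products: the extended space consists of the functions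
  into the algebraic closure supported on \<open>B\<close>, \<open>F\<close> is the matrix of
  \<open>f\<close> on them, and \<open>j\<close> embeds the original space. The fixed vector is
  split off first, which puts the eigenvalue 1 into the list.\<close>

lemma trc_funpow_eq_power_sums_alg_closure:
  fixes scale :: "'f::field \<Rightarrow> 'v::ab_group_add \<Rightarrow> 'v"
  assumes "trace_space scale" and B: "finite B" "\<not> module.dependent scale B"
    and f: "Vector_Spaces.linear scale scale f" and fB: "f ` module.span scale B \<subseteq> module.span scale B"
    and v: "v \<in> module.span scale B" "v \<noteq> 0" "f v = v"
  shows "\<exists>as. 1 \<in> set as \<and> (\<forall>k. to_ac (trace_space.trc scale B (f ^^ k)) = (\<Sum>a\<leftarrow>as. a ^ k))"
proof -
  interpret trace_space scale by fact
  define sc :: "'f alg_closure \<Rightarrow> ('v \<Rightarrow> 'f alg_closure) \<Rightarrow> 'v \<Rightarrow> 'f alg_closure"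
    where "sc = (\<lambda>c x i. c * x i)"
  interpret K: trace_space sc
    by unfold_locales (auto simp: sc_def fun_eq_iff algebra_simps)
  define e :: "'v \<Rightarrow> 'v \<Rightarrow> 'f alg_closure" where "e = (\<lambda>b i. if i = b then 1 else 0)"
  define j where "j = (\<lambda>w i. to_ac (representation B w i))"
  define F where "F = (\<lambda>x i. if i \<in> B then \<Sum>b\<in>B. to_ac (representation B (f b) i) * x b else 0)"
  have F: "K.lin F"
    unfolding K.lin_iff by (auto simp: F_def sc_def fun_eq_iff algebra_simps sum.distrib sum_distrib_left)
  have sum_e: "(\<Sum>b\<in>B. sc (x b) (e b)) = (\<lambda>i. if i \<in> B then x i else 0)" for x
    using B(1) by (simp add: fun_eq_iff sc_def e_def sum_fun_apply if_distrib cong: if_cong)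
  have span_e: "x \<in> K.span (e ` B)" if "\<And>i. i \<notin> B \<Longrightarrow> x i = 0" for x
  proof -
    have "x = (\<Sum>b\<in>B. sc (x b) (e b))" unfolding sum_e using that by auto
    also have "\<dots> \<in> K.span (e ` B)" by (intro K.span_sum K.span_scale K.span_base) auto
    finally show ?thesis .
  qed
  have supp: "x i = 0" if "x \<in> K.span (e ` B)" "i \<notin> B" for x i
    using that
    by (induction rule: module.span_induct_alt[OF K.module_axioms, consumes 1, case_names base step])
      (auto simp: sc_def e_def split: if_splits)
  have inj: "inj e" by (auto simp: inj_def e_def fun_eq_iff split: if_splits)
  have ind: "\<not> K.dependent (e ` B)"
  proof
    assume "K.dependent (e ` B)"
    then obtain u w where u: "(\<Sum>w\<in>e ` B. sc (u w) w) = 0" "w \<in> e ` B" "u w \<noteq> 0"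
      using B(1) by (auto simp: K.dependent_finite)
    then obtain b where b: "b \<in> B" "w = e b" by blast
    have "(\<Sum>b\<in>B. sc (u (e b)) (e b)) = 0"
      using u(1) by (simp add: sum.reindex inj_on_subset[OF inj])
    then have "(\<lambda>i. if i \<in> B then u (e i) else 0) = 0" unfolding sum_e .
    then have "u (e b) = 0" using b by (auto simp: fun_eq_iff dest!: spec[of _ b])
    then show False using u b by simp
  qed
  have rep: "K.representation (e ` B) x (e b) = x b" if "x \<in> K.span (e ` B)" "b \<in> B" for x b
  proof -
    have "x = (\<Sum>b\<in>B. sc (x b) (e b))" unfolding sum_e using supp[OF that(1)] by auto
    then have "K.representation (e ` B) x = K.representation (e ` B) (\<Sum>b\<in>B. sc (x b) (e b))" by simp
    also have "\<dots> = (\<lambda>v. \<Sum>b\<in>B. K.representation (e ` B) (sc (x b) (e b)) v)"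
      by (intro K.representation_sum ind K.span_scale K.span_base) auto
    finally show ?thesis
      using that(2) B(1) ind inj
      by (simp add: K.representation_scale K.representation_basis K.span_base inj_eq if_distrib cong: if_cong)
  qed
  have jB: "j w i = 0" if "i \<notin> B" for w i
    using that representation_ne_zero[of B w i] by (auto simp: j_def)
  have je: "j b = e b" if "b \<in> B" for b
    using that B by (auto simp: j_def e_def representation_basis)
  interpret f: Vector_Spaces.linear scale scale f by fact
  have Fj: "F (j w) = j (f w)" if w: "w \<in> span B" for w
  proof
    fix i
    have "f w = (\<Sum>c\<in>B. scale (representation B w c) (f c))"
      using sum_representation[OF B w] by (metis (no_types, lifting) f.scale f.sum sum.cong)
    moreover have "representation B (\<Sum>c\<in>B. scale (representation B w c) (f c)) =
        (\<lambda>b. \<Sum>c\<in>B. representation B (scale (representation B w c) (f c)) b)"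
      using fB by (intro representation_sum B) (blast intro: span_scale span_base)
    ultimately have "representation B (f w) i = (\<Sum>c\<in>B. representation B w c * representation B (f c) i)"
      using fB B by (auto intro!: sum.cong simp: representation_scale span_base image_subset_iff)
    then show "F (j w) i = j (f w) i"
      using jB[of i "f w"] by (auto simp: F_def j_def to_ac_sum mult.commute)
  qed
  have Fspan: "F ` K.span (e ` B) \<subseteq> K.span (e ` B)"
    by (auto intro!: span_e simp: F_def)
  have pow: "(F ^^ k) (j w) = j ((f ^^ k) w)" if "w \<in> span B" for k w
    using that funpow_in_span[OF f fB] by (induction k) (auto simp: Fj)
  have tr: "K.trc (e ` B) (F ^^ k) = to_ac (trc B (f ^^ k))" for k
  proof -
    have "K.trc (e ` B) (F ^^ k) = (\<Sum>b\<in>B. K.representation (e ` B) ((F ^^ k) (e b)) (e b))"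
      unfolding K.trc_def by (simp add: sum.reindex inj_on_subset[OF inj])
    also have "\<dots> = (\<Sum>b\<in>B. (F ^^ k) (e b) b)"
      by (intro sum.cong refl rep K.funpow_in_span[OF F Fspan] K.span_base) auto
    also have "\<dots> = to_ac (trc B (f ^^ k))"
      unfolding trc_def to_ac_sum using pow span_base je by (intro sum.cong refl) (metis j_def)
    finally show ?thesis .
  qed
  have j0: "j v \<noteq> 0"
  proof
    assume j0: "j v = 0"
    have "representation B v i = 0" for i
    proof -
      have "j v i = 0" using j0 by simp
      then show ?thesis unfolding j_def by simp
    qed
    then show False using sum_representation[OF B v(1)] v(2) by simp
  qed
  have eig: "F (j v) = sc 1 (j v)" using Fj[OF v(1)] v(3) by (simp add: sc_def)
  have jv: "j v \<in> K.span (e ` B)" using jB by (intro span_e)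
  have fin: "finite (e ` B)" using B(1) by simp
  obtain C g where C: "finite C" "\<not> K.dependent C" "K.lin g" "g ` K.span C \<subseteq> K.span C"
      "\<And>k. K.trc (e ` B) (F ^^ k) = 1 ^ k + K.trc C (g ^^ k)"
    by (rule K.trc_funpow_split_eigenvector[OF fin ind F Fspan jv j0 eig]) (rule that)
  obtain as where "\<And>k. K.trc C (g ^^ k) = (\<Sum>a\<leftarrow>as. a ^ k)"
    using trc_funpow_eq_power_sums[OF K.trace_space_axioms C(1-4)] by blast
  then have "\<forall>k. to_ac (trc B (f ^^ k)) = (\<Sum>a\<leftarrow>1 # as. a ^ k)"
    using C(5) tr by simp
  then show ?thesis by (intro exI[of _ "1 # as"]) simp
qed

section \<open>Positivity and the trace of an inverse operator\<close>

text \<open>Values of a rational functional have nonnegative squares although the field itself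
  carries no order; the normalization at 1 is what later yields a nonzero square.\<close>

lemma exists_rat_linear_functional:
  obtains \<theta> :: "'k::field_char_0 \<Rightarrow> rat"
  where "\<And>x y. \<theta> (x + y) = \<theta> x + \<theta> y" "\<And>q x. \<theta> (of_rat q * x) = q * \<theta> x" "\<theta> 1 = 1"
proof -
  define sc :: "rat \<Rightarrow> 'k \<Rightarrow> 'k" where "sc = (\<lambda>q x. of_rat q * x)"
  interpret V: vector_space sc
    by unfold_locales (auto simp: sc_def algebra_simps of_rat_add of_rat_mult)
  interpret Q: vector_space "(*) :: rat \<Rightarrow> rat \<Rightarrow> rat"
    by unfold_locales (auto simp: algebra_simps)
  interpret pr: vector_space_pair sc "(*) :: rat \<Rightarrow> rat \<Rightarrow> rat" by unfold_locales
  have "\<not> V.dependent {1}" by simp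
  from pr.linear_independent_extend[OF this, of "\<lambda>_. 1"] obtain \<theta>
    where \<theta>: "Vector_Spaces.linear sc (*) \<theta>" "\<theta> 1 = 1" by auto
  then show ?thesis using that[of \<theta>]
    unfolding Vector_Spaces.linear_iff by (auto simp: sc_def)
qed

lemma sum_swap3:
  "(\<Sum>x\<in>A. \<Sum>i\<in>B. \<Sum>j\<in>C. f x i j) = (\<Sum>i\<in>B. \<Sum>j\<in>C. \<Sum>x\<in>A. f x i j)"
proof -
  have "(\<Sum>x\<in>A. \<Sum>i\<in>B. \<Sum>j\<in>C. f x i j) = (\<Sum>i\<in>B. \<Sum>x\<in>A. \<Sum>j\<in>C. f x i j)" by (rule sum.swap)
  also have "\<dots> = (\<Sum>i\<in>B. \<Sum>j\<in>C. \<Sum>x\<in>A. f x i j)" by (intro sum.cong refl sum.swap)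
  finally show ?thesis .
qed

text \<open>By linearity the powers may be replaced by any polynomial; the one vanishing on
  \<open>P\<close> except at \<open>b\<close> isolates \<open>c b\<close>.\<close>

lemma weighted_power_sums_eq_0D:
  fixes c :: "'k::field \<Rightarrow> 'k"
  assumes "finite P" and "\<And>k. (\<Sum>b\<in>P. b ^ k * c b) = 0" and "b \<in> P"
  shows "c b = 0"
proof -
  have *: "(\<Sum>b\<in>P. poly p b * c b) = 0" for p
  proof -
    have "(\<Sum>b\<in>P. poly p b * c b) = (\<Sum>i\<le>degree p. coeff p i * (\<Sum>b\<in>P. b ^ i * c b))"
      unfolding poly_altdef sum_distrib_right sum_distrib_left
      by (subst sum.swap) (simp add: mult.assoc)
    then show ?thesis using assms(2) by simp
  qed
  define p where "p = (\<Prod>a\<in>P - {b}. [:- a, 1:])"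
  have "poly p a = 0" if "a \<in> P - {b}" for a
    using that assms(1) by (auto simp: p_def poly_prod)
  then have "(\<Sum>a\<in>P. poly p a * c a) = poly p b * c b"
    using assms(1,3) by (simp add: sum.remove)
  moreover have "poly p b \<noteq> 0" using assms(1) by (auto simp: p_def poly_prod)
  ultimately show ?thesis using *[of p] by simp
qed

text \<open>Grouped by \<open>\<alpha> i ^ M\<close>, the numbers \<open>\<alpha> i\<close> of a group \<open>b\<close> are \<open>\<gamma> b\<close> times roots of unity
  \<open>g i\<close> and add up to the size of the group. With \<open>s b\<close> the sum of the \<open>g i\<close>, the sum of the
  \<open>inverse (\<alpha> i)\<close> is \<open>D = \<Sum>b. s b * s' b / n b\<close>, where \<open>s'\<close> is the conjugate of \<open>s\<close>. Averaging over
  all roots of unity \<open>x\<close>, with a rational functional \<open>\<theta>\<close> in place of complex absolute values,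
  \<open>\<Sum>x. \<theta> x * \<theta> (x * D)\<close> becomes the sum of squares \<open>\<Sum>x. \<Sum>b. (\<theta> (x * s b))^2 / n b\<close>.\<close>

lemma sum_inverse_nonzero:
  fixes \<alpha> :: "'i \<Rightarrow> 'k::field_char_0"
  assumes I: "finite I" and nz: "\<And>i. i \<in> I \<Longrightarrow> \<alpha> i \<noteq> 0" and M: "M > 0"
    and tr: "\<And>k. (\<Sum>i\<in>I. \<alpha> i ^ (M * k) * (\<alpha> i - 1)) = 0"
    and one: "i0 \<in> I" "\<alpha> i0 = 1"
  shows "(\<Sum>i\<in>I. inverse (\<alpha> i)) \<noteq> 0"
proof
  assume D0: "(\<Sum>i\<in>I. inverse (\<alpha> i)) = 0"
  define P where "P = (\<lambda>i. \<alpha> i ^ M) ` I"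
  define J where "J = (\<lambda>b. {i \<in> I. \<alpha> i ^ M = b})"
  define n where "n = (\<lambda>b. card (J b))"
  have P: "finite P" using I by (simp add: P_def)
  have J: "finite (J b)" for b using I by (simp add: J_def)
  have group: "(\<Sum>i\<in>I. h i) = (\<Sum>b\<in>P. \<Sum>i\<in>J b. h i)" for h :: "'i \<Rightarrow> 'k"
    unfolding J_def P_def using I by (rule sum.image_gen)
  have n: "(\<Sum>i\<in>J b. \<alpha> i) = of_nat (n b)" if "b \<in> P" for b
  proof -
    have "(\<Sum>b\<in>P. b ^ k * (\<Sum>i\<in>J b. \<alpha> i - 1)) = 0" for k
    proof -
      have "(\<Sum>b\<in>P. b ^ k * (\<Sum>i\<in>J b. \<alpha> i - 1)) = (\<Sum>b\<in>P. \<Sum>i\<in>J b. \<alpha> i ^ (M * k) * (\<alpha> i - 1))"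
        unfolding sum_distrib_left by (intro sum.cong refl) (auto simp: J_def power_mult)
      also have "\<dots> = 0" unfolding group[symmetric] by (rule tr)
      finally show ?thesis .
    qed
    then have "(\<Sum>i\<in>J b. \<alpha> i - 1) = 0"
      using weighted_power_sums_eq_0D[OF P _ that, of "\<lambda>b. \<Sum>i\<in>J b. \<alpha> i - 1"] by blast
    then show ?thesis by (simp add: sum_subtractf n_def)
  qed
  have n0: "n b \<noteq> 0" if "b \<in> P" for b
    using that J[of b] by (auto simp: n_def P_def J_def)
  \<comment> \<open>The group of \<open>b = 1\<close> contains \<open>i0\<close>, and this choice of
    representative gives \<open>\<gamma> 1 = 1\<close>; so \<open>s 1\<close> is the size of that
    group, a positive integer on which \<open>\<theta>\<close> is known.\<close>
  define r where "r = (\<lambda>b. if b = 1 then i0 else (SOME i. i \<in> J b))"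
  have r: "r b \<in> J b" if "b \<in> P" for b
    using that one by (auto simp: r_def J_def P_def intro: someI2)
  define \<gamma> where "\<gamma> = (\<lambda>b. \<alpha> (r b))"
  have \<gamma>: "\<gamma> b \<noteq> 0" "\<gamma> b ^ M = b" if "b \<in> P" for b
    using r[OF that] nz by (auto simp: \<gamma>_def J_def)
  define g where "g = (\<lambda>b i. \<alpha> i / \<gamma> b)"
  define G where "G = {x::'k. x ^ M = 1}"
  have G: "finite G"
  proof -
    have "coeff (monom 1 M - 1 :: 'k poly) M \<noteq> 0" using M by simp
    then have "finite {x::'k. poly (monom 1 M - 1) x = 0}" by (intro poly_roots_finite) fastforce
    then show ?thesis by (simp add: G_def poly_monom)
  qed
  have gG: "g b i \<in> G" "g b i \<noteq> 0" if "b \<in> P" "i \<in> J b" for b i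
    using that \<gamma>[OF that(1)] nz by (auto simp: g_def G_def J_def power_divide)
  define s where "s = (\<lambda>b. \<Sum>i\<in>J b. g b i)"
  have s: "\<gamma> b * s b = of_nat (n b)" if "b \<in> P" for b
    using n[OF that] \<gamma>[OF that] by (simp add: s_def g_def sum_distrib_left)
  have inv: "(\<Sum>i\<in>J b. inverse (\<alpha> i)) = of_rat (1 / of_nat (n b)) * (\<Sum>i\<in>J b. \<Sum>j\<in>J b. g b i / g b j)"
    if b: "b \<in> P" for b
  proof -
    have "(\<Sum>i\<in>J b. inverse (\<alpha> i)) = inverse (\<gamma> b) * (\<Sum>j\<in>J b. inverse (g b j))"
      unfolding sum_distrib_left using \<gamma>[OF b] by (intro sum.cong refl) (simp add: g_def field_simps)
    also have "inverse (\<gamma> b) = s b / of_nat (n b)"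
      using s[OF b] \<gamma>[OF b] n0[OF b] by (simp add: field_simps)
    also have "s b / of_nat (n b) * (\<Sum>j\<in>J b. inverse (g b j)) =
        of_rat (1 / of_nat (n b)) * (\<Sum>i\<in>J b. \<Sum>j\<in>J b. g b i / g b j)"
      by (simp add: s_def sum_product of_rat_divide field_simps)
    finally show ?thesis .
  qed
  obtain \<theta> :: "'k \<Rightarrow> rat" where \<theta>: "\<And>x y. \<theta> (x + y) = \<theta> x + \<theta> y"
    "\<And>q x. \<theta> (of_rat q * x) = q * \<theta> x" "\<theta> 1 = 1"
    using exists_rat_linear_functional by blast
  have \<theta>0: "\<theta> 0 = 0" using \<theta>(2)[of 0 0] by simp
  have \<theta>sum: "\<theta> (\<Sum>i\<in>A. f i) = (\<Sum>i\<in>A. \<theta> (f i))" for A and f :: "'c \<Rightarrow> 'k"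
    by (induction A rule: infinite_finite_induct) (simp_all add: \<theta> \<theta>0)
  have square: "(\<Sum>x\<in>G. (\<theta> (x * s b))\<^sup>2) = (\<Sum>x\<in>G. \<theta> x * (\<Sum>i\<in>J b. \<Sum>j\<in>J b. \<theta> (x * (g b i / g b j))))"
    if b: "b \<in> P" for b
  proof -
    have "(\<Sum>x\<in>G. (\<theta> (x * s b))\<^sup>2) = (\<Sum>x\<in>G. \<Sum>i\<in>J b. \<Sum>j\<in>J b. \<theta> (x * g b i) * \<theta> (x * g b j))"
    proof -
      have "\<theta> (x * s b) = (\<Sum>i\<in>J b. \<theta> (x * g b i))" for x
        by (simp add: s_def sum_distrib_left \<theta>sum)
      then show ?thesis by (simp only: power2_eq_square sum_product)
    qed
    also have "\<dots> = (\<Sum>i\<in>J b. \<Sum>j\<in>J b. \<Sum>x\<in>G. \<theta> (x * g b i) * \<theta> (x * g b j))"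
      by (rule sum_swap3)
    also have "\<dots> = (\<Sum>i\<in>J b. \<Sum>j\<in>J b. \<Sum>x\<in>G. \<theta> (x * (g b i / g b j)) * \<theta> x)"
    proof (rule sum.cong[OF refl], rule sum.cong[OF refl])
      fix i j assume ij: "i \<in> J b" "j \<in> J b"
      \<comment> \<open>Multiplication by \<open>g b j\<close> permutes the finite group
        \<open>G\<close> of \<open>M\<close>-th roots of unity.\<close>
      show "(\<Sum>x\<in>G. \<theta> (x * g b i) * \<theta> (x * g b j)) = (\<Sum>x\<in>G. \<theta> (x * (g b i / g b j)) * \<theta> x)"
        using gG[OF b ij(2)]
        by (intro sum.reindex_bij_witness[of _ "\<lambda>x. x / g b j" "\<lambda>x. x * g b j"])
          (auto simp: G_def power_mult_distrib power_divide field_simps)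
    qed
    also have "\<dots> = (\<Sum>x\<in>G. \<Sum>i\<in>J b. \<Sum>j\<in>J b. \<theta> (x * (g b i / g b j)) * \<theta> x)"
      by (rule sum_swap3[symmetric])
    finally show ?thesis by (simp add: sum_distrib_left mult.commute)
  qed
  have "(\<Sum>b\<in>P. \<Sum>x\<in>G. (\<theta> (x * s b))\<^sup>2 / of_nat (n b)) = (\<Sum>x\<in>G. \<theta> x * \<theta> (x * (\<Sum>i\<in>I. inverse (\<alpha> i))))"
  proof -
    have 1: "\<theta> (x * (\<Sum>i\<in>I. inverse (\<alpha> i))) =
        (\<Sum>b\<in>P. (\<Sum>i\<in>J b. \<Sum>j\<in>J b. \<theta> (x * (g b i / g b j))) / of_nat (n b))" for x
    proof -
      have "x * (\<Sum>i\<in>I. inverse (\<alpha> i)) =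
          (\<Sum>b\<in>P. of_rat (1 / of_nat (n b)) * (\<Sum>i\<in>J b. \<Sum>j\<in>J b. x * (g b i / g b j)))"
      proof -
        have "(\<Sum>i\<in>I. inverse (\<alpha> i)) =
            (\<Sum>b\<in>P. of_rat (1 / of_nat (n b)) * (\<Sum>i\<in>J b. \<Sum>j\<in>J b. g b i / g b j))"
          unfolding group by (rule sum.cong[OF refl inv])
        then show ?thesis by (simp only: sum_distrib_left mult.left_commute)
      qed
      then show ?thesis by (simp add: \<theta>sum \<theta>(2))
    qed
    define T where "T = (\<lambda>b x. \<Sum>i\<in>J b. \<Sum>j\<in>J b. \<theta> (x * (g b i / g b j)))"
    have "(\<Sum>b\<in>P. \<Sum>x\<in>G. (\<theta> (x * s b))\<^sup>2 / of_nat (n b)) =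
       (\<Sum>b\<in>P. \<Sum>x\<in>G. \<theta> x * (T b x / of_nat (n b)))"
    proof (rule sum.cong[OF refl])
      fix b assume "b \<in> P"
      then show "(\<Sum>x\<in>G. (\<theta> (x * s b))\<^sup>2 / of_nat (n b)) = (\<Sum>x\<in>G. \<theta> x * (T b x / of_nat (n b)))"
        using square[of b] by (simp add: T_def flip: sum_divide_distrib)
    qed
    also have "\<dots> = (\<Sum>x\<in>G. \<theta> x * \<theta> (x * (\<Sum>i\<in>I. inverse (\<alpha> i))))"
      unfolding 1 by (subst sum.swap) (simp add: T_def sum_distrib_left sum_divide_distrib)
    finally show ?thesis .
  qed
  then have "(\<Sum>b\<in>P. \<Sum>x\<in>G. (\<theta> (x * s b))\<^sup>2 / of_nat (n b)) = 0" by (simp add: D0 \<theta>0)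
  then have "\<forall>b\<in>P. (\<Sum>x\<in>G. (\<theta> (x * s b))\<^sup>2 / of_nat (n b)) = 0"
    using P by (subst (asm) sum_nonneg_eq_0_iff) (auto intro!: sum_nonneg)
  moreover have 1: "1 \<in> P" "1 \<in> G" using one by (auto simp: P_def G_def image_iff intro!: bexI[of _ i0])
  ultimately have "\<forall>x\<in>G. (\<theta> (x * s 1))\<^sup>2 / of_nat (n 1) = 0"
    using G by (subst (asm) sum_nonneg_eq_0_iff) auto
  then have "\<theta> (s 1) = 0" using 1 n0 by force
  moreover have "s 1 = of_rat (of_nat (n 1)) * 1" using s[OF 1(1)] one by (simp add: \<gamma>_def r_def)
  ultimately show False using \<theta>(2)[of "of_nat (n 1)" 1] \<theta>(3) n0[OF 1(1)] by simp
qed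

text \<open>An annihilator of \<open>f\<close> with nonzero constant term gives \<open>q\<close>
  with \<open>q(f)\<close> inverse to \<open>f\<close>, so the trace of \<open>g\<close> is the sum
  of the values of \<open>q\<close> at the eigenvalues. The fixed vector \<open>v\<close> supplies
  the eigenvalue 1 that \<open>sum_inverse_nonzero\<close> asks for.\<close>

lemma trc_inverse_nonzero:
  fixes scale :: "'f::field_char_0 \<Rightarrow> 'v::ab_group_add \<Rightarrow> 'v"
  assumes "trace_space scale" and B: "finite B" "\<not> module.dependent scale B"
    and f: "Vector_Spaces.linear scale scale f" and fB: "f ` module.span scale B \<subseteq> module.span scale B"
    and v: "v \<in> module.span scale B" "v \<noteq> 0" "f v = v"
    and g: "\<And>x. x \<in> module.span scale B \<Longrightarrow> g x \<in> module.span scale B \<and> f (g x) = x \<and> g (f x) = x"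
    and M: "M > 0"
    and tr: "\<And>k. trace_space.trc scale B (f ^^ (M * k + 1)) = trace_space.trc scale B (f ^^ (M * k))"
  shows "trace_space.trc scale B g \<noteq> 0"
proof -
  interpret trace_space scale by fact
  obtain as where as: "1 \<in> set as" "\<And>k. to_ac (trc B (f ^^ k)) = (\<Sum>a\<leftarrow>as. a ^ k)"
    using trc_funpow_eq_power_sums_alg_closure[OF assms(1-8)] by blast
  define I where "I = {..<length as}"
  define \<alpha> where "\<alpha> = (\<lambda>i. as ! i)"
  have sum_as: "(\<Sum>a\<leftarrow>as. h a) = (\<Sum>i\<in>I. h (\<alpha> i))" for h :: "'f alg_closure \<Rightarrow> 'f alg_closure"
    by (simp add: sum_list_sum_nth I_def \<alpha>_def atLeast0LessThan)
  have trp: "to_ac (trc B (poly_act f p)) = (\<Sum>i\<in>I. poly (map_poly to_ac p) (\<alpha> i))" for p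
  proof -
    have "to_ac (trc B (poly_act f p)) = (\<Sum>k\<le>degree p. to_ac (coeff p k) * (\<Sum>i\<in>I. \<alpha> i ^ k))"
      by (simp add: trc_poly_act[OF f B(2) fB] to_ac_sum as(2) sum_as)
    also have "\<dots> = (\<Sum>i\<in>I. \<Sum>k\<le>degree p. to_ac (coeff p k) * \<alpha> i ^ k)"
      unfolding sum_distrib_left by (rule sum.swap)
    also have "\<dots> = (\<Sum>i\<in>I. poly (map_poly to_ac p) (\<alpha> i))"
      by (simp add: poly_altdef coeff_map_poly degree_map_poly)
    finally show ?thesis .
  qed
  have inj: "x = y" if "x \<in> span B" "y \<in> span B" "f x = f y" for x y
    using g[OF that(1)] g[OF that(2)] that(3) by metis
  obtain p where p: "p \<noteq> 0" "\<And>v. v \<in> span B \<Longrightarrow> poly_act f p v = 0"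
    using annihilating_poly[OF f B(1) fB] by blast
  obtain p' where p': "p = [:-0, 1:] ^ order 0 p * p'" "\<not> [:-0, 1:] dvd p'"
    using order_decomp[OF p(1), of 0] by auto
  \<comment> \<open>Injectivity of \<open>f\<close> on \<open>span B\<close> allows the factors
    \<open>X\<close> of the annihilator to be cancelled.\<close>
  have "poly_act f ([:0, 1:] ^ k * p') x = 0 \<Longrightarrow> poly_act f p' x = 0" if x: "x \<in> span B" for k x
  proof (induction k)
    case (Suc k)
    have "f (poly_act f ([:0, 1:] ^ k * p') x) = f 0"
      using Suc.prems by (simp add: mult.assoc poly_act_pCons[OF f] lin_0[OF f])
    then have "poly_act f ([:0, 1:] ^ k * p') x = 0"
      using inj poly_act_in_span[OF f fB x] span_zero by metis
    then show ?case by (rule Suc.IH)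
  qed simp
  then have p'0: "poly_act f p' x = 0" if "x \<in> span B" for x
    using that p(2) p'(1) by (metis minus_zero)
  obtain c r where cr: "p' = pCons c r" by (cases p')
  have c: "c \<noteq> 0" using p'(2) poly_eq_0_iff_dvd[of p' 0] by (simp add: cr)
  define q where "q = Polynomial.smult (- inverse c) r"
  have q: "[:0, 1:] * q = 1 + Polynomial.smult (- inverse c) p'"
    using c by (simp add: q_def cr one_pCons)
  have fq: "f (poly_act f q x) = x" if "x \<in> span B" for x
  proof -
    have "f (poly_act f q x) = poly_act f ([:0, 1:] * q) x" by (simp add: poly_act_pCons[OF f])
    also have "\<dots> = x" unfolding q poly_act_add poly_act_smult using p'0[OF that] by simp
    finally show ?thesis .
  qed
  have trg: "trc B g = trc B (poly_act f q)"
  proof (rule trc_cong)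
    fix b assume "b \<in> B"
    then have b: "b \<in> span B" by (rule span_base)
    show "g b = poly_act f q b"
      using inj[of "g b" "poly_act f q b"] g[OF b] fq[OF b] poly_act_in_span[OF f fB b] by simp
  qed
  \<comment> \<open>For \<open>R = X q - 1\<close> the traces of all \<open>f^k R(f)\<close> vanish.
    Grouping equal eigenvalues turns this into weighted power sums, so \<open>R\<close> vanishes at
    every \<open>\<alpha> i\<close>, multiplicities being nonzero in characteristic 0.\<close>
  have \<alpha>q: "\<alpha> i * poly (map_poly to_ac q) (\<alpha> i) = 1" if i: "i \<in> I" for i
  proof -
    define R where "R = [:0, 1:] * q - 1"
    define Q where "Q = map_poly to_ac q"
    have R: "poly (map_poly to_ac R) x = x * poly Q x - 1" for x
    proof -
      have "map_poly to_ac R = [:0, 1:] * Q - 1"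
        by (intro poly_eqI) (simp add: R_def Q_def coeff_map_poly coeff_pCons split: nat.splits)
      then show ?thesis by simp
    qed
    have R0: "poly_act f R x = 0" if "x \<in> span B" for x
    proof -
      have "R = Polynomial.smult (- inverse c) p'" using q by (simp add: R_def)
      then have "poly_act f R x = scale (- inverse c) (poly_act f p' x)" by (simp only: poly_act_smult)
      then show ?thesis using p'0[OF that] by simp
    qed
    have "(\<Sum>b\<in>\<alpha> ` I. b ^ k * (of_nat (card {i\<in>I. \<alpha> i = b}) * (b * poly Q b - 1))) = 0" for k
    proof -
      have "(\<Sum>b\<in>\<alpha> ` I. b ^ k * (of_nat (card {i\<in>I. \<alpha> i = b}) * (b * poly Q b - 1)))
          = (\<Sum>b\<in>\<alpha> ` I. \<Sum>i\<in>{i\<in>I. \<alpha> i = b}. \<alpha> i ^ k * (\<alpha> i * poly Q (\<alpha> i) - 1))"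
        by (intro sum.cong refl) (simp add: mult_ac)
      also have "\<dots> = (\<Sum>i\<in>I. \<alpha> i ^ k * (\<alpha> i * poly Q (\<alpha> i) - 1))"
        by (rule sum.image_gen[symmetric]) (simp add: I_def)
      also have "\<dots> = (\<Sum>i\<in>I. poly (map_poly to_ac (monom 1 k * R)) (\<alpha> i))"
      proof -
        have "map_poly to_ac (monom 1 k * R) = monom 1 k * map_poly to_ac R"
          by (intro poly_eqI) (simp add: coeff_map_poly coeff_monom_mult)
        then show ?thesis by (simp add: R poly_monom)
      qed
      also have "\<dots> = to_ac (trc B (poly_act f (monom 1 k * R)))" by (simp add: trp)
      also have "trc B (poly_act f (monom 1 k * R)) = 0"
        unfolding trc_def
        by (intro sum.neutral ballI)
          (simp add: poly_act_mult[OF f] R0 span_base lin_0[OF linear_poly_act[OF f]] representation_zero)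
      finally show ?thesis by simp
    qed
    then have "of_nat (card {j\<in>I. \<alpha> j = \<alpha> i}) * (\<alpha> i * poly Q (\<alpha> i) - 1) = 0"
      using weighted_power_sums_eq_0D[of "\<alpha> ` I" "\<lambda>b. of_nat (card {i\<in>I. \<alpha> i = b}) * (b * poly Q b - 1)" "\<alpha> i"] i
      by (simp add: I_def)
    moreover have "card {j\<in>I. \<alpha> j = \<alpha> i} \<noteq> 0" using i by (auto simp: I_def)
    ultimately show ?thesis by (simp add: Q_def)
  qed
  have "to_ac (trc B g) = (\<Sum>i\<in>I. inverse (\<alpha> i))"
    unfolding trg trp using \<alpha>q by (intro sum.cong refl) (metis inverse_unique)
  moreover have "(\<Sum>i\<in>I. inverse (\<alpha> i)) \<noteq> 0"
  proof -
    obtain i0 where i0: "i0 \<in> I" "\<alpha> i0 = 1" using as(1) by (auto simp: I_def \<alpha>_def in_set_conv_nth)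
    have "(\<Sum>i\<in>I. \<alpha> i ^ (M * k) * (\<alpha> i - 1)) = 0" for k
    proof -
      have "(\<Sum>i\<in>I. \<alpha> i ^ (M * k) * (\<alpha> i - 1)) =
          to_ac (trc B (f ^^ (M * k + 1))) - to_ac (trc B (f ^^ (M * k)))"
        unfolding as sum_as by (simp add: algebra_simps flip: sum_subtractf)
      then show ?thesis using tr by simp
    qed
    moreover have "\<alpha> i \<noteq> 0" if "i \<in> I" for i using \<alpha>q[OF that] by auto
    ultimately show ?thesis using sum_inverse_nonzero[of I \<alpha> M i0] i0 M by (simp add: I_def)
  qed
  ultimately show ?thesis by auto
qed

section \<open>Finite dimensional Hopf algebras\<close>

locale fin_basis = trace_space scale
  for scale :: "'f::field \<Rightarrow> 'h::ab_group_add \<Rightarrow> 'h" (infixr \<open>*s\<close> 75) +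
  fixes B :: "'h set"
  assumes finite_B: "finite B" and independent_B: "independent B" and span_B: "span B = UNIV"
begin

abbreviation coef :: "'h \<Rightarrow> 'h \<Rightarrow> 'f" where "coef \<equiv> representation B"

abbreviation tr :: "('h \<Rightarrow> 'h) \<Rightarrow> 'f" where "tr \<equiv> trc B"

definition lf :: "('h \<Rightarrow> 'f) \<Rightarrow> bool" where
  "lf p \<longleftrightarrow> (\<forall>x y. p (x + y) = p x + p y) \<and> (\<forall>c x. p (c *s x) = c * p x)"

definition bil :: "('h \<Rightarrow> 'h \<Rightarrow> 'f) \<Rightarrow> bool" where
  "bil F \<longleftrightarrow> (\<forall>a. lf (\<lambda>b. F a b)) \<and> (\<forall>b. lf (\<lambda>a. F a b))"

lemma in_span_B [simp]: "x \<in> span B"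
  by (simp add: span_B)

lemma sum_coef: "(\<Sum>b\<in>B. coef x b *s b) = x"
  by (rule sum_representation) (simp_all add: finite_B independent_B)

lemma coef_add: "coef (x + y) b = coef x b + coef y b"
  by (simp add: representation_add independent_B)

lemma coef_scale: "coef (c *s x) b = c * coef x b"
  by (simp add: representation_scale independent_B)

lemma coef_basis: "a \<in> B \<Longrightarrow> coef a b = (if b = a then 1 else 0)"
  by (simp add: representation_basis independent_B)

lemma coef_sum: "coef (\<Sum>i\<in>A. f i) b = (\<Sum>i\<in>A. coef (f i) b)"
  by (subst representation_sum) (auto simp: independent_B)

lemma coef_sum_basis: "a \<in> B \<Longrightarrow> coef (\<Sum>b\<in>B. c b *s b) a = c a"
  by (simp add: coef_sum coef_scale coef_basis finite_B if_distrib cong: if_cong)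

lemma lfD: "lf p \<Longrightarrow> p (x + y) = p x + p y" "lf p \<Longrightarrow> p (c *s x) = c * p x"
  by (simp_all add: lf_def)

lemma lf_0: "lf p \<Longrightarrow> p 0 = 0"
  using lfD(2)[of p 0 0] by simp

lemma lf_diff: "lf p \<Longrightarrow> p (x - y) = p x - p y"
  using lfD(1)[of p "x - y" y] by simp

lemma lf_sum: "lf p \<Longrightarrow> p (\<Sum>i\<in>A. f i) = (\<Sum>i\<in>A. p (f i))"
  by (induction A rule: infinite_finite_induct) (simp_all add: lf_0 lfD)

lemma lf_expand: "lf p \<Longrightarrow> p x = (\<Sum>b\<in>B. coef x b * p b)"
  using lf_sum[of p "\<lambda>b. coef x b *s b" B] by (simp add: sum_coef lfD)

lemma lf_coef: "lf (\<lambda>x. coef x b)"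
  by (simp add: lf_def coef_add coef_scale)

lemma eqI_lf: "(\<And>p. lf p \<Longrightarrow> p x = p y) \<Longrightarrow> x = y"
  using lf_coef sum_coef[of x] sum_coef[of y] by (metis (no_types, lifting) sum.cong)

text \<open>Rules establishing that an expression is linear in a variable; they discharge the
  linearity conditions attached to Sweedler manipulations. Individual proofs add the functionals and
  operators at hand.\<close>

named_theorems lf_intros

lemma lf_comp: "lf p \<Longrightarrow> lin g \<Longrightarrow> lf (\<lambda>x. p (g x))"
  by (simp add: lf_def lin_iff)

lemma lf_minus [lf_intros]: "lf p \<Longrightarrow> lf q \<Longrightarrow> lf (\<lambda>x. p x - q x)"
  by (simp add: lf_def algebra_simps)

lemma lf_cmult [lf_intros]: "lf p \<Longrightarrow> lf (\<lambda>x. c * p x)"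
  by (simp add: lf_def algebra_simps)

lemma lf_multc [lf_intros]: "lf p \<Longrightarrow> lf (\<lambda>x. p x * c)"
  by (simp add: lf_def algebra_simps)

lemma lf_sumI [lf_intros]: "(\<And>i. i \<in> A \<Longrightarrow> lf (p i)) \<Longrightarrow> lf (\<lambda>x. \<Sum>i\<in>A. p i x)"
  by (simp add: lf_def sum.distrib sum_distrib_left)

lemmas [lf_intros] = lf_comp[OF lf_coef]

lemma lin_scalec [lf_intros]: "lin g \<Longrightarrow> lin (\<lambda>x. c *s g x)"
  by (simp add: lin_iff scale_right_distrib mult.commute)

lemma lin_lf_scale [lf_intros]: "lf p \<Longrightarrow> lin (\<lambda>x. p x *s c)"
  by (simp add: lin_iff lf_def scale_left_distrib)

lemma lin_sumI [lf_intros]: "(\<And>i. i \<in> A \<Longrightarrow> lin (g i)) \<Longrightarrow> lin (\<lambda>x. \<Sum>i\<in>A. g i x)"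
  by (simp add: lin_iff sum.distrib scale_sum_right)

lemmas [lf_intros] = lin_id

lemma bilI: "(\<And>a. lf (\<lambda>b. F a b)) \<Longrightarrow> (\<And>b. lf (\<lambda>a. F a b)) \<Longrightarrow> bil F"
  by (simp add: bil_def)

lemma bil_lf1: "bil F \<Longrightarrow> lf (\<lambda>a. F a b)"
  by (simp add: bil_def)

lemma bil_lf2: "bil F \<Longrightarrow> lf (\<lambda>b. F a b)"
  by (simp add: bil_def)

lemma bil_expand:
  assumes "bil F"
  shows "F x y = (\<Sum>a\<in>B. \<Sum>b\<in>B. coef x a * coef y b * F a b)"
proof -
  have "F x y = (\<Sum>a\<in>B. coef x a * F a y)"
    using lf_expand[OF bil_lf1[OF assms]] .
  also have "\<dots> = (\<Sum>a\<in>B. coef x a * (\<Sum>b\<in>B. coef y b * F a b))"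
    using lf_expand[OF bil_lf2[OF assms]] by (intro sum.cong refl arg_cong2[where f = "(*)"])
  finally show ?thesis by (simp add: sum_distrib_left mult.assoc)
qed

lemma bil_intros: "bil F \<Longrightarrow> lin g \<Longrightarrow> lf (\<lambda>a. F (g a) b)" "bil F \<Longrightarrow> lin g \<Longrightarrow> lf (\<lambda>b. F a (g b))"
  using lf_comp[OF bil_lf1, of F g b] lf_comp[OF bil_lf2, of F g a] by simp_all

lemma tr_compose_commute: "lin f \<Longrightarrow> lin g \<Longrightarrow> tr (\<lambda>x. f (g x)) = tr (\<lambda>x. g (f x))"
  by (rule trc_compose_commute) (auto simp: finite_B independent_B)

lemma tr_sum: "tr (\<lambda>x. \<Sum>i\<in>A. f i x) = (\<Sum>i\<in>A. tr (f i))"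
  by (rule trc_sum) (auto simp: independent_B)

lemma tr_scale: "tr (\<lambda>x. c *s f x) = c * tr f"
  by (rule trc_scale) (auto simp: independent_B)

lemma tr_add: "tr (\<lambda>x. f x + g x) = tr f + tr g"
  by (rule trc_add) (auto simp: independent_B)

lemma lf_tr [lf_intros]: "(\<And>x. lin (\<lambda>y. g y x)) \<Longrightarrow> lf (\<lambda>y. tr (g y))"
  unfolding trc_def using lf_comp[OF lf_coef] by (intro lf_intros) blast

end

section \<open>Structure constants and Sweedler sums\<close>

text \<open>\<open>D h a b\<close> is the coefficient of \<open>a \<otimes> b\<close> in \<open>\<Delta>(h)\<close> for \<open>a\<close>, \<open>b\<close> in a fixed basis \<open>B\<close>, so that
  \<open>sw h F\<close> below is Sweedler's \<open>F h\<^sub>(\<^sub>1\<^sub>) h\<^sub>(\<^sub>2\<^sub>)\<close> for scalar valued bilinear \<open>F\<close>.\<close>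

locale fin_bialgebra = fin_basis scale B
  for scale :: "'f::field \<Rightarrow> 'h::ab_group_add \<Rightarrow> 'h" (infixr \<open>*s\<close> 75) and B :: "'h set" +
  fixes mult :: "'h \<Rightarrow> 'h \<Rightarrow> 'h" (infixl \<open>\<cdot>\<close> 76) and one :: 'h
    and D :: "'h \<Rightarrow> 'h \<Rightarrow> 'h \<Rightarrow> 'f" and eps :: "'h \<Rightarrow> 'f"
  assumes mult_add_left: "(x + y) \<cdot> z = x \<cdot> z + y \<cdot> z"
    and mult_add_right: "z \<cdot> (x + y) = z \<cdot> x + z \<cdot> y"
    and mult_scale_left: "(c *s x) \<cdot> y = c *s (x \<cdot> y)"
    and mult_scale_right: "x \<cdot> (c *s y) = c *s (x \<cdot> y)"
    and mult_assoc: "x \<cdot> y \<cdot> z = x \<cdot> (y \<cdot> z)"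
    and mult_one_left: "one \<cdot> x = x"
    and mult_one_right: "x \<cdot> one = x"
    and D_add: "D (x + y) a b = D x a b + D y a b"
    and D_scale: "D (c *s x) a b = c * D x a b"
    and D_coassoc: "\<lbrakk>p \<in> B; q \<in> B; r \<in> B\<rbrakk> \<Longrightarrow>
      (\<Sum>k\<in>B. D h k r * D k p q) = (\<Sum>k\<in>B. D h p k * D k q r)"
    and D_counit_left: "b \<in> B \<Longrightarrow> (\<Sum>a\<in>B. D h a b * eps a) = representation B h b"
    and D_counit_right: "a \<in> B \<Longrightarrow> (\<Sum>b\<in>B. D h a b * eps b) = representation B h a"
    and eps_add: "eps (x + y) = eps x + eps y"
    and eps_scale: "eps (c *s x) = c * eps x"
    and eps_mult: "eps (x \<cdot> y) = eps x * eps y"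
    and eps_one: "eps one = 1"
    and D_mult: "\<lbrakk>p \<in> B; q \<in> B\<rbrakk> \<Longrightarrow> D (x \<cdot> y) p q = (\<Sum>a\<in>B. \<Sum>b\<in>B. \<Sum>c\<in>B. \<Sum>d\<in>B.
      D x a b * D y c d * representation B (a \<cdot> c) p * representation B (b \<cdot> d) q)"
    and D_one: "\<lbrakk>p \<in> B; q \<in> B\<rbrakk> \<Longrightarrow> D one p q = representation B one p * representation B one q"
begin

definition sw :: "'h \<Rightarrow> ('h \<Rightarrow> 'h \<Rightarrow> 'f) \<Rightarrow> 'f" where
  "sw h F = (\<Sum>a\<in>B. \<Sum>b\<in>B. D h a b * F a b)"

lemma lf_eps: "lf eps"
  by (simp add: lf_def eps_add eps_scale)

lemma lf_sw_param [lf_intros]: "(\<And>a b. lf (\<lambda>x. F x a b)) \<Longrightarrow> lf (\<lambda>x. sw h (F x))"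
  unfolding sw_def by (intro lf_intros)

lemma lf_sw: "lf (\<lambda>x. sw x F)"
  by (simp add: lf_def sw_def D_add D_scale algebra_simps sum.distrib sum_distrib_left)

lemmas [lf_intros] = lf_comp[OF lf_sw] lf_comp[OF lf_eps]

lemma lin_mult_left [lf_intros]: "lin g \<Longrightarrow> lin (\<lambda>x. g x \<cdot> y)"
  by (simp add: lin_iff mult_add_left mult_scale_left)

lemma lin_mult_right [lf_intros]: "lin g \<Longrightarrow> lin (\<lambda>x. y \<cdot> g x)"
  by (simp add: lin_iff mult_add_right mult_scale_right)

lemma sw_sum: "sw h (\<lambda>a b. \<Sum>i\<in>A. F i a b) = (\<Sum>i\<in>A. sw h (F i))"
  unfolding sw_def sum_distrib_left by (simp only: sum.swap[of _ A])

lemma sw_cmult: "sw h (\<lambda>a b. c * F a b) = c * sw h F"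
  by (simp add: sw_def sum_distrib_left mult.left_commute)

lemma sw_multc: "sw h (\<lambda>a b. F a b * c) = sw h F * c"
  by (simp add: sw_def sum_distrib_right mult.assoc)

lemma sw_diff: "sw h (\<lambda>a b. F a b - G a b) = sw h F - sw h G"
  by (simp add: sw_def right_diff_distrib sum_subtractf)

lemma sw_zero: "sw h (\<lambda>a b. 0) = 0"
  by (simp add: sw_def)

lemma sw_swap: "sw x (\<lambda>a b. sw y (\<lambda>c d. F a b c d)) = sw y (\<lambda>c d. sw x (\<lambda>a b. F a b c d))"
proof -
  have "sw x (\<lambda>a b. sw y (F a b)) = (\<Sum>c\<in>B. \<Sum>d\<in>B. sw x (\<lambda>a b. D y c d * F a b c d))"
    by (simp add: sw_def[of y] sw_sum)
  then show ?thesis by (simp add: sw_cmult sw_def[of y])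
qed

lemma sw_lf:
  assumes "lf p"
  shows "p (\<Sum>a\<in>B. \<Sum>b\<in>B. D h a b *s F a b) = sw h (\<lambda>a b. p (F a b))"
  by (simp add: lf_sum[OF assms] lfD[OF assms] sw_def)

lemma sw_coassoc: "sw h (\<lambda>x c. sw x (\<lambda>a b. G a b c)) = sw h (\<lambda>a x. sw x (\<lambda>b c. G a b c))"
proof -
  have "sw h (\<lambda>x c. sw x (\<lambda>a b. G a b c)) =
      (\<Sum>x\<in>B. \<Sum>c\<in>B. \<Sum>a\<in>B. \<Sum>b\<in>B. D h x c * D x a b * G a b c)"
    by (simp add: sw_def sum_distrib_left mult.assoc)
  also have "\<dots> = (\<Sum>c\<in>B. \<Sum>a\<in>B. \<Sum>b\<in>B. \<Sum>x\<in>B. D h x c * D x a b * G a b c)"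
    by (subst sum.swap) (intro sum.cong refl sum_swap3)
  also have "\<dots> = (\<Sum>c\<in>B. \<Sum>a\<in>B. \<Sum>b\<in>B. (\<Sum>x\<in>B. D h x c * D x a b) * G a b c)"
    by (simp add: sum_distrib_right)
  also have "\<dots> = (\<Sum>c\<in>B. \<Sum>a\<in>B. \<Sum>b\<in>B. (\<Sum>x\<in>B. D h a x * D x b c) * G a b c)"
    by (intro sum.cong refl) (simp add: D_coassoc)
  also have "\<dots> = (\<Sum>a\<in>B. \<Sum>b\<in>B. \<Sum>c\<in>B. (\<Sum>x\<in>B. D h a x * D x b c) * G a b c)"
    by (rule sum_swap3)
  also have "\<dots> = (\<Sum>a\<in>B. \<Sum>b\<in>B. \<Sum>c\<in>B. \<Sum>x\<in>B. D h a x * (D x b c * G a b c))"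
    by (simp add: sum_distrib_right mult.assoc)
  also have "\<dots> = (\<Sum>a\<in>B. \<Sum>x\<in>B. \<Sum>b\<in>B. \<Sum>c\<in>B. D h a x * (D x b c * G a b c))"
    by (intro sum.cong refl sum_swap3[symmetric])
  also have "\<dots> = sw h (\<lambda>a x. sw x (\<lambda>b c. G a b c))"
    by (simp add: sw_def sum_distrib_left)
  finally show ?thesis .
qed

lemma sw_counit_left: "lf p \<Longrightarrow> sw h (\<lambda>a b. eps a * p b) = p h"
  unfolding lf_expand[of p h] sw_def
  by (subst sum.swap) (simp add: D_counit_left[symmetric] sum_distrib_right mult.assoc)

lemma sw_counit_right: "lf p \<Longrightarrow> sw h (\<lambda>a b. eps b * p a) = p h"
  unfolding lf_expand[of p h] sw_def
  by (simp add: D_counit_right[symmetric] sum_distrib_right mult.assoc)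

lemma sw_one: "bil F \<Longrightarrow> sw one F = F one one"
  by (simp add: bil_expand[of F one one] sw_def D_one)

lemma sw_mult:
  assumes "bil F"
  shows "sw (x \<cdot> y) F = sw x (\<lambda>a b. sw y (\<lambda>c d. F (a \<cdot> c) (b \<cdot> d)))"
proof -
  have "sw x (\<lambda>a b. sw y (\<lambda>c d. F (a \<cdot> c) (b \<cdot> d))) =
     sw x (\<lambda>a b. sw y (\<lambda>c d. \<Sum>p\<in>B. \<Sum>q\<in>B. coef (a \<cdot> c) p * coef (b \<cdot> d) q * F p q))"
    by (simp only: bil_expand[OF assms, symmetric])
  also have "\<dots> = (\<Sum>p\<in>B. \<Sum>q\<in>B. sw x (\<lambda>a b. sw y (\<lambda>c d. coef (a \<cdot> c) p * coef (b \<cdot> d) q)) * F p q)"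
    by (simp only: sw_sum sw_multc)
  also have "\<dots> = (\<Sum>p\<in>B. \<Sum>q\<in>B. D (x \<cdot> y) p q * F p q)"
    by (intro sum.cong refl) (simp add: D_mult sw_def sum_distrib_left mult.assoc)
  finally show ?thesis by (simp add: sw_def)
qed

end

locale fin_hopf = fin_bialgebra scale B mult one D eps
  for scale :: "'f::field \<Rightarrow> 'h::ab_group_add \<Rightarrow> 'h" (infixr \<open>*s\<close> 75)
    and B :: "'h set" and mult :: "'h \<Rightarrow> 'h \<Rightarrow> 'h" (infixl \<open>\<cdot>\<close> 76) and one :: 'h
    and D :: "'h \<Rightarrow> 'h \<Rightarrow> 'h \<Rightarrow> 'f" and eps :: "'h \<Rightarrow> 'f" +
  fixes S :: "'h \<Rightarrow> 'h"
  assumes lin_S: "lin S"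
    and sw_antipode_left: "lf p \<Longrightarrow> sw h (\<lambda>a b. p (S a \<cdot> b)) = eps h * p one"
    and sw_antipode_right: "lf p \<Longrightarrow> sw h (\<lambda>a b. p (a \<cdot> S b)) = eps h * p one"
begin

lemma lin_S_comp [lf_intros]: "lin g \<Longrightarrow> lin (\<lambda>x. S (g x))"
  by (rule lin_compose[OF lin_S])

lemma S_one: "S one = one"
proof (rule eqI_lf)
  fix p assume p: "lf p"
  note [lf_intros] = lf_comp[OF p]
  have "sw one (\<lambda>a b. p (S a \<cdot> b)) = p (S one \<cdot> one)"
    by (rule sw_one) (intro bilI lf_intros)
  then show "p (S one) = p one"
    by (simp add: sw_antipode_left[OF p] eps_one mult_one_right)
qed

lemma eps_S: "eps (S h) = eps h"
proof -
  have "sw h (\<lambda>a b. eps b * eps (S a)) = eps (S h)"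
    by (rule sw_counit_right) (intro lf_intros)
  moreover have "sw h (\<lambda>a b. eps (S a \<cdot> b)) = eps h * eps one"
    by (rule sw_antipode_left) (rule lf_eps)
  ultimately show ?thesis by (simp add: eps_mult eps_one mult.commute)
qed

text \<open>Both sides are convolution inverses of the multiplication map on
  \<open>H \<otimes> H\<close>: \<open>?T\<close> is the threefold convolution of
  \<open>S (x \<cdot> y)\<close>, the product and \<open>S y \<cdot> S x\<close>, evaluated once by
  cancelling the last two factors and once by cancelling the first two.\<close>

lemma S_mult: "S (x \<cdot> y) = S y \<cdot> S x"
proof (rule eqI_lf)
  fix p assume p: "lf p"
  note [lf_intros] = lf_comp[OF p]
  let ?G = "\<lambda>x1 x2 x3 y1 y2 y3. p (S (x1 \<cdot> y1) \<cdot> (x2 \<cdot> y2) \<cdot> (S y3 \<cdot> S x3))"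
  let ?T = "sw x (\<lambda>x1 x'. sw x' (\<lambda>x2 x3. sw y (\<lambda>y1 y'. sw y' (\<lambda>y2 y3. ?G x1 x2 x3 y1 y2 y3))))"
  have "?T = sw x (\<lambda>x1 x'. sw x' (\<lambda>x2 x3. sw y (\<lambda>y1 y'. eps y' * p (S (x1 \<cdot> y1) \<cdot> (x2 \<cdot> S x3)))))"
  proof -
    have "sw y' (\<lambda>y2 y3. ?G x1 x2 x3 y1 y2 y3) = eps y' * p (S (x1 \<cdot> y1) \<cdot> (x2 \<cdot> S x3))"
      for x1 x2 x3 y1 y'
    proof -
      have "sw y' (\<lambda>y2 y3. p (S (x1 \<cdot> y1) \<cdot> (x2 \<cdot> (y2 \<cdot> S y3) \<cdot> S x3))) =
          eps y' * p (S (x1 \<cdot> y1) \<cdot> (x2 \<cdot> one \<cdot> S x3))"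
        by (rule sw_antipode_right) (intro lf_intros)
      then show ?thesis by (simp add: mult_assoc mult_one_left)
    qed
    then show ?thesis by simp
  qed
  also have "\<dots> = sw x (\<lambda>x1 x'. sw x' (\<lambda>x2 x3. p (S (x1 \<cdot> y) \<cdot> (x2 \<cdot> S x3))))"
    by (subst sw_counit_right) (intro lf_intros, rule refl)
  also have "\<dots> = sw x (\<lambda>x1 x'. eps x' * p (S (x1 \<cdot> y) \<cdot> one))"
    by (subst sw_antipode_right) (intro lf_intros, rule refl)
  also have "\<dots> = p (S (x \<cdot> y))"
    by (subst sw_counit_right) (intro lf_intros, simp add: mult_one_right)
  finally have 1: "?T = p (S (x \<cdot> y))" .
  have "?T = sw x (\<lambda>a x3. sw a (\<lambda>x1 x2. sw y (\<lambda>b y3. sw b (\<lambda>y1 y2. ?G x1 x2 x3 y1 y2 y3))))"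
    unfolding sw_coassoc ..
  also have "\<dots> = sw x (\<lambda>a x3. sw y (\<lambda>b y3. sw a (\<lambda>x1 x2. sw b (\<lambda>y1 y2. ?G x1 x2 x3 y1 y2 y3))))"
    by (subst sw_swap) (rule refl)
  also have "\<dots> = sw x (\<lambda>a x3. sw y (\<lambda>b y3. sw (a \<cdot> b) (\<lambda>u v. p (S u \<cdot> v \<cdot> (S y3 \<cdot> S x3)))))"
    by (subst sw_mult) (intro bilI lf_intros, rule refl)
  also have "\<dots> = sw x (\<lambda>a x3. sw y (\<lambda>b y3. eps (a \<cdot> b) * p (one \<cdot> (S y3 \<cdot> S x3))))"
    by (subst sw_antipode_left) (intro lf_intros, rule refl)
  also have "\<dots> = sw x (\<lambda>a x3. eps a * sw y (\<lambda>b y3. eps b * p (S y3 \<cdot> S x3)))"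
    by (simp add: eps_mult mult_one_left mult.assoc sw_cmult)
  also have "\<dots> = sw x (\<lambda>a x3. eps a * p (S y \<cdot> S x3))"
    by (subst sw_counit_left) (intro lf_intros, rule refl)
  also have "\<dots> = p (S y \<cdot> S x)"
    by (rule sw_counit_left) (intro lf_intros)
  finally show "p (S (x \<cdot> y)) = p (S y \<cdot> S x)" using 1 by simp
qed

end

section \<open>The dual Hopf algebra\<close>

context fin_bialgebra
begin

text \<open>The form for which \<open>B\<close> is orthonormal; \<open>x\<close> thereby stands for
  the functional \<open>pair x\<close>.\<close>

definition pair :: "'h \<Rightarrow> 'h \<Rightarrow> 'f" where
  "pair x y = (\<Sum>b\<in>B. coef x b * coef y b)"

text \<open>Convolution of functionals under this identification. The dual coproduct accordingly has
  the coefficients \<open>pair x (a \<cdot> b)\<close>, and the dual counit is evaluation at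
  \<open>one\<close>.\<close>

definition dmult :: "'h \<Rightarrow> 'h \<Rightarrow> 'h" where
  "dmult x y = (\<Sum>c\<in>B. sw c (\<lambda>a b. pair x a * pair y b) *s c)"

definition dunit :: 'h where
  "dunit = (\<Sum>b\<in>B. eps b *s b)"


lemma pair_commute: "pair x y = pair y x"
  by (simp add: pair_def mult.commute)

lemma lf_pair: "lf (pair x)"
  unfolding pair_def[abs_def] by (intro lf_intros)

lemmas [lf_intros] = lf_comp[OF lf_pair]

lemma lf_pair2 [lf_intros]: "lin g \<Longrightarrow> lf (\<lambda>x. pair (g x) y)"
  using lf_comp[OF lf_pair, of g y] by (simp add: pair_commute[of y])

lemma pair_basis: "b \<in> B \<Longrightarrow> pair x b = coef x b"
  by (simp add: pair_def coef_basis finite_B if_distrib cong: if_cong)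

lemma pair_basis': "b \<in> B \<Longrightarrow> pair b x = coef x b"
  by (subst pair_commute) (rule pair_basis)

lemma lf_eqI: "lf p \<Longrightarrow> lf q \<Longrightarrow> (\<And>b. b \<in> B \<Longrightarrow> p b = q b) \<Longrightarrow> p x = q x"
  by (subst (1 2) lf_expand) auto

lemma pair_sum_basis: "lf p \<Longrightarrow> pair (\<Sum>b\<in>B. p b *s b) h = p h"
  by (rule lf_eqI) (auto simp: pair_basis coef_sum_basis lf_pair)

lemma eqI_pair: "(\<And>h. pair x h = pair y h) \<Longrightarrow> x = y"
  using sum_coef[of x] sum_coef[of y] by (metis (no_types, lifting) pair_basis sum.cong)

lemma pair_dmult: "pair (dmult x y) h = sw h (\<lambda>a b. pair x a * pair y b)"
  unfolding dmult_def by (rule pair_sum_basis) (rule lf_sw)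

lemma pair_dunit: "pair dunit h = eps h"
  unfolding dunit_def by (rule pair_sum_basis) (rule lf_eps)

lemma pair_add: "pair (x + y) h = pair x h + pair y h"
  by (simp add: pair_def coef_add algebra_simps sum.distrib)

lemma pair_scale: "pair (c *s x) h = c * pair x h"
  by (simp add: pair_def coef_scale algebra_simps sum_distrib_left)

lemma sum_coef_pair: "lf p \<Longrightarrow> (\<Sum>k\<in>B. pair k z * p k) = p z"
  by (subst lf_expand[of p z]) (auto intro!: sum.cong simp: pair_commute[of _ z] pair_basis)

lemma dual_bialgebra:
  "fin_bialgebra scale B dmult dunit (\<lambda>x a b. pair x (a \<cdot> b)) (\<lambda>x. pair x one)"
proof unfold_locales
  fix x y z :: 'h and c :: 'f
  show "dmult (x + y) z = dmult x z + dmult y z"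
    by (rule eqI_pair) (simp add: pair_dmult pair_add sw_def algebra_simps sum.distrib)
  show "dmult z (x + y) = dmult z x + dmult z y"
    by (rule eqI_pair) (simp add: pair_dmult pair_add sw_def algebra_simps sum.distrib)
  show "dmult (c *s x) y = c *s dmult x y"
    by (rule eqI_pair) (simp add: pair_dmult pair_scale sw_def algebra_simps sum_distrib_left)
  show "dmult x (c *s y) = c *s dmult x y"
    by (rule eqI_pair) (simp add: pair_dmult pair_scale sw_def algebra_simps sum_distrib_left)
  show "dmult (dmult x y) z = dmult x (dmult y z)"
  proof (rule eqI_pair)
    fix h
    have "pair (dmult (dmult x y) z) h = sw h (\<lambda>u d. sw u (\<lambda>a b. pair x a * pair y b * pair z d))"
      by (simp add: pair_dmult sw_multc)
    also have "\<dots> = sw h (\<lambda>a u. sw u (\<lambda>b d. pair x a * pair y b * pair z d))"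
      by (rule sw_coassoc)
    also have "\<dots> = pair (dmult x (dmult y z)) h"
      by (simp add: pair_dmult sw_cmult mult.assoc)
    finally show "pair (dmult (dmult x y) z) h = pair (dmult x (dmult y z)) h" .
  qed
  show "dmult dunit x = x"
    by (rule eqI_pair) (simp add: pair_dmult pair_dunit sw_counit_left[OF lf_pair])
  show "dmult x dunit = x"
    by (rule eqI_pair) (simp add: pair_dmult pair_dunit mult.commute sw_counit_right[OF lf_pair])
  fix a b
  show "pair (x + y) (a \<cdot> b) = pair x (a \<cdot> b) + pair y (a \<cdot> b)" by (rule pair_add)
  show "pair (c *s x) (a \<cdot> b) = c * pair x (a \<cdot> b)" by (rule pair_scale)
  show "pair (x + y) one = pair x one + pair y one" by (rule pair_add)
  show "pair (c *s x) one = c * pair x one" by (rule pair_scale)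
next
  fix p q r h
  have "(\<Sum>k\<in>B. pair h (k \<cdot> r) * pair k (p \<cdot> q)) = pair h (p \<cdot> q \<cdot> r)"
    using sum_coef_pair[of "\<lambda>k. pair h (k \<cdot> r)" "p \<cdot> q"] by (simp add: mult.commute lf_intros)
  moreover have "(\<Sum>k\<in>B. pair h (p \<cdot> k) * pair k (q \<cdot> r)) = pair h (p \<cdot> (q \<cdot> r))"
    using sum_coef_pair[of "\<lambda>k. pair h (p \<cdot> k)" "q \<cdot> r"] by (simp add: mult.commute lf_intros)
  ultimately show "(\<Sum>k\<in>B. pair h (k \<cdot> r) * pair k (p \<cdot> q)) = (\<Sum>k\<in>B. pair h (p \<cdot> k) * pair k (q \<cdot> r))"
    by (simp add: mult_assoc)
next
  fix b h assume b: "b \<in> B"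
  show "(\<Sum>a\<in>B. pair h (a \<cdot> b) * pair a one) = coef h b"
    using sum_coef_pair[of "\<lambda>a. pair h (a \<cdot> b)" one] b
    by (simp add: mult.commute lf_intros mult_one_left pair_basis)
  show "(\<Sum>a\<in>B. pair h (b \<cdot> a) * pair a one) = coef h b"
    using sum_coef_pair[of "\<lambda>a. pair h (b \<cdot> a)" one] b
    by (simp add: mult.commute lf_intros mult_one_right pair_basis)
next
  fix x y
  show "pair (dmult x y) one = pair x one * pair y one"
    unfolding pair_dmult by (rule sw_one) (intro bilI lf_intros)
  show "pair dunit one = 1" by (simp add: pair_dunit eps_one)
  fix p q assume pq: "p \<in> B" "q \<in> B"
  show "pair dunit (p \<cdot> q) = coef dunit p * coef dunit q"
    using pq by (simp add: pair_dunit eps_mult pair_basis[symmetric])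
  have "pair (dmult x y) (p \<cdot> q) = sw p (\<lambda>a b. sw q (\<lambda>c d. pair x (a \<cdot> c) * pair y (b \<cdot> d)))"
    unfolding pair_dmult by (rule sw_mult) (intro bilI lf_intros)
  also have "\<dots> = (\<Sum>a\<in>B. \<Sum>b\<in>B. \<Sum>c\<in>B. \<Sum>d\<in>B. D p a b * D q c d * pair x (a \<cdot> c) * pair y (b \<cdot> d))"
    by (simp add: sw_def sum_distrib_left mult.assoc)
  also have "\<dots> = (\<Sum>a\<in>B. \<Sum>c\<in>B. \<Sum>b\<in>B. \<Sum>d\<in>B. D p a b * D q c d * pair x (a \<cdot> c) * pair y (b \<cdot> d))"
    by (intro sum.cong refl sum.swap)
  also have "\<dots> = (\<Sum>a\<in>B. \<Sum>b\<in>B. \<Sum>c\<in>B. \<Sum>d\<in>B.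
      pair x (a \<cdot> b) * pair y (c \<cdot> d) * coef (dmult a c) p * coef (dmult b d) q)"
  proof -
    \<comment> \<open>The structure constants of the dual multiplication are those of the coproduct,
      so this axiom is the transpose of \<open>sw_mult\<close>.\<close>
    have *: "coef (dmult a c) p = D p a c" if "a \<in> B" "c \<in> B" "p \<in> B" for a c p
    proof -
      have "coef (dmult a c) p = sw p (\<lambda>u v. pair a u * pair c v)"
        using that pair_dmult by (simp flip: pair_basis)
      also have "\<dots> = (\<Sum>u\<in>B. if u = a then \<Sum>v\<in>B. if v = c then D p u v else 0 else 0)"
        unfolding sw_def using that
        by (intro sum.cong refl) (auto simp: pair_basis coef_basis intro!: sum.cong)
      also have "\<dots> = D p a c"
        using that by (simp add: finite_B)
      finally show ?thesis .
    qed
    show ?thesis using pq by (intro sum.cong refl) (simp add: * mult_ac)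
  qed
  finally show "pair (dmult x y) (p \<cdot> q) = (\<Sum>a\<in>B. \<Sum>b\<in>B. \<Sum>c\<in>B. \<Sum>d\<in>B.
      pair x (a \<cdot> b) * pair y (c \<cdot> d) * coef (dmult a c) p * coef (dmult b d) q)" .
qed

end

context fin_hopf
begin

definition dS :: "'h \<Rightarrow> 'h" where
  "dS x = (\<Sum>b\<in>B. pair x (S b) *s b)"

lemma pair_dS: "pair (dS x) h = pair x (S h)"
  unfolding dS_def by (rule pair_sum_basis[where p = "\<lambda>h. pair x (S h)"]) (intro lf_intros lin_S)

lemma dual_hopf: "fin_hopf scale B dmult dunit (\<lambda>x a b. pair x (a \<cdot> b)) (\<lambda>x. pair x one) dS"
proof -
  interpret dual: fin_bialgebra scale B dmult dunit "\<lambda>x a b. pair x (a \<cdot> b)" "\<lambda>x. pair x one"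
    by (rule dual_bialgebra)
  have sw: "dual.sw h (\<lambda>a b. coef u a * coef v b) = pair h (u \<cdot> v)" for h u v
  proof -
    have "bil (\<lambda>u v. pair h (u \<cdot> v))" by (intro bilI lf_intros)
    from bil_expand[OF this, of u v] show ?thesis
      by (simp add: dual.sw_def mult_ac)
  qed
  \<comment> \<open>Biduality: a functional on the dual is evaluation at the element
    \<open>w\<close>.\<close>
  have rep: "p (dmult x y) = sw w (\<lambda>a b. pair x a * pair y b)" "p dunit = eps w"
    if p: "lf p" "w = (\<Sum>b\<in>B. p b *s b)" for p w x y
  proof -
    have "pair w z = p z" for z
      unfolding p(2) by (rule pair_sum_basis[OF p(1)])
    then have "p z = pair z w" for z using pair_commute[of w z] by simp
    then show "p (dmult x y) = sw w (\<lambda>a b. pair x a * pair y b)" "p dunit = eps w"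
      by (simp_all add: pair_dmult pair_dunit)
  qed
  show ?thesis
  proof (intro fin_hopf.intro fin_hopf_axioms.intro dual_bialgebra)
    show "lin dS"
      unfolding dS_def[abs_def] by (intro lf_intros)
  next
    fix p h assume p: "lf p"
    define w where w: "w = (\<Sum>b\<in>B. p b *s b)"
    have "dual.sw h (\<lambda>a b. p (dmult (dS a) b)) = dual.sw h (\<lambda>a b. sw w (\<lambda>x y. coef (S x) a * coef y b))"
      unfolding dual.sw_def
      by (rule sum.cong[OF refl], rule sum.cong[OF refl]) (simp add: rep[OF p w] pair_dS pair_basis')
    also have "\<dots> = sw w (\<lambda>x y. dual.sw h (\<lambda>a b. coef (S x) a * coef y b))"
      by (simp only: sw_def dual.sw_sum dual.sw_cmult)
    also have "\<dots> = eps w * pair h one"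
      unfolding sw by (rule sw_antipode_left) (rule lf_pair)
    finally show "dual.sw h (\<lambda>a b. p (dmult (dS a) b)) = pair h one * p dunit"
      by (simp add: rep[OF p w] mult.commute)
    have "dual.sw h (\<lambda>a b. p (dmult a (dS b))) = dual.sw h (\<lambda>a b. sw w (\<lambda>x y. coef x a * coef (S y) b))"
      unfolding dual.sw_def
      by (rule sum.cong[OF refl], rule sum.cong[OF refl]) (simp add: rep[OF p w] pair_dS pair_basis')
    also have "\<dots> = sw w (\<lambda>x y. dual.sw h (\<lambda>a b. coef x a * coef (S y) b))"
      by (simp only: sw_def dual.sw_sum dual.sw_cmult)
    also have "\<dots> = eps w * pair h one"
      unfolding sw by (rule sw_antipode_right) (rule lf_pair)
    finally show "dual.sw h (\<lambda>a b. p (dmult a (dS b))) = pair h one * p dunit"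
      by (simp add: rep[OF p w] mult.commute)
  qed
qed

text \<open>The antipode reverses coproducts because \<open>S_mult\<close>, applied to the dual Hopf
  algebra, says that its transpose reverses products.\<close>

lemma sw_S:
  assumes F: "bil F"
  shows "sw (S h) F = sw h (\<lambda>a b. F (S b) (S a))"
proof -
  interpret dual: fin_hopf scale B dmult dunit "\<lambda>x a b. pair x (a \<cdot> b)" "\<lambda>x. pair x one" dS
    by (rule dual_hopf)
  have *: "sw (S h) (\<lambda>a b. coef a x * coef b y) = sw h (\<lambda>a b. coef (S b) x * coef (S a) y)"
    if "x \<in> B" "y \<in> B" for x y
  proof -
    have "sw (S h) (\<lambda>a b. pair x a * pair y b) = pair (dS (dmult x y)) h"
      by (simp add: pair_dmult pair_dS)
    also have "\<dots> = sw h (\<lambda>a b. pair x (S b) * pair y (S a))"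
      unfolding dual.S_mult by (simp add: pair_dmult pair_dS mult.commute)
    finally show ?thesis using that by (simp add: pair_commute[of x] pair_commute[of y] pair_basis)
  qed
  have "sw (S h) F = sw (S h) (\<lambda>a b. \<Sum>x\<in>B. \<Sum>y\<in>B. coef a x * coef b y * F x y)"
    by (simp only: bil_expand[OF F, symmetric])
  also have "\<dots> = (\<Sum>x\<in>B. \<Sum>y\<in>B. sw h (\<lambda>a b. coef (S b) x * coef (S a) y) * F x y)"
    unfolding sw_sum sw_multc by (intro sum.cong refl) (simp add: *)
  also have "\<dots> = sw h (\<lambda>a b. \<Sum>x\<in>B. \<Sum>y\<in>B. coef (S b) x * coef (S a) y * F x y)"
    unfolding sw_sum sw_multc ..
  also have "\<dots> = sw h (\<lambda>a b. F (S b) (S a))"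
    by (simp only: bil_expand[OF F, symmetric])
  finally show ?thesis .
qed

end

section \<open>The square of the antipode\<close>

locale hopf_with_integral = fin_hopf scale B mult one D eps S
  for scale :: "'f::field_char_0 \<Rightarrow> 'h::ab_group_add \<Rightarrow> 'h" (infixr \<open>*s\<close> 75)
    and B :: "'h set" and mult :: "'h \<Rightarrow> 'h \<Rightarrow> 'h" (infixl \<open>\<cdot>\<close> 76) and one :: 'h
    and D :: "'h \<Rightarrow> 'h \<Rightarrow> 'h \<Rightarrow> 'f" and eps :: "'h \<Rightarrow> 'f" and S :: "'h \<Rightarrow> 'h" +
  fixes t :: 'h
  assumes t_left: "h \<cdot> t = eps h *s t" and t_right: "t \<cdot> h = eps h *s t" and eps_t: "eps t = 1"
begin

section \<open>Coproduct identities for the integral \<open>t\<close>\<close>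

text \<open>Inserting \<open>S h1 \<cdot> h2\<close> in front of the first factor produces the
  coproduct of \<open>h' \<cdot> t\<close>, a multiple of that of \<open>t\<close>, with only
  \<open>S h1\<close> left over.\<close>

lemma sw_t_mult_right:
  assumes F: "bil F"
  shows "sw t (\<lambda>a b. F a (h \<cdot> b)) = sw t (\<lambda>a b. F (S h \<cdot> a) b)"
proof -
  note [lf_intros] = bil_intros[OF F]
  let ?G = "\<lambda>h1 h2 h3. sw t (\<lambda>a b. F (S h1 \<cdot> (h2 \<cdot> a)) (h3 \<cdot> b))"
  have "sw h (\<lambda>h1 h'. sw h' (\<lambda>h2 h3. ?G h1 h2 h3)) = sw h (\<lambda>h1 h'. sw (h' \<cdot> t) (\<lambda>u v. F (S h1 \<cdot> u) v))"
    by (subst sw_mult) (intro bilI lf_intros, rule refl)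
  also have "\<dots> = sw h (\<lambda>h1 h'. eps h' * sw t (\<lambda>u v. F (S h1 \<cdot> u) v))"
    by (simp add: t_left lfD(2)[OF lf_sw])
  also have "\<dots> = sw t (\<lambda>a b. F (S h \<cdot> a) b)"
    by (rule sw_counit_right) (intro lf_intros)
  finally have 1: "sw h (\<lambda>h1 h'. sw h' (\<lambda>h2 h3. ?G h1 h2 h3)) = sw t (\<lambda>a b. F (S h \<cdot> a) b)" .
  have "sw h (\<lambda>h1 h'. sw h' (\<lambda>h2 h3. ?G h1 h2 h3)) = sw h (\<lambda>z h3. sw z (\<lambda>h1 h2. ?G h1 h2 h3))"
    by (rule sw_coassoc[symmetric])
  also have "\<dots> = sw h (\<lambda>z h3. eps z * sw t (\<lambda>a b. F (one \<cdot> a) (h3 \<cdot> b)))"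
    unfolding mult_assoc[symmetric]
    by (subst sw_antipode_left[where p = "\<lambda>w. sw t (\<lambda>a b. F (w \<cdot> a) (_ \<cdot> b))"]) (intro lf_intros, rule refl)
  also have "\<dots> = sw t (\<lambda>a b. F a (h \<cdot> b))"
    by (subst sw_counit_left) (intro lf_intros, simp add: mult_one_left)
  finally show ?thesis using 1 by simp
qed

lemma sw_t_mult_left:
  assumes F: "bil F"
  shows "sw t (\<lambda>a b. F (a \<cdot> h) b) = sw t (\<lambda>a b. F a (b \<cdot> S h))"
proof -
  note [lf_intros] = bil_intros[OF F]
  let ?G = "\<lambda>h1 h2 h3. sw t (\<lambda>a b. F (a \<cdot> h1) (b \<cdot> h2 \<cdot> S h3))"
  have "sw h (\<lambda>z h3. sw z (\<lambda>h1 h2. ?G h1 h2 h3)) = sw h (\<lambda>z h3. sw (t \<cdot> z) (\<lambda>u v. F u (v \<cdot> S h3)))"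
    by (subst sw_mult, intro bilI lf_intros, subst sw_swap, rule refl)
  also have "\<dots> = sw h (\<lambda>z h3. eps z * sw t (\<lambda>u v. F u (v \<cdot> S h3)))"
    by (simp add: t_right lfD(2)[OF lf_sw])
  also have "\<dots> = sw t (\<lambda>a b. F a (b \<cdot> S h))"
    by (rule sw_counit_left) (intro lf_intros)
  finally have 1: "sw h (\<lambda>z h3. sw z (\<lambda>h1 h2. ?G h1 h2 h3)) = sw t (\<lambda>a b. F a (b \<cdot> S h))" .
  have "sw h (\<lambda>z h3. sw z (\<lambda>h1 h2. ?G h1 h2 h3)) = sw h (\<lambda>h1 h'. sw h' (\<lambda>h2 h3. ?G h1 h2 h3))"
    by (rule sw_coassoc)
  also have "\<dots> = sw h (\<lambda>h1 h'. eps h' * sw t (\<lambda>a b. F (a \<cdot> h1) (b \<cdot> one)))"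
    unfolding mult_assoc
    by (subst sw_antipode_right[where p = "\<lambda>w. sw t (\<lambda>a b. F (a \<cdot> _) (b \<cdot> w))"]) (intro lf_intros, rule refl)
  also have "\<dots> = sw t (\<lambda>a b. F (a \<cdot> h) b)"
    by (subst sw_counit_right) (intro lf_intros, simp add: mult_one_right)
  finally show ?thesis using 1 by simp
qed

text \<open>With \<open>t1\<close>, \<open>t2\<close> the Sweedler factors of \<open>t\<close>, the
  tensor \<open>t1 \<otimes> S t2\<close> is a Casimir element. It makes averaging over
  \<open>t\<close> compatible with multiplication, as in Maschke's theorem.\<close>

lemma sw_t_casimir:
  assumes F: "bil F"
  shows "sw t (\<lambda>a b. F (h \<cdot> a) (S b)) = sw t (\<lambda>a b. F a (S b \<cdot> h))"
proof -
  note [lf_intros] = bil_intros[OF F]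
  let ?G = "\<lambda>h1 h2 h3. sw t (\<lambda>a b. F (h1 \<cdot> a) (S b \<cdot> (S h2 \<cdot> h3)))"
  have "sw h (\<lambda>z h3. sw z (\<lambda>h1 h2. ?G h1 h2 h3)) = sw h (\<lambda>z h3. sw (z \<cdot> t) (\<lambda>u v. F u (S v \<cdot> h3)))"
    by (subst sw_mult, intro bilI lf_intros, simp add: S_mult mult_assoc)
  also have "\<dots> = sw h (\<lambda>z h3. eps z * sw t (\<lambda>u v. F u (S v \<cdot> h3)))"
    by (simp add: t_left lfD(2)[OF lf_sw])
  also have "\<dots> = sw t (\<lambda>a b. F a (S b \<cdot> h))"
    by (rule sw_counit_left) (intro lf_intros)
  finally have 1: "sw h (\<lambda>z h3. sw z (\<lambda>h1 h2. ?G h1 h2 h3)) = sw t (\<lambda>a b. F a (S b \<cdot> h))" .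
  have "sw h (\<lambda>z h3. sw z (\<lambda>h1 h2. ?G h1 h2 h3)) = sw h (\<lambda>h1 h'. sw h' (\<lambda>h2 h3. ?G h1 h2 h3))"
    by (rule sw_coassoc)
  also have "\<dots> = sw h (\<lambda>h1 h'. eps h' * sw t (\<lambda>a b. F (h1 \<cdot> a) (S b \<cdot> one)))"
    by (subst sw_antipode_left[where p = "\<lambda>w. sw t (\<lambda>a b. F (_ \<cdot> a) (S b \<cdot> w))"]) (intro lf_intros, rule refl)
  also have "\<dots> = sw t (\<lambda>a b. F (h \<cdot> a) (S b))"
    by (subst sw_counit_right) (intro lf_intros, simp add: mult_one_right)
  finally show ?thesis using 1 by simp
qed

text \<open>The functionals \<open>p\<close> with \<open>t\<^sub>(\<^sub>1\<^sub>) p (S t\<^sub>(\<^sub>2\<^sub>)) = 0\<close> form a right ideal of the dual algebra that is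
  closed under \<open>p \<mapsto> p (\<sqdot> h)\<close>; hence with \<open>p\<close> it contains \<open>x \<mapsto> p (x\<^sub>(\<^sub>1\<^sub>) S x\<^sub>(\<^sub>2\<^sub>)) = p(1) \<epsilon>(x)\<close>,
  which forces \<open>p(1) = 0\<close>.\<close>

lemma lf_eq_0_if_comp_S_eq_0:
  assumes p: "lf p" and pS: "\<And>x. p (S x) = 0"
  shows "p x = 0"
proof -
  define N where "N = (\<lambda>p. lf p \<and> (\<forall>q. lf q \<longrightarrow> sw t (\<lambda>a b. q a * p (S b)) = 0))"
  have a: "N (\<lambda>x. p (x \<cdot> h))" if "N p" for p h
  proof -
    have p: "lf p" and 0: "\<And>q. lf q \<Longrightarrow> sw t (\<lambda>a b. q a * p (S b)) = 0" using that by (auto simp: N_def)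
    note [lf_intros] = lf_comp[OF p]
    have "sw t (\<lambda>a b. q a * p (S b \<cdot> h)) = 0" if q: "lf q" for q
    proof -
      note [lf_intros] = lf_comp[OF q]
      have "sw t (\<lambda>a b. q a * p (S b \<cdot> h)) = sw t (\<lambda>a b. q (h \<cdot> a) * p (S b))"
        by (rule sw_t_casimir[symmetric]) (intro bilI lf_intros)
      also have "\<dots> = 0" by (rule 0) (intro lf_intros)
      finally show ?thesis .
    qed
    then show ?thesis by (auto simp: N_def intro!: lf_intros)
  qed
  have b: "sw t (\<lambda>a b. q a * sw (S b) (\<lambda>u v. p u * r v)) = 0" if "N p" "lf q" "lf r" for p q r
  proof -
    have p: "lf p" and 0: "\<And>q. lf q \<Longrightarrow> sw t (\<lambda>a b. q a * p (S b)) = 0" using that by (auto simp: N_def)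
    note [lf_intros] = lf_comp[OF p] lf_comp[OF that(2)] lf_comp[OF that(3)]
    have "sw t (\<lambda>a b. q a * sw (S b) (\<lambda>u v. p u * r v)) = sw t (\<lambda>a x. sw x (\<lambda>b c. q a * r (S b) * p (S c)))"
      by (subst sw_S, intro bilI lf_intros) (simp add: mult_ac flip: sw_cmult)
    also have "\<dots> = sw t (\<lambda>x c. sw x (\<lambda>a b. q a * r (S b)) * p (S c))"
      unfolding sw_coassoc[symmetric] by (simp add: sw_multc)
    also have "\<dots> = 0" by (rule 0) (rule lf_sw)
    finally show ?thesis .
  qed
  have one0: "p one = 0" if "N p" for p
  proof -
    have p: "lf p" using that by (auto simp: N_def)
    note [lf_intros] = lf_comp[OF p]
    have *: "p one * eps x = (\<Sum>c\<in>B. sw x (\<lambda>a b. p (a \<cdot> c) * coef (S b) c))" for x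
    proof -
      have "(\<Sum>c\<in>B. p (a \<cdot> c) * coef y c) = p (a \<cdot> y)" for a y
        by (subst lf_expand[of "\<lambda>y. p (a \<cdot> y)" y]) (auto intro!: lf_intros sum.cong)
      then show ?thesis using sw_antipode_right[OF p, of x] by (simp flip: sw_sum)
    qed
    have "p one = p one * sw t (\<lambda>a b. eps a * eps (S b))"
      by (subst sw_counit_left) (auto intro!: lf_intros lin_S simp: eps_S eps_t)
    also have "\<dots> = (\<Sum>c\<in>B. sw t (\<lambda>a b. eps a * sw (S b) (\<lambda>u v. p (u \<cdot> c) * coef (S v) c)))"
      by (simp add: sw_cmult[symmetric] mult.left_commute[of "p one"] * sum_distrib_left sw_sum)
    also have "\<dots> = 0"
      by (intro sum.neutral ballI b a that lf_eps) (intro lf_intros)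
    finally show ?thesis .
  qed
  have "N p" using p pS by (simp add: N_def sw_zero)
  then have "p (one \<cdot> x) = 0" by (intro one0 a)
  then show ?thesis by (simp add: mult_one_left)
qed

section \<open>Bijectivity of the antipode and its consequences\<close>

lemma surj_S: "surj S"
proof (rule ccontr)
  assume "\<not> surj S"
  then obtain x where x: "x \<notin> range S" by blast
  interpret S: Vector_Spaces.linear scale scale S by (rule lin_S)
  have "subspace (range S)" by (intro S.subspace_image subspace_UNIV)
  then obtain C where C: "finite C" "independent C" "span C = range S"
    using finite_basis_of_subspace[OF finite_B, of "range S"] by (auto simp: span_B)
  have "independent (insert x C)" using x C by (simp add: independent_insert)
  then obtain q where q: "lin q" "\<And>b. b \<in> insert x C \<Longrightarrow> q b = (if b = x then x else 0)"
    using exists_lin_extension[of "insert x C" "\<lambda>b. if b = x then x else 0"] by metis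
  have "x \<noteq> 0" using x S.zero by (metis rangeI)
  then obtain b where b: "coef x b \<noteq> 0" using sum_coef[of x] by (metis (no_types, lifting) scale_zero_left sum.neutral)
  have "q y = 0" if "y \<in> span C" for y
    using that
  proof (induction rule: module.span_induct_alt[OF module_axioms, consumes 1, case_names base step])
    case base
    then show ?case by (rule lin_0[OF q(1)])
  next
    case (step c z y)
    then have "z \<noteq> x" using x C(3) span_base by blast
    then show ?case using step q(2)[of z] by (simp add: lin_add[OF q(1)] lin_scale[OF q(1)])
  qed
  then have 0: "coef (q (S y)) b = 0" for y
    using C(3) lf_0[OF lf_coef] by (metis rangeI)
  have "coef (q x) b = 0"
    by (rule lf_eq_0_if_comp_S_eq_0[OF lf_comp[OF lf_coef q(1)] 0])
  then show False using q(2)[of x] b by simp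
qed

lemma inj_S: "inj S"
proof -
  interpret V: finite_dimensional_vector_space scale B
    by unfold_locales (simp_all add: finite_B independent_B span_B)
  show ?thesis using V.linear_surj_imp_inj[OF lin_S surj_S] .
qed

definition Si :: "'h \<Rightarrow> 'h" where "Si = inv_into UNIV S"

lemma S_Si [simp]: "S (Si x) = x"
  by (simp add: Si_def surj_f_inv_f surj_S)

lemma Si_S [simp]: "Si (S x) = x"
  by (simp add: Si_def inj_S)

lemma lin_Si: "lin Si"
  unfolding lin_iff using inj_S lin_S unfolding lin_iff by (metis Si_S S_Si)

lemma lin_Si_comp [lf_intros]: "lin g \<Longrightarrow> lin (\<lambda>x. Si (g x))"
  by (rule lin_compose[OF lin_Si])

lemma Si_mult: "Si (x \<cdot> y) = Si y \<cdot> Si x"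
  by (metis S_mult S_Si Si_S)

lemma Si_one: "Si one = one"
  by (metis S_one Si_S)

lemma eps_Si: "eps (Si h) = eps h"
  by (metis eps_S S_Si)

lemma sw_Si: "bil F \<Longrightarrow> sw (Si h) F = sw h (\<lambda>a b. F (Si b) (Si a))"
  using sw_S[of "\<lambda>a b. F (Si b) (Si a)" "Si h"] by (simp add: bil_def bil_intros lin_Si)

text \<open>\<open>t \<cdot> S t\<close> is computed twice: it is \<open>S t\<close> because
  \<open>S t\<close> absorbs left factors, and \<open>t\<close> because \<open>t\<close> absorbs
  right factors.\<close>

lemma S_t: "S t = t"
proof -
  have "h \<cdot> S t = eps h *s S t" for h
  proof -
    have "S (Si h) \<cdot> S t = S (t \<cdot> Si h)" by (simp add: S_mult)
    then show ?thesis by (simp add: t_right eps_Si lin_scale[OF lin_S])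
  qed
  from this[of t] t_right[of "S t"] show ?thesis by (simp add: eps_S eps_t)
qed

lemma sw_t_S: "bil F \<Longrightarrow> sw t F = sw t (\<lambda>a b. F (S b) (S a))"
  using sw_S[of F t] by (simp add: S_t)

text \<open>The left action of the dual algebra on \<open>H\<close>.\<close>

definition conv :: "('h \<Rightarrow> 'f) \<Rightarrow> 'h \<Rightarrow> 'h" where
  "conv p y = (\<Sum>a\<in>B. \<Sum>b\<in>B. D y a b *s (p b *s a))"

lemma lf_conv: "lf q \<Longrightarrow> q (conv p y) = sw y (\<lambda>a b. q a * p b)"
  using sw_lf[of q y "\<lambda>a b. p b *s a"] by (simp add: conv_def lfD mult.commute)

lemma lin_conv: "lin (conv p)"
  unfolding lin_iff conv_def D_add D_scale
  by (simp add: scale_left_distrib sum.distrib scale_sum_right distrib_right mult.assoc)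

lemma lin_conv_comp [lf_intros]: "lin g \<Longrightarrow> lin (\<lambda>x. conv p (g x))"
  by (rule lin_compose[OF lin_conv])

text \<open>Writing \<open>h\<^sub>(\<^sub>1\<^sub>) y \<otimes> h\<^sub>(\<^sub>2\<^sub>) = h\<^sub>(\<^sub>1\<^sub>) y\<^sub>(\<^sub>1\<^sub>) \<otimes> h\<^sub>(\<^sub>2\<^sub>) y\<^sub>(\<^sub>2\<^sub>) S y\<^sub>(\<^sub>3\<^sub>)\<close> turns left multiplication by \<open>h\<^sub>(\<^sub>1\<^sub>)\<close>
  into left multiplication by \<open>h\<close> between two convolution operators, and the trace is cyclic.\<close>

lemma tr_mult_coproduct:
  assumes T: "lin T" and R: "lin R" and p: "lf p"
    and R_T: "\<And>q x. lf q \<Longrightarrow>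
      sw x (\<lambda>x1 x2. sw (T x1) (\<lambda>u v. q u * p (x2 \<cdot> S v))) = q (R x)"
  shows "sw h (\<lambda>a b. tr (\<lambda>x. a \<cdot> T x) * p b) = tr (\<lambda>x. h \<cdot> R x)"
proof -
  note [lf_intros] = lf_comp[OF p] lin_compose[OF T] lin_compose[OF R]
  \<comment> \<open>A sum over the basis elements \<open>c\<close> separates
    \<open>p (v \<cdot> S b)\<close> into the factors \<open>p (v \<cdot> c)\<close> and
    \<open>coef (S b) c\<close>, so that each factor belongs to an operator of its own.\<close>
  define P where "P = (\<lambda>c. conv (\<lambda>v. coef (S v) c))"
  define Q where "Q = (\<lambda>c. conv (\<lambda>v. p (v \<cdot> c)))"
  have lX [lf_intros]: "lin g \<Longrightarrow> lin (\<lambda>x. P c (g x))" for g c unfolding P_def by (intro lf_intros)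
  have lY [lf_intros]: "lin g \<Longrightarrow> lin (\<lambda>x. Q c (g x))" for g c unfolding Q_def by (intro lf_intros)
  have sum_c: "(\<Sum>c\<in>B. coef z c * r c) = r z" if "lf r" for r z
    by (rule lf_expand[OF that, symmetric])
  have 1: "sw h (\<lambda>a b. q (a \<cdot> y) * p b) = q (\<Sum>c\<in>B. Q c (h \<cdot> P c y))" if q: "lf q" for q y
  proof -
    note [lf_intros] = lf_comp[OF q]
    have "q (\<Sum>c\<in>B. Q c (h \<cdot> P c y)) = (\<Sum>c\<in>B. sw (h \<cdot> P c y) (\<lambda>u v. q u * p (v \<cdot> c)))"
      by (simp add: lf_sum[OF q] Q_def lf_conv[OF q])
    also have "\<dots> = (\<Sum>c\<in>B. sw y (\<lambda>a b. coef (S b) c * sw (h \<cdot> a) (\<lambda>u v. q u * p (v \<cdot> c))))"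
    proof (rule sum.cong[OF refl])
      fix c
      have "lf (\<lambda>z. sw (h \<cdot> z) (\<lambda>u v. q u * p (v \<cdot> c)))" by (intro lf_intros)
      from lf_conv[OF this] show "sw (h \<cdot> P c y) (\<lambda>u v. q u * p (v \<cdot> c)) =
          sw y (\<lambda>a b. coef (S b) c * sw (h \<cdot> a) (\<lambda>u v. q u * p (v \<cdot> c)))"
        by (simp add: P_def mult.commute)
    qed
    also have "\<dots> = sw y (\<lambda>a b. sw (h \<cdot> a) (\<lambda>u v. q u * p (v \<cdot> S b)))"
      unfolding sw_sum[symmetric] by (subst sum_c) (intro lf_intros, rule refl)
    also have "\<dots> = sw y (\<lambda>a b. sw a (\<lambda>a1 a2. sw h (\<lambda>h1 h2. q (h1 \<cdot> a1) * p (h2 \<cdot> a2 \<cdot> S b))))"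
      by (subst sw_mult, intro bilI lf_intros, subst sw_swap, rule refl)
    also have "\<dots> = sw y (\<lambda>a1 b'. sw b' (\<lambda>a2 b. sw h (\<lambda>h1 h2. q (h1 \<cdot> a1) * p (h2 \<cdot> (a2 \<cdot> S b)))))"
      unfolding sw_coassoc mult_assoc ..
    also have "\<dots> = sw y (\<lambda>a1 b'. eps b' * sw h (\<lambda>h1 h2. q (h1 \<cdot> a1) * p (h2 \<cdot> one)))"
      by (subst sw_antipode_right[where p = "\<lambda>z. sw h (\<lambda>h1 h2. q (h1 \<cdot> _) * p (h2 \<cdot> z))"])
        (intro lf_intros, rule refl)
    also have "\<dots> = sw h (\<lambda>a b. q (a \<cdot> y) * p b)"
      by (subst sw_counit_right) (intro lf_intros, simp add: mult_one_right)
    finally show ?thesis by simp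
  qed
  have "sw h (\<lambda>a b. tr (\<lambda>x. a \<cdot> T x) * p b) = tr (\<lambda>x. \<Sum>c\<in>B. Q c (h \<cdot> P c (T x)))"
    unfolding trc_def sum_distrib_right sw_sum by (simp add: 1[OF lf_coef])
  also have "\<dots> = (\<Sum>c\<in>B. tr (\<lambda>x. h \<cdot> P c (T (Q c x))))"
    unfolding tr_sum by (intro sum.cong refl tr_compose_commute lf_intros)
  also have "\<dots> = tr (\<lambda>x. h \<cdot> R x)"
  proof -
    have "(\<Sum>c\<in>B. P c (T (Q c x))) = R x" for x
    proof (rule eqI_lf)
      fix q assume q: "lf q"
      note [lf_intros] = lf_comp[OF q]
      have "q (\<Sum>c\<in>B. P c (T (Q c x))) = (\<Sum>c\<in>B. sw x (\<lambda>x1 x2. q (P c (T x1)) * p (x2 \<cdot> c)))"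
        unfolding lf_sum[OF q] Q_def by (intro sum.cong refl lf_conv lf_intros)
      also have "\<dots> = sw x (\<lambda>x1 x2. sw (T x1) (\<lambda>u v. \<Sum>c\<in>B. coef (S v) c * (q u * p (x2 \<cdot> c))))"
        unfolding sw_sum P_def lf_conv[OF q] sw_multc[symmetric] by (simp only: mult_ac)
      also have "\<dots> = sw x (\<lambda>x1 x2. sw (T x1) (\<lambda>u v. q u * p (x2 \<cdot> S v)))"
        by (subst sum_c) (intro lf_intros, rule refl)
      also have "\<dots> = q (R x)" by (rule R_T[OF q])
      finally show "q (\<Sum>c\<in>B. P c (T (Q c x))) = q (R x)" .
    qed
    then have "tr (\<lambda>x. h \<cdot> R x) = tr (\<lambda>x. \<Sum>c\<in>B. h \<cdot> P c (T (Q c x)))"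
      by (simp flip: lin_sum[OF lin_mult_right[OF lin_id]])
    then show ?thesis by (simp add: tr_sum)
  qed
  finally show ?thesis .
qed

end

section \<open>The Frobenius form \<mu>\<close>

context hopf_with_integral
begin

definition \<tau> :: "'h \<Rightarrow> 'h" where "\<tau> x = Si (Si x)"

lemma lin_\<tau>: "lin \<tau>"
  unfolding \<tau>_def[abs_def] by (intro lf_intros)

lemma lin_\<tau>_comp [lf_intros]: "lin g \<Longrightarrow> lin (\<lambda>x. \<tau> (g x))"
  by (rule lin_compose[OF lin_\<tau>])

lemma \<tau>_mult: "\<tau> (x \<cdot> y) = \<tau> x \<cdot> \<tau> y"
  by (simp add: \<tau>_def Si_mult)

lemma S_\<tau>: "S (\<tau> x) = Si x"
  by (simp add: \<tau>_def)

lemma \<tau>_S: "\<tau> (S x) = Si x"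
  by (simp add: \<tau>_def)

lemma SS_\<tau> [simp]: "S (S (\<tau> x)) = x"
  by (simp add: \<tau>_def)

lemma sw_\<tau>:
  assumes F: "bil F"
  shows "sw (\<tau> h) F = sw h (\<lambda>a b. F (\<tau> a) (\<tau> b))"
proof -
  note [lf_intros] = bil_intros[OF F]
  have "bil (\<lambda>a b. F (Si b) (Si a))" by (intro bilI lf_intros)
  then show ?thesis unfolding \<tau>_def by (simp add: sw_Si[OF F] sw_Si)
qed

definition \<mu> :: "'h \<Rightarrow> 'f" where "\<mu> h = tr (\<lambda>x. h \<cdot> \<tau> x)"

lemma lf_\<mu>: "lf \<mu>"
  unfolding \<mu>_def[abs_def] by (intro lf_intros)

lemmas lf_\<mu>_comp [lf_intros] = lf_comp[OF lf_\<mu>]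

text \<open>The trace identity for \<open>T = \<tau>\<close>. The power \<open>S^-2\<close> is the
  right one because \<open>S\<close> after \<open>\<tau>\<close> is \<open>Si\<close>, for which the
  antipode law holds with the factors in reversed order; this collapses
  \<open>x2 \<cdot> Si v\<close>.\<close>

lemma \<mu>_right_integral:
  assumes p: "lf p"
  shows "sw h (\<lambda>a b. \<mu> a * p b) = \<mu> h * p one"
proof -
  note [lf_intros] = lf_comp[OF p]
  have "sw h (\<lambda>a b. \<mu> a * p b) = tr (\<lambda>x. h \<cdot> (p one *s \<tau> x))"
    unfolding \<mu>_def
  proof (rule tr_mult_coproduct[OF lin_\<tau> _ p])
    show "lin (\<lambda>x. p one *s \<tau> x)" by (intro lf_intros)
    fix q x assume q: "lf q"
    note [lf_intros] = lf_comp[OF q]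
    have "sw x (\<lambda>x1 x2. sw (\<tau> x1) (\<lambda>u v. q u * p (x2 \<cdot> S v))) =
        sw x (\<lambda>x1 x2. sw x1 (\<lambda>u v. q (\<tau> u) * p (x2 \<cdot> Si v)))"
      by (subst sw_\<tau>) (intro bilI lf_intros, simp add: S_\<tau>)
    also have "\<dots> = sw x (\<lambda>u w. sw w (\<lambda>v x2. q (\<tau> u) * p (x2 \<cdot> Si v)))" by (rule sw_coassoc)
    also have "\<dots> = sw x (\<lambda>u w. sw w (\<lambda>v x2. q (\<tau> u) * p (Si (v \<cdot> S x2))))"
      by (simp add: Si_mult)
    also have "\<dots> = sw x (\<lambda>u w. eps w * (q (\<tau> u) * p (Si one)))"
      by (subst sw_antipode_right[where p = "\<lambda>z. q (\<tau> _) * p (Si z)"]) (intro lf_intros, rule refl)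
    also have "\<dots> = q (\<tau> x) * p (Si one)"
      by (rule sw_counit_right) (intro lf_intros)
    finally show "sw x (\<lambda>x1 x2. sw (\<tau> x1) (\<lambda>u v. q u * p (x2 \<cdot> S v))) = q (p one *s \<tau> x)"
      by (simp add: Si_one lfD[OF q])
  qed
  then show ?thesis by (simp add: \<mu>_def mult_scale_right tr_scale mult.commute)
qed

lemma tr_mult_t: "lf p \<Longrightarrow> tr (\<lambda>x. p x *s t) = p t"
  unfolding trc_def coef_scale by (subst lf_expand[of p t]) (simp_all add: mult.commute)

lemma \<mu>_t: "\<mu> t = 1"
proof -
  have "\<mu> t = tr (\<lambda>x. eps x *s t)" by (simp add: \<mu>_def t_right \<tau>_def eps_Si)
  then show ?thesis by (simp add: tr_mult_t lf_eps eps_t)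
qed

text \<open>Cyclicity of the trace; \<open>\<tau>\<close> is the Nakayama automorphism of the form
  given by \<open>\<mu>\<close>.\<close>

lemma \<mu>_commute: "\<mu> (x \<cdot> y) = \<mu> (y \<cdot> \<tau> x)"
proof -
  have "\<mu> (x \<cdot> y) = tr (\<lambda>z. x \<cdot> (y \<cdot> \<tau> z))" by (simp add: \<mu>_def mult_assoc)
  also have "\<dots> = tr (\<lambda>z. y \<cdot> \<tau> (x \<cdot> z))" by (rule tr_compose_commute) (intro lf_intros)+
  finally show ?thesis by (simp add: \<mu>_def mult_assoc \<tau>_mult)
qed

definition right_integral :: "('h \<Rightarrow> 'f) \<Rightarrow> bool" where
  "right_integral \<nu> \<longleftrightarrow> lf \<nu> \<and> (\<forall>h p. lf p \<longrightarrow> sw h (\<lambda>a b. \<nu> a * p b) = \<nu> h * p one)"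

lemma sw_t_right_integral:
  assumes "right_integral \<nu>" "lf q"
  shows "sw t (\<lambda>a b. \<nu> (a \<cdot> h) * q b) = \<nu> t * q (S h)"
proof -
  have \<nu>: "lf \<nu>" using assms by (simp add: right_integral_def)
  note [lf_intros] = lf_comp[OF \<nu>] lf_comp[OF assms(2)]
  have "sw t (\<lambda>a b. \<nu> (a \<cdot> h) * q b) = sw t (\<lambda>a b. \<nu> a * q (b \<cdot> S h))"
    by (rule sw_t_mult_left) (intro bilI lf_intros)
  also have "\<dots> = \<nu> t * q (one \<cdot> S h)"
  proof -
    have "lf (\<lambda>b. q (b \<cdot> S h))" by (intro lf_intros)
    then show ?thesis using assms(1) by (simp add: right_integral_def)
  qed
  finally show ?thesis by (simp add: mult_one_left)
qed

lemma right_integral_\<mu>: "right_integral \<mu>"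
  by (simp add: right_integral_def lf_\<mu> \<mu>_right_integral)

lemma sw_t_\<mu>: "lf q \<Longrightarrow> sw t (\<lambda>a b. \<mu> (a \<cdot> h) * q b) = q (S h)"
  using sw_t_right_integral[OF right_integral_\<mu>] by (simp add: \<mu>_t)

lemma \<mu>_nondegenerate_right:
  assumes "\<And>x. \<mu> (x \<cdot> h) = 0"
  shows "h = 0"
proof -
  have "S h = 0"
    using sw_t_\<mu>[of _ h] assms by (intro eqI_lf) (simp add: sw_zero lf_0)
  then show ?thesis by (metis Si_S lin_0[OF lin_Si])
qed

text \<open>By \<open>sw_t_\<mu>\<close>, the Sweedler factors of \<open>t\<close>, with
  \<open>Si\<close> applied to the second, act as dual bases for the form
  \<open>\<mu> (x \<cdot> y)\<close>.\<close>

lemma tr_eq_sw_t: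
  assumes "lin f"
  shows "tr f = sw t (\<lambda>a b. \<mu> (a \<cdot> f (Si b)))"
proof -
  note [lf_intros] = lin_compose[OF assms]
  have "tr f = (\<Sum>c\<in>B. sw t (\<lambda>a b. \<mu> (a \<cdot> c) * coef (f (Si b)) c))"
    unfolding trc_def
  proof (intro sum.cong refl)
    fix c
    have "sw t (\<lambda>a b. \<mu> (a \<cdot> c) * coef (f (Si b)) c) = coef (f (Si (S c))) c"
      by (rule sw_t_\<mu>) (intro lf_intros)
    then show "coef (f c) c = sw t (\<lambda>a b. \<mu> (a \<cdot> c) * coef (f (Si b)) c)" by simp
  qed
  also have "\<dots> = sw t (\<lambda>a b. \<Sum>c\<in>B. coef (f (Si b)) c * \<mu> (a \<cdot> c))"
    by (simp add: sw_sum mult.commute)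
  also have "(\<lambda>a b. \<Sum>c\<in>B. coef (f (Si b)) c * \<mu> (a \<cdot> c)) = (\<lambda>a b. \<mu> (a \<cdot> f (Si b)))"
    by (intro ext lf_expand[symmetric]) (intro lf_intros)
  finally show ?thesis .
qed

text \<open>Uniqueness of right integrals: the value at \<open>t\<close> determines them. Since
  \<open>S t = t\<close>, the roles of \<open>\<nu>\<close> and \<open>\<mu>\<close> can be
  exchanged, after which \<open>sw_t_\<mu>\<close> recovers \<open>\<nu> h\<close>.\<close>

lemma right_integral_eq_0:
  assumes \<nu>: "right_integral \<nu>" and t0: "\<nu> t = 0"
  shows "\<nu> h = 0"
proof -
  have l: "lf \<nu>" using \<nu> by (simp add: right_integral_def)
  note [lf_intros] = lf_comp[OF l]
  have "sw t (\<lambda>a b. \<nu> (a \<cdot> h) * \<mu> (Si b)) = 0"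
    by (subst sw_t_right_integral[OF \<nu>]) (intro lf_intros, simp add: t0)
  moreover have "sw t (\<lambda>a b. \<nu> (a \<cdot> h) * \<mu> (Si b)) = sw t (\<lambda>a b. \<nu> (S b \<cdot> h) * \<mu> (Si (S a)))"
    by (rule sw_t_S) (intro bilI lf_intros)
  ultimately have "sw t (\<lambda>a b. \<mu> (a \<cdot> one) * \<nu> (S b \<cdot> h)) = 0" by (simp add: mult.commute mult_one_right)
  moreover have "sw t (\<lambda>a b. \<mu> (a \<cdot> one) * \<nu> (S b \<cdot> h)) = \<nu> (S (S one) \<cdot> h)"
    by (rule sw_t_\<mu>) (intro lf_intros)
  ultimately show ?thesis by (simp add: S_one mult_one_left)
qed

section \<open>The distinguished grouplike element and Radford's formula\<close>

text \<open>The only candidate for the element measuring how far \<open>\<mu>\<close> is from being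
  a left integral, read off at \<open>t\<close>, where \<open>\<mu>\<close> is 1.\<close>

definition g :: 'h where "g = conv \<mu> t"

lemma lf_g: "lf p \<Longrightarrow> p g = sw t (\<lambda>a b. p a * \<mu> b)"
  by (simp add: g_def lf_conv)

text \<open>By coassociativity the left hand side is again a right integral in \<open>h\<close>,
  hence a multiple of \<open>\<mu>\<close>; the multiple is read off at \<open>t\<close>.\<close>

lemma sw_\<mu>_right:
  assumes p: "lf p"
  shows "sw h (\<lambda>a b. p a * \<mu> b) = p g * \<mu> h"
proof -
  note [lf_intros] = lf_comp[OF p]
  define \<nu> where "\<nu> = (\<lambda>h. sw h (\<lambda>a b. p a * \<mu> b) - p g * \<mu> h)"
  have "right_integral \<nu>"
    unfolding right_integral_def
  proof (intro conjI allI impI)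
    show "lf \<nu>" unfolding \<nu>_def by (intro lf_intros)
    fix h r assume r: "lf r"
    have "sw h (\<lambda>x c. \<nu> x * r c) =
        sw h (\<lambda>x c. sw x (\<lambda>a b. p a * \<mu> b * r c)) - p g * sw h (\<lambda>x c. \<mu> x * r c)"
      by (simp add: \<nu>_def left_diff_distrib sw_diff sw_multc, simp add: mult.assoc sw_cmult)
    also have "sw h (\<lambda>x c. sw x (\<lambda>a b. p a * \<mu> b * r c)) = sw h (\<lambda>a x. p a * sw x (\<lambda>b c. \<mu> b * r c))"
      by (subst sw_coassoc) (simp add: mult.assoc sw_cmult)
    also have "\<dots> = sw h (\<lambda>a x. p a * \<mu> x) * r one"
      by (simp add: \<mu>_right_integral[OF r] mult.assoc flip: sw_multc)
    also have "sw h (\<lambda>a x. p a * \<mu> x) * r one - p g * sw h (\<lambda>x c. \<mu> x * r c) = \<nu> h * r one"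
      by (simp add: \<mu>_right_integral[OF r] \<nu>_def left_diff_distrib)
    finally show "sw h (\<lambda>a b. \<nu> a * r b) = \<nu> h * r one" .
  qed
  moreover have "\<nu> t = 0" by (simp add: \<nu>_def lf_g[OF p] \<mu>_t)
  ultimately have "\<nu> h = 0" by (rule right_integral_eq_0)
  then show ?thesis by (simp add: \<nu>_def)
qed

definition grouplike :: "'h \<Rightarrow> bool" where
  "grouplike x \<longleftrightarrow> eps x = 1 \<and> (\<forall>F. bil F \<longrightarrow> sw x F = F x x)"

lemma grouplike_g: "grouplike g"
  unfolding grouplike_def
proof (intro conjI allI impI)
  show "eps g = 1" by (simp add: lf_g[OF lf_eps] sw_counit_left[OF lf_\<mu>] \<mu>_t)
  fix F assume F: "bil F"
  have "sw g F = sw t (\<lambda>x c. sw x (\<lambda>a b. F a b * \<mu> c))"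
    by (simp add: lf_g[OF lf_sw] sw_multc)
  also have "\<dots> = sw t (\<lambda>a x. F a g * \<mu> x)"
    by (simp add: sw_coassoc sw_\<mu>_right[OF bil_lf2[OF F]])
  also have "\<dots> = F g g" by (rule lf_g[OF bil_lf1[OF F], symmetric])
  finally show "sw g F = F g g" .
qed

lemma grouplike_one: "grouplike one"
  by (simp add: grouplike_def eps_one sw_one)

lemma grouplike_mult:
  assumes "grouplike x" "grouplike y"
  shows "grouplike (x \<cdot> y)"
  unfolding grouplike_def
proof (intro conjI allI impI)
  show "eps (x \<cdot> y) = 1" using assms by (simp add: grouplike_def eps_mult)
  fix F assume F: "bil F"
  note [lf_intros] = bil_intros[OF F]
  have "sw (x \<cdot> y) F = sw x (\<lambda>a b. sw y (\<lambda>c d. F (a \<cdot> c) (b \<cdot> d)))" by (rule sw_mult[OF F])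
  also have "\<dots> = sw x (\<lambda>a b. F (a \<cdot> y) (b \<cdot> y))"
  proof -
    have "bil (\<lambda>c d. F (a \<cdot> c) (b \<cdot> d))" for a b by (intro bilI lf_intros)
    then show ?thesis using assms(2) by (simp add: grouplike_def)
  qed
  also have "\<dots> = F (x \<cdot> y) (x \<cdot> y)"
  proof -
    have "bil (\<lambda>a b. F (a \<cdot> y) (b \<cdot> y))" by (intro bilI lf_intros)
    then show ?thesis using assms(1) by (simp add: grouplike_def)
  qed
  finally show "sw (x \<cdot> y) F = F (x \<cdot> y) (x \<cdot> y)" .
qed

lemma grouplike_inverse:
  assumes "grouplike x"
  shows "x \<cdot> S x = one" "S x \<cdot> x = one"
proof -
  have "p (x \<cdot> S x) = p one" "p (S x \<cdot> x) = p one" if p: "lf p" for p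
  proof -
    note [lf_intros] = lf_comp[OF p]
    have "bil (\<lambda>a b. p (a \<cdot> S b))" "bil (\<lambda>a b. p (S a \<cdot> b))" by (intro bilI lf_intros)+
    then show "p (x \<cdot> S x) = p one" "p (S x \<cdot> x) = p one"
      using assms sw_antipode_right[OF p, of x] sw_antipode_left[OF p, of x]
      by (simp_all add: grouplike_def)
  qed
  then show "x \<cdot> S x = one" "S x \<cdot> x = one" by (auto intro: eqI_lf)
qed

text \<open>Dedekind's argument: in a relation expressing \<open>x\<close> through \<open>A\<close>,
  comparing coproducts makes the coefficients orthogonal idempotents of the field, and the counit
  makes their sum 1; so \<open>x\<close> is itself a member of \<open>A\<close>.\<close>

lemma independent_grouplikes:
  assumes "finite A" "\<And>x. x \<in> A \<Longrightarrow> grouplike x"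
  shows "independent A"
  using assms
proof (induction A rule: finite_induct)
  case (insert x A)
  then have ind: "independent A" by simp
  have "x \<notin> span A"
  proof
    assume x: "x \<in> span A"
    define c where "c = representation A x"
    have xc: "(\<Sum>a\<in>A. c a *s a) = x"
      unfolding c_def by (rule sum_representation) (use insert ind x in auto)
    have "\<exists>p. \<forall>a. lf (p a) \<and> (\<forall>b\<in>A. p a b = (if b = a then 1 else 0))"
    proof (intro choice allI)
      fix a
      obtain q where "lin q" "\<And>b. b \<in> A \<Longrightarrow> q b = (if b = a then one else 0)"
        using exists_lin_extension[OF ind, of "\<lambda>b. if b = a then one else 0"] by blast
      then show "\<exists>p. lf p \<and> (\<forall>b\<in>A. p b = (if b = a then 1 else 0))"
        using lf_comp[OF lf_eps, of q]
        by (intro exI[of _ "\<lambda>x. eps (q x)"]) (simp add: eps_one lf_0[OF lf_eps])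
    qed
    then obtain p where p: "\<And>a. lf (p a)" "\<And>a b. b \<in> A \<Longrightarrow> p a b = (if b = a then 1 else 0)" by blast
    have px: "p a x = c a" if "a \<in> A" for a
      unfolding xc[symmetric] lf_sum[OF p(1)] lfD(2)[OF p(1)] using that insert(1)
      by (simp add: p(2) if_distrib cong: if_cong)
    have cc: "c a * c b = (if a = b then c a else 0)" if ab: "a \<in> A" "b \<in> A" for a b
    proof -
      have bil: "bil (\<lambda>u v. p a u * p b v)" by (intro bilI lf_intros lf_comp[OF p(1)])
      have "c a * c b = sw x (\<lambda>u v. p a u * p b v)"
        using insert(4)[of x] bil px[OF ab(1)] px[OF ab(2)] by (simp add: grouplike_def)
      also have "\<dots> = (\<Sum>y\<in>A. c y * sw y (\<lambda>u v. p a u * p b v))"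
        unfolding xc[symmetric] by (simp add: lf_sum[OF lf_sw] lfD(2)[OF lf_sw])
      also have "\<dots> = (\<Sum>y\<in>A. c y * (p a y * p b y))"
        using insert(4) bil by (intro sum.cong refl) (simp add: grouplike_def)
      also have "\<dots> = (\<Sum>y\<in>A. if y = a then if a = b then c a else 0 else 0)"
        by (intro sum.cong refl) (auto simp: p(2))
      finally show ?thesis using ab insert(1) by simp
    qed
    have "(\<Sum>a\<in>A. c a) = eps (\<Sum>a\<in>A. c a *s a)"
      using insert(4) by (simp add: lf_sum[OF lf_eps] eps_scale grouplike_def)
    then have "(\<Sum>a\<in>A. c a) = 1" using insert(4) by (simp add: xc grouplike_def)
    then obtain a where a: "a \<in> A" "c a \<noteq> 0" by (metis sum.neutral zero_neq_one)
    have "c b = (if b = a then 1 else 0)" if "b \<in> A" for b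
      using cc[OF a(1) a(1)] cc[OF a(1) that] a(2) by auto
    then have "(\<Sum>b\<in>A. c b *s b) = (\<Sum>b\<in>A. if b = a then a else 0)"
      by (intro sum.cong refl) auto
    then have "x = a" using a(1) insert(1) by (simp add: xc)
    then show False using a(1) insert(2) by simp
  qed
  then show ?case using ind insert(2) by (simp add: independent_insert)
qed (simp add: dependent_explicit)

definition pow :: "'h \<Rightarrow> nat \<Rightarrow> 'h" where "pow x n = ((\<cdot>) x ^^ n) one"

lemma pow_0 [simp]: "pow x 0 = one" and pow_Suc: "pow x (Suc n) = x \<cdot> pow x n"
  by (simp_all add: pow_def)

lemma pow_add: "pow x (m + n) = pow x m \<cdot> pow x n"
  by (induction m) (simp_all add: pow_Suc mult_one_left mult_assoc)

lemma funpow_mult: "((\<lambda>y. x \<cdot> y) ^^ n) y = pow x n \<cdot> y"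
  by (induction n) (simp_all add: pow_Suc mult_one_left mult_assoc)

lemma grouplike_finite_order:
  assumes "grouplike x"
  obtains m where "m > 0" "pow x m = one"
proof -
  have gl: "grouplike (pow x n)" for n
    by (induction n) (simp_all add: grouplike_one pow_Suc grouplike_mult assms)
  have "\<not> inj_on (pow x) {..card B}"
  proof
    assume inj: "inj_on (pow x) {..card B}"
    have "independent (pow x ` {..card B})" by (rule independent_grouplikes) (auto simp: gl)
    then have "card (pow x ` {..card B}) \<le> card B"
      using independent_span_bound[OF finite_B] by (simp add: span_B)
    then show False using card_image[OF inj] by simp
  qed
  then obtain i j where "i \<noteq> j" "pow x i = pow x j" by (auto simp: inj_on_def)
  then obtain i j where ij: "i < j" "pow x i = pow x j" by (metis nat_neq_iff)
  have "pow x (j - i) \<cdot> pow x i = pow x i" using ij by (metis le_add_diff_inverse2 less_imp_le pow_add)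
  then have "pow x (j - i) \<cdot> (pow x i \<cdot> S (pow x i)) = pow x i \<cdot> S (pow x i)"
    by (metis mult_assoc)
  then have "pow x (j - i) = one" by (simp add: grouplike_inverse[OF gl] mult_one_right)
  with ij(1) show ?thesis by (intro that[of "j - i"]) simp_all
qed

lemma left_integral_eq_0:
  assumes l: "lf \<nu>" and \<nu>: "\<And>p h. lf p \<Longrightarrow> sw h (\<lambda>a b. p a * \<nu> b) = \<nu> h * p one" and t0: "\<nu> t = 0"
  shows "\<nu> h = 0"
proof -
  note [lf_intros] = lf_comp[OF l]
  have "sw t (\<lambda>a b. \<mu> (a \<cdot> one) * \<nu> (h \<cdot> b)) = sw t (\<lambda>a b. \<mu> (S h \<cdot> a \<cdot> one) * \<nu> b)"
    by (rule sw_t_mult_right) (intro bilI lf_intros)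
  also have "\<dots> = 0"
    by (subst \<nu>) (intro lf_intros, simp add: t0)
  finally have "sw t (\<lambda>a b. \<mu> (a \<cdot> one) * \<nu> (h \<cdot> b)) = 0" .
  moreover have "sw t (\<lambda>a b. \<mu> (a \<cdot> one) * \<nu> (h \<cdot> b)) = \<nu> (h \<cdot> S one)"
    by (rule sw_t_\<mu>) (intro lf_intros)
  ultimately show ?thesis by (simp add: S_one mult_one_right)
qed

text \<open>Both sides are left integrals in \<open>h\<close> and agree at \<open>t\<close>.\<close>

lemma \<mu>_S: "\<mu> (S h) = \<mu> (h \<cdot> g)"
proof -
  define \<nu> where "\<nu> = (\<lambda>h. \<mu> (S h) - \<mu> (h \<cdot> g))"
  have "\<nu> h = 0"
  proof (rule left_integral_eq_0)
    show "lf \<nu>" unfolding \<nu>_def by (intro lf_intros lin_S)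
    show "\<nu> t = 0"
      using grouplike_g by (simp add: \<nu>_def S_t t_right grouplike_def)
    fix p h assume p: "lf p"
    note [lf_intros] = lf_comp[OF p]
    have "sw h (\<lambda>a b. p a * \<mu> (S b)) = sw h (\<lambda>a b. \<mu> (S b) * p (Si (S a)))"
      by (simp add: mult.commute)
    also have "\<dots> = sw (S h) (\<lambda>u v. \<mu> u * p (Si v))"
      by (rule sw_S[symmetric]) (intro bilI lf_intros)
    also have "\<dots> = \<mu> (S h) * p (Si one)"
      by (rule \<mu>_right_integral) (intro lf_intros)
    finally have 1: "sw h (\<lambda>a b. p a * \<mu> (S b)) = \<mu> (S h) * p one" by (simp add: Si_one)
    have bil: "bil (\<lambda>u v. p (u \<cdot> S g) * \<mu> v)" by (intro bilI lf_intros)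
    have "bil (\<lambda>c d. p (a \<cdot> c \<cdot> S g) * \<mu> (b \<cdot> d))" for a b by (intro bilI lf_intros)
    then have "sw h (\<lambda>a b. p a * \<mu> (b \<cdot> g)) = sw (h \<cdot> g) (\<lambda>u v. p (u \<cdot> S g) * \<mu> v)"
      using grouplike_g
      by (simp add: sw_mult[OF bil] grouplike_def mult_assoc grouplike_inverse[OF grouplike_g] mult_one_right)
    also have "\<dots> = p (g \<cdot> S g) * \<mu> (h \<cdot> g)"
      by (rule sw_\<mu>_right) (intro lf_intros)
    finally have 2: "sw h (\<lambda>a b. p a * \<mu> (b \<cdot> g)) = p one * \<mu> (h \<cdot> g)"
      by (simp add: grouplike_inverse[OF grouplike_g])
    show "sw h (\<lambda>a b. p a * \<nu> b) = \<nu> h * p one"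
      using 1 2 by (simp add: \<nu>_def right_diff_distrib sw_diff left_diff_distrib mult.commute)
  qed
  then show ?thesis by (simp add: \<nu>_def)
qed

text \<open>Radford's formula in the case of a two-sided integral:
  \<open>\<mu> (S (x \<cdot> y))\<close> is evaluated by \<open>\<mu>_S\<close> before and after
  exchanging the factors by \<open>\<mu>_commute\<close>, and nondegeneracy removes
  \<open>x\<close>.\<close>

lemma g_mult_\<tau>_\<tau>: "g \<cdot> \<tau> (\<tau> y) = y \<cdot> g"
proof -
  have "\<mu> (x \<cdot> (y \<cdot> g - g \<cdot> \<tau> (\<tau> y))) = 0" for x
  proof -
    have "\<mu> (x \<cdot> y \<cdot> g) = \<mu> (S y \<cdot> S x)" by (simp add: \<mu>_S[symmetric] S_mult)
    also have "\<dots> = \<mu> (S x \<cdot> \<tau> (S y))" by (rule \<mu>_commute)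
    also have "\<dots> = \<mu> (S (\<tau> y \<cdot> x))" by (simp add: S_mult S_\<tau> \<tau>_S)
    also have "\<dots> = \<mu> (x \<cdot> g \<cdot> \<tau> (\<tau> y))" by (simp add: \<mu>_S mult_assoc \<mu>_commute[of "\<tau> y"])
    finally show ?thesis
      by (simp add: lf_diff[OF lf_\<mu>_comp[OF lin_mult_right[OF lin_id]]] mult_assoc)
  qed
  then show ?thesis using \<mu>_nondegenerate_right by fastforce
qed

lemma \<tau>_finite_order:
  obtains m where "m > 0" "\<And>y. (\<tau> ^^ m) y = y"
proof -
  obtain m where m: "m > 0" "pow g m = one" using grouplike_finite_order[OF grouplike_g] by blast
  have "pow g n \<cdot> (\<tau> ^^ (2 * n)) y = y \<cdot> pow g n" for n y
  proof (induction n arbitrary: y)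
    case (Suc n)
    have "pow g (Suc n) = pow g n \<cdot> g" using pow_add[of g n 1] by (simp add: pow_Suc mult_one_right)
    then have "pow g (Suc n) \<cdot> (\<tau> ^^ (2 * Suc n)) y = pow g n \<cdot> (g \<cdot> \<tau> (\<tau> ((\<tau> ^^ (2 * n)) y)))"
      by (simp add: mult_assoc)
    also have "\<dots> = pow g n \<cdot> (\<tau> ^^ (2 * n)) y \<cdot> g" by (simp add: g_mult_\<tau>_\<tau> mult_assoc)
    also have "\<dots> = y \<cdot> pow g (Suc n)"
      using \<open>pow g (Suc n) = _\<close> by (simp add: Suc mult_assoc)
    finally show ?case .
  qed (simp add: mult_one_left mult_one_right)
  from this[of m] have "(\<tau> ^^ (2 * m)) y = y" for y using m(2) by (simp add: mult_one_left mult_one_right)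
  then show ?thesis using that[of "2 * m"] m(1) by simp
qed

section \<open>The element implementing the square of the antipode, and the regular
  character\<close>

definition u :: 'h where "u = (\<Sum>a\<in>B. \<Sum>b\<in>B. D t a b *s (S b \<cdot> a))"

lemma lf_u: "lf q \<Longrightarrow> q u = sw t (\<lambda>a b. q (S b \<cdot> a))"
  unfolding u_def by (rule sw_lf)

lemma u_mult: "u \<cdot> h = S (S h) \<cdot> u"
proof (rule eqI_lf)
  fix q assume q: "lf q"
  note [lf_intros] = lf_comp[OF q]
  have "q (u \<cdot> h) = sw t (\<lambda>a b. q (S b \<cdot> a \<cdot> h))" by (rule lf_u) (intro lf_intros)
  also have "\<dots> = sw t (\<lambda>a b. q (S b \<cdot> (a \<cdot> h)))" by (simp add: mult_assoc)
  also have "\<dots> = sw t (\<lambda>a b. q (S (b \<cdot> S h) \<cdot> a))" by (rule sw_t_mult_left) (intro bilI lf_intros)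
  also have "\<dots> = sw t (\<lambda>a b. q (S (S h) \<cdot> (S b \<cdot> a)))" by (simp add: S_mult mult_assoc)
  also have "\<dots> = q (S (S h) \<cdot> u)" by (rule lf_u[symmetric]) (intro lf_intros)
  finally show "q (u \<cdot> h) = q (S (S h) \<cdot> u)" .
qed

lemma u_\<tau>: "u \<cdot> \<tau> x = x \<cdot> u"
  by (simp add: u_mult)

lemma eps_u: "eps u = 1"
proof -
  have "eps u = sw t (\<lambda>a b. eps a * eps b)" by (simp add: lf_u[OF lf_eps] eps_mult eps_S mult.commute)
  then show ?thesis by (simp add: sw_counit_left lf_eps eps_t)
qed

text \<open>Next to a central factor the trace exchanges the two factors of \<open>u\<close>, and
  the reversed product reduces to \<open>one\<close> by the antipode law.\<close>

lemma tr_u_mult_central: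
  assumes z: "\<And>x. z \<cdot> x = x \<cdot> z"
  shows "tr (\<lambda>x. u \<cdot> (z \<cdot> x)) = tr (\<lambda>x. z \<cdot> x)"
proof -
  have "tr (\<lambda>x. u \<cdot> (z \<cdot> x)) = sw t (\<lambda>a b. tr (\<lambda>x. (S b \<cdot> a) \<cdot> (z \<cdot> x)))"
    by (rule lf_u) (intro lf_intros)
  also have "\<dots> = sw t (\<lambda>a b. tr (\<lambda>x. z \<cdot> ((a \<cdot> S b) \<cdot> x)))"
  proof -
    have "tr (\<lambda>x. (S b \<cdot> a) \<cdot> (z \<cdot> x)) = tr (\<lambda>x. z \<cdot> ((a \<cdot> S b) \<cdot> x))" for a b
    proof -
      have "tr (\<lambda>x. S b \<cdot> (a \<cdot> (z \<cdot> x))) = tr (\<lambda>x. a \<cdot> (z \<cdot> (S b \<cdot> x)))"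
        by (rule tr_compose_commute) (intro lf_intros)+
      moreover have "a \<cdot> (z \<cdot> y) = z \<cdot> (a \<cdot> y)" for y by (metis z mult_assoc)
      ultimately show ?thesis by (simp add: mult_assoc)
    qed
    then show ?thesis by simp
  qed
  also have "\<dots> = eps t * tr (\<lambda>x. z \<cdot> (one \<cdot> x))"
    by (rule sw_antipode_right) (intro lf_intros)
  finally show ?thesis by (simp add: eps_t mult_one_left)
qed

definition \<chi> :: "'h \<Rightarrow> 'f" where "\<chi> h = tr (\<lambda>x. h \<cdot> x)"

lemma lf_\<chi>: "lf \<chi>"
  unfolding \<chi>_def[abs_def] by (intro lf_intros)

lemmas lf_\<chi>_comp [lf_intros] = lf_comp[OF lf_\<chi>]

text \<open>The trace formula for left multiplication by \<open>h\<close>; thus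
  \<open>\<tau> u\<close> is the density of the regular character with respect to
  \<open>\<mu>\<close>.\<close>

lemma \<chi>_eq_\<mu>: "\<chi> h = \<mu> (h \<cdot> \<tau> u)"
proof -
  have "\<mu> (h \<cdot> \<tau> u) = sw t (\<lambda>a b. \<mu> (h \<cdot> \<tau> (S b \<cdot> a)))" by (rule lf_u) (intro lf_intros)
  also have "\<dots> = sw t (\<lambda>a b. \<mu> (a \<cdot> (h \<cdot> Si b)))"
    by (simp add: \<tau>_mult \<tau>_S \<mu>_commute[of _ "h \<cdot> Si _"] mult_assoc)
  also have "\<dots> = \<chi> h" unfolding \<chi>_def by (rule tr_eq_sw_t[symmetric]) (intro lf_intros)
  finally show ?thesis by simp
qed

lemma \<chi>_commute: "\<chi> (x \<cdot> y) = \<chi> (y \<cdot> x)"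
  unfolding \<chi>_def mult_assoc by (rule tr_compose_commute) (intro lf_intros)+

sublocale V: finite_dimensional_vector_space scale B
  by unfold_locales (simp_all add: finite_B independent_B span_B)

lemma tr_idempotent_eq_0:
  assumes "lin e" "\<And>x. e (e x) = e x" "tr e = 0"
  shows "e x = 0"
proof -
  have "dim (range e) = 0"
    using trc_idempotent[OF finite_B independent_B assms(1)] assms by (simp add: span_B)
  then show ?thesis unfolding V.dim_eq_0 by auto
qed

text \<open>Averaging a linear generalized inverse of left multiplication by \<open>x\<close> over
  \<open>t\<close> gives \<open>w\<close> with \<open>x \<cdot> w \<cdot> x = x\<close>. Left
  multiplication by \<open>x \<cdot> w\<close> is then idempotent of trace
  \<open>\<chi> (x \<cdot> w) = 0\<close>, hence zero in characteristic 0.\<close>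

lemma \<chi>_nondegenerate:
  assumes x: "\<And>h. \<chi> (x \<cdot> h) = 0"
  shows "x = 0"
proof -
  interpret VP: vector_space_pair scale scale ..
  have "lin (\<lambda>y. x \<cdot> y)" by (intro lf_intros)
  then obtain r where r: "lin r" "\<And>y. x \<cdot> r (x \<cdot> y) = x \<cdot> y"
    using VP.linear_exists_right_inverse_on[of "\<lambda>y. x \<cdot> y" UNIV] by auto
  note [lf_intros] = lin_compose[OF r(1)]
  define w where "w = (\<Sum>a\<in>B. \<Sum>b\<in>B. D t a b *s (r a \<cdot> S b))"
  have e: "x \<cdot> w \<cdot> (x \<cdot> h) = x \<cdot> h" for h
  proof (rule eqI_lf)
    fix q assume q: "lf q"
    note [lf_intros] = lf_comp[OF q]
    have "lf (\<lambda>w. q (x \<cdot> w \<cdot> (x \<cdot> h)))" by (intro lf_intros)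
    from sw_lf[OF this, of t "\<lambda>a b. r a \<cdot> S b"]
    have "q (x \<cdot> w \<cdot> (x \<cdot> h)) = sw t (\<lambda>a b. q (x \<cdot> r a \<cdot> (S b \<cdot> (x \<cdot> h))))"
      by (simp add: w_def mult_assoc)
    also have "\<dots> = sw t (\<lambda>a b. q (x \<cdot> r ((x \<cdot> h) \<cdot> a) \<cdot> S b))"
      by (rule sw_t_casimir[symmetric]) (intro bilI lf_intros)
    also have "\<dots> = sw t (\<lambda>a b. q (x \<cdot> h \<cdot> (a \<cdot> S b)))" by (simp add: mult_assoc r(2))
    also have "\<dots> = eps t * q (x \<cdot> h \<cdot> one)" by (rule sw_antipode_right) (intro lf_intros)
    finally show "q (x \<cdot> w \<cdot> (x \<cdot> h)) = q (x \<cdot> h)" by (simp add: eps_t mult_one_right)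
  qed
  have "x \<cdot> w \<cdot> one = 0"
  proof (rule tr_idempotent_eq_0[of "\<lambda>y. x \<cdot> w \<cdot> y"])
    show "lin (\<lambda>y. x \<cdot> w \<cdot> y)" by (intro lf_intros)
    show "x \<cdot> w \<cdot> (x \<cdot> w \<cdot> y) = x \<cdot> w \<cdot> y" for y using e[of "w \<cdot> y"] by (simp add: mult_assoc)
    show "tr (\<lambda>y. x \<cdot> w \<cdot> y) = 0" using x[of w] by (simp add: \<chi>_def)
  qed
  moreover have "0 \<cdot> x = 0" using mult_scale_left[of 0 0 x] by simp
  ultimately show ?thesis using e[of one] by (simp add: mult_one_right)
qed

text \<open>An element killed by left multiplication with \<open>u\<close> lies in the radical of
  the trace form of \<open>\<chi>\<close>, because \<open>\<chi>\<close> is \<open>\<mu>\<close>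
  twisted by \<open>\<tau> u\<close>.\<close>

lemma u_invertible:
  obtains w where "u \<cdot> w = one" "w \<cdot> u = one"
proof -
  have lin: "lin (\<lambda>y. u \<cdot> y)" by (intro lf_intros)
  have 0: "z = 0" if "u \<cdot> z = 0" for z
  proof (rule \<chi>_nondegenerate)
    fix h
    have "\<chi> (z \<cdot> h) = \<mu> (z \<cdot> (h \<cdot> \<tau> u))" by (simp add: \<chi>_eq_\<mu> mult_assoc)
    also have "\<dots> = \<mu> (h \<cdot> \<tau> (u \<cdot> z))" by (simp add: \<mu>_commute[of z] \<tau>_mult mult_assoc)
    finally show "\<chi> (z \<cdot> h) = 0"
      using that lf_0[OF lf_\<mu>_comp, of "\<lambda>z. h \<cdot> \<tau> z"] by (simp add: lf_intros)
  qed
  have inj: "y = z" if "u \<cdot> y = u \<cdot> z" for y z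
  proof -
    have "u \<cdot> (y - z) + u \<cdot> z = u \<cdot> y" by (simp flip: mult_add_right)
    then show ?thesis using that 0[of "y - z"] by simp
  qed
  then have "surj (\<lambda>y. u \<cdot> y)"
    using V.linear_inj_imp_surj[OF lin] by (simp add: inj_on_def)
  then obtain w where w: "u \<cdot> w = one" by (metis surjD)
  have "u \<cdot> (w \<cdot> u) = u \<cdot> one" by (simp add: w mult_one_left mult_one_right flip: mult_assoc)
  then show ?thesis using that w inj by blast
qed

text \<open>\<open>\<tau> x = w \<cdot> x \<cdot> u\<close>, and under the trace right
  multiplication by \<open>u\<close> reduces to right multiplication by \<open>one\<close>, since
  left and right multiplications commute.\<close>

lemma \<mu>_one_eq_tr_inverse:
  assumes w: "w \<cdot> u = one"
  shows "\<mu> one = tr (\<lambda>x. w \<cdot> x)"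
proof -
  have "w \<cdot> u \<cdot> \<tau> x = w \<cdot> (x \<cdot> u)" for x
    by (simp only: mult_assoc u_\<tau>)
  then have "\<tau> x = w \<cdot> (x \<cdot> u)" for x
    by (simp add: w mult_one_left)
  then have "\<mu> one = tr (\<lambda>x. w \<cdot> (x \<cdot> u))" by (simp add: \<mu>_def mult_one_left)
  also have "\<dots> = sw t (\<lambda>a b. tr (\<lambda>x. w \<cdot> (x \<cdot> (S b \<cdot> a))))" by (rule lf_u) (intro lf_intros)
  also have "\<dots> = sw t (\<lambda>a b. tr (\<lambda>x. w \<cdot> (x \<cdot> (a \<cdot> S b))))"
  proof -
    have "tr (\<lambda>x. w \<cdot> (x \<cdot> (S b \<cdot> a))) = tr (\<lambda>x. w \<cdot> (x \<cdot> (a \<cdot> S b)))" for a b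
    proof -
      have "tr (\<lambda>x. (w \<cdot> (x \<cdot> S b)) \<cdot> a) = tr (\<lambda>x. w \<cdot> ((x \<cdot> a) \<cdot> S b))"
        by (rule tr_compose_commute[of "\<lambda>x. x \<cdot> a"]) (intro lf_intros)+
      then show ?thesis by (simp add: mult_assoc)
    qed
    then show ?thesis by simp
  qed
  also have "\<dots> = eps t * tr (\<lambda>x. w \<cdot> (x \<cdot> one))" by (rule sw_antipode_right) (intro lf_intros)
  finally show ?thesis by (simp add: eps_t mult_one_right)
qed

lemma pow_u_\<tau>: "pow u n \<cdot> (\<tau> ^^ n) x = x \<cdot> pow u n"
proof (induction n arbitrary: x)
  case (Suc n)
  have "pow u (Suc n) \<cdot> (\<tau> ^^ Suc n) x = u \<cdot> (pow u n \<cdot> (\<tau> ^^ n) (\<tau> x))"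
    by (simp add: pow_Suc mult_assoc funpow_swap1)
  also have "\<dots> = (u \<cdot> \<tau> x) \<cdot> pow u n" by (simp add: Suc mult_assoc)
  finally show ?case by (simp add: u_\<tau> pow_Suc mult_assoc)
qed (simp add: mult_one_left mult_one_right)

text \<open>The exponent is a period \<open>m\<close> of \<open>\<tau>\<close>: powers of
  \<open>u\<close> with exponent divisible by \<open>m\<close> are central, which yields the trace
  hypothesis of \<open>trc_inverse_nonzero\<close>. The fixed vector is the integral
  \<open>t\<close>, because \<open>eps u = 1\<close>.\<close>

lemma \<mu>_one_nonzero: "\<mu> one \<noteq> 0"
proof -
  obtain w where w: "u \<cdot> w = one" "w \<cdot> u = one" by (rule u_invertible)
  obtain m where m: "m > 0" "\<And>y. (\<tau> ^^ m) y = y" using \<tau>_finite_order by blast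
  have central: "pow u (m * k) \<cdot> x = x \<cdot> pow u (m * k)" for k x
  proof -
    have "(\<tau> ^^ (m * k)) x = x" by (induction k) (simp_all add: m(2) funpow_add)
    then show ?thesis using pow_u_\<tau>[of "m * k" x] by simp
  qed
  have "tr (\<lambda>x. w \<cdot> x) \<noteq> 0"
  proof (rule trc_inverse_nonzero[OF trace_space_axioms finite_B independent_B, of "\<lambda>x. u \<cdot> x" t _ m])
    show "lin (\<lambda>x. u \<cdot> x)" by (intro lf_intros)
    show "t \<noteq> 0" using eps_t lf_0[OF lf_eps] by auto
    show "u \<cdot> t = t" by (simp add: t_left eps_u)
    show "w \<cdot> x \<in> span B \<and> u \<cdot> (w \<cdot> x) = x \<and> w \<cdot> (u \<cdot> x) = x" for x
      by (simp add: w mult_one_left flip: mult_assoc)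
    show "tr ((\<lambda>x. u \<cdot> x) ^^ (m * k + 1)) = tr ((\<lambda>x. u \<cdot> x) ^^ (m * k))" for k
    proof -
      have "(\<lambda>x. u \<cdot> x) ^^ n = (\<lambda>x. pow u n \<cdot> x)" for n by (simp add: fun_eq_iff funpow_mult)
      then show ?thesis using tr_u_mult_central[OF central[of k]] by (simp add: pow_Suc mult_assoc)
    qed
  qed (use m(1) in auto)
  then show ?thesis by (simp add: \<mu>_one_eq_tr_inverse[OF w(2)])
qed

lemma g_eq_one: "g = one"
proof (rule eqI_lf)
  fix p assume p: "lf p"
  note [lf_intros] = lf_comp[OF p]
  have "sw one (\<lambda>a b. p a * \<mu> b) = p one * \<mu> one" by (rule sw_one) (intro bilI lf_intros)
  then show "p g = p one" using sw_\<mu>_right[OF p, of one] \<mu>_one_nonzero by simp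
qed

lemma \<tau>_\<tau>: "\<tau> (\<tau> x) = x"
  using g_mult_\<tau>_\<tau>[of x] by (simp add: g_eq_one mult_one_left mult_one_right)

lemma S_S_eq_\<tau>: "S (S x) = \<tau> x"
  using SS_\<tau>[of "\<tau> x"] by (simp add: \<tau>_\<tau>)

section \<open>From \<open>S^4 = id\<close> to \<open>S^2 = id\<close>\<close>

lemma \<chi>_one: "\<chi> one = of_nat (card B)"
  by (simp add: \<chi>_def trc_def mult_one_left coef_basis)

lemma \<chi>_t: "\<chi> t = 1"
  by (simp add: \<chi>_def t_right tr_mult_t[OF lf_eps] eps_t)

lemma \<chi>_\<tau>: "\<chi> (\<tau> x) = \<chi> x"
proof -
  have "\<chi> (\<tau> x) = tr (\<lambda>z. \<tau> (x \<cdot> \<tau> z))" by (simp add: \<chi>_def \<tau>_mult \<tau>_\<tau>)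
  also have "\<dots> = tr (\<lambda>z. x \<cdot> \<tau> (\<tau> z))" by (rule tr_compose_commute) (intro lf_intros)+
  finally show ?thesis by (simp add: \<chi>_def \<tau>_\<tau>)
qed

text \<open>The tensor square of the regular module is a sum of \<open>dim H\<close> copies of it.
  On characters this is the trace identity with \<open>T = id\<close>, where the symmetry of
  \<open>\<chi>\<close> lets the antipode cancel.\<close>

lemma sw_\<chi>_\<chi>: "sw h (\<lambda>a b. \<chi> a * \<chi> b) = \<chi> one * \<chi> h"
proof -
  have "sw h (\<lambda>a b. tr (\<lambda>x. a \<cdot> x) * \<chi> b) = tr (\<lambda>x. h \<cdot> (\<chi> one *s x))"
  proof (rule tr_mult_coproduct[OF lin_id _ lf_\<chi>])
    show "lin (\<lambda>x. \<chi> one *s x)" by (intro lf_intros)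
    fix q x assume q: "lf q"
    note [lf_intros] = lf_comp[OF q]
    have "sw x (\<lambda>x1 x2. sw x1 (\<lambda>u v. q u * \<chi> (x2 \<cdot> S v))) = sw x (\<lambda>u w. sw w (\<lambda>v x2. q u * \<chi> (S v \<cdot> x2)))"
      unfolding \<chi>_commute[of _ "S _"] by (rule sw_coassoc)
    also have "\<dots> = sw x (\<lambda>u w. eps w * (q u * \<chi> one))"
    proof -
      have "sw w (\<lambda>v x2. q u * \<chi> (S v \<cdot> x2)) = eps w * (q u * \<chi> one)" for u w
        by (rule sw_antipode_left) (intro lf_intros)
      then show ?thesis by simp
    qed
    also have "\<dots> = q x * \<chi> one" by (rule sw_counit_right) (intro lf_intros)
    finally show "sw x (\<lambda>x1 x2. sw x1 (\<lambda>u v. q u * \<chi> (x2 \<cdot> S v))) = q (\<chi> one *s x)"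
      by (simp add: lfD[OF q])
  qed
  then show ?thesis by (simp add: \<chi>_def mult_scale_right tr_scale)
qed

text \<open>Convolution by the regular character, which is \<open>dim H\<close> times an idempotent
  of the dual algebra; so \<open>Q\<close> is \<open>dim H\<close> times a projection.\<close>

definition Q :: "'h \<Rightarrow> 'h" where
  "Q y = (\<Sum>a\<in>B. \<Sum>b\<in>B. D y a b *s (\<chi> a *s b))"

lemma lf_Q: "lf q \<Longrightarrow> q (Q y) = sw y (\<lambda>a b. \<chi> a * q b)"
  using sw_lf[of q y "\<lambda>a b. \<chi> a *s b"] by (simp add: Q_def lfD)

lemma lin_Q: "lin Q"
  unfolding lin_iff Q_def D_add D_scale
  by (simp add: scale_left_distrib sum.distrib scale_sum_right distrib_right mult.assoc)

lemma lin_Q_comp [lf_intros]: "lin f \<Longrightarrow> lin (\<lambda>x. Q (f x))"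
  by (rule lin_compose[OF lin_Q])

lemma Q_Q: "Q (Q y) = of_nat (card B) *s Q y"
proof (rule eqI_lf)
  fix q assume q: "lf q"
  note [lf_intros] = lf_comp[OF q]
  have "q (Q (Q y)) = sw y (\<lambda>a x. \<chi> a * q (Q x))"
    by (rule lf_Q) (intro lf_intros)
  also have "\<dots> = sw y (\<lambda>a x. sw x (\<lambda>b c. \<chi> a * \<chi> b * q c))"
    by (simp add: lf_Q[OF q] mult.assoc sw_cmult)
  also have "\<dots> = sw y (\<lambda>x c. sw x (\<lambda>a b. \<chi> a * \<chi> b) * q c)"
    unfolding sw_coassoc[symmetric] by (simp add: sw_multc)
  also have "\<dots> = of_nat (card B) * sw y (\<lambda>x c. \<chi> x * q c)"
    by (simp add: sw_\<chi>_\<chi> \<chi>_one mult.assoc sw_cmult)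
  finally show "q (Q (Q y)) = q (of_nat (card B) *s Q y)"
    by (simp add: lfD[OF q] lf_Q[OF q])
qed

lemma Q_\<tau>: "Q (\<tau> y) = \<tau> (Q y)"
proof (rule eqI_lf)
  fix q assume q: "lf q"
  note [lf_intros] = lf_comp[OF q]
  have bil: "bil (\<lambda>a b. \<chi> a * q b)" by (intro bilI lf_intros)
  have "q (\<tau> (Q y)) = sw y (\<lambda>a b. \<chi> a * q (\<tau> b))" by (rule lf_Q) (intro lf_intros)
  then show "q (Q (\<tau> y)) = q (\<tau> (Q y))" by (simp add: lf_Q[OF q] sw_\<tau>[OF bil] \<chi>_\<tau>)
qed

text \<open>The trace formula leaves a product \<open>a \<cdot> S b\<close>, which collapses to
  \<open>\<mu> one\<close>; the remaining factor is \<open>\<chi> (S t) = 1\<close>.\<close>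

lemma tr_Q_\<tau>: "tr (\<lambda>x. Q (\<tau> x)) = \<mu> one"
proof -
  have "tr (\<lambda>x. Q (\<tau> x)) = sw t (\<lambda>a b. \<mu> (a \<cdot> Q (\<tau> (Si b))))"
    by (rule tr_eq_sw_t) (intro lf_intros)
  also have "\<dots> = sw t (\<lambda>a x. sw x (\<lambda>b c. \<mu> (a \<cdot> S b) * \<chi> (S c)))"
  proof -
    have "\<mu> (a \<cdot> Q (\<tau> (Si x))) = sw x (\<lambda>b c. \<mu> (a \<cdot> S b) * \<chi> (S c))" for a x
    proof -
      have "\<tau> (Si x) = S x" by (simp flip: S_S_eq_\<tau>)
      then have "\<mu> (a \<cdot> Q (\<tau> (Si x))) = sw (S x) (\<lambda>c b. \<chi> c * \<mu> (a \<cdot> b))"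
        using lf_Q[of "\<lambda>z. \<mu> (a \<cdot> z)"] by (simp add: lf_intros)
      also have "\<dots> = sw x (\<lambda>b c. \<chi> (S c) * \<mu> (a \<cdot> S b))"
        by (rule sw_S) (intro bilI lf_intros)
      finally show ?thesis by (simp add: mult.commute)
    qed
    then show ?thesis by simp
  qed
  also have "\<dots> = sw t (\<lambda>x c. sw x (\<lambda>a b. \<mu> (a \<cdot> S b)) * \<chi> (S c))"
    unfolding sw_coassoc[symmetric] by (simp add: sw_multc)
  also have "\<dots> = sw t (\<lambda>x c. eps x * (\<mu> one * \<chi> (S c)))"
    by (simp add: sw_antipode_right[OF lf_\<mu>] mult.assoc)
  also have "\<dots> = \<mu> one * \<chi> (S t)" by (rule sw_counit_left) (intro lf_intros lin_S)
  finally show ?thesis by (simp add: S_t \<chi>_t)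
qed

text \<open>The trace of the involution \<open>\<tau>\<close> is \<open>\<mu>(1) \<noteq> 0\<close> and is divisible by \<open>card B = dim H\<close>, since
  it is \<open>dim H\<close> times the trace of \<open>\<tau>\<close> on the image of the projection \<open>Q / dim H\<close>. As \<open>\<tau>\<close> fixes
  \<open>one\<close>, this trace is not \<open>- dim H\<close>; so it is \<open>dim H\<close>.\<close>

theorem S_S: "S (S x) = x"
proof -
  define n where "n = card B"
  have n: "n > 0"
  proof -
    have "B \<noteq> {}" using span_B eps_one lf_0[OF lf_eps] by (metis UNIV_I span_empty singletonD zero_neq_one)
    then show ?thesis by (simp add: n_def card_gt_0_iff finite_B)
  qed
  \<comment> \<open>\<open>e\<close> is the projection belonging to \<open>Q\<close>, and
    \<open>P\<close>, \<open>P'\<close> are the projections onto the eigenspaces of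
    \<open>\<tau>\<close> for 1 and -1; the traces of these idempotents are ranks, hence natural
    numbers.\<close>
  define e where "e = (\<lambda>x. inverse (of_nat n) *s Q x)"
  define P where "P = (\<lambda>x. inverse 2 *s (x + \<tau> x))"
  define P' where "P' = (\<lambda>x. inverse 2 *s (x + (- 1) *s \<tau> x))"
  have lin_plus [lf_intros]: "lin (\<lambda>x. f x + f' x)" if "lin f" "lin f'" for f f'
    using that by (simp add: lin_iff algebra_simps)
  have l: "lin e" "lin P" "lin P'" unfolding e_def P_def P'_def by (intro lf_intros)+
  have half: "inverse 2 *s x + inverse 2 *s x = x" for x
    unfolding scale_left_distrib[symmetric] by simp
  have ee: "e (e x) = e x" for x
    using n by (simp add: e_def lin_scale[OF lin_Q] Q_Q flip: n_def)
  have PP: "P (P x) = P x" "P' (P' x) = P' x" for x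
  proof -
    have "P y = y" if "\<tau> y = y" for y using half[of y] that by (simp add: P_def scale_right_distrib)
    moreover have "\<tau> (P x) = P x"
      by (simp add: P_def lin_scale[OF lin_\<tau>] lin_add[OF lin_\<tau>] \<tau>_\<tau> add.commute)
    ultimately show "P (P x) = P x" by blast
    have "P' y = y" if "\<tau> y = (- 1) *s y" for y using half[of y] that by (simp add: P'_def scale_right_distrib)
    moreover have "\<tau> (P' x) = (- 1) *s P' x"
      by (simp only: P'_def lin_scale[OF lin_\<tau>] lin_add[OF lin_\<tau>] \<tau>_\<tau>)
        (simp add: scale_right_distrib scale_right_diff_distrib)
    ultimately show "P' (P' x) = P' x" by blast
  qed
  have Pe: "P (e x) = e (P x)" for x
    by (simp add: P_def e_def lin_scale[OF lin_Q] lin_add[OF lin_Q] lin_scale[OF lin_\<tau>] Q_\<tau> algebra_simps)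
  have nat: "\<exists>k. tr f = of_nat k" if "lin f" "\<And>x. f (f x) = f x" for f
    using trc_idempotent[OF finite_B independent_B that(1)] that(2) by (auto simp: span_B)
  obtain r1 where r1: "tr e = of_nat r1" using nat[OF l(1) ee] by blast
  obtain r where r: "tr P = of_nat r" using nat[OF l(2) PP(1)] by blast
  obtain m where m: "tr P' = of_nat m" using nat[OF l(3) PP(2)] by blast
  have "P (e (P (e x))) = P (e x)" for x by (simp add: Pe ee PP)
  then obtain r2 where r2: "tr (\<lambda>x. P (e x)) = of_nat r2"
    using nat[OF lin_compose[OF l(2,1)]] by blast
  have tr_add: "tr (\<lambda>x. f x + f' x) = tr f + tr f'" for f f'
    by (rule trc_add) (auto simp: independent_B)
  have "tr (\<lambda>x. x) = of_nat n" using \<chi>_one by (simp add: \<chi>_def n_def mult_one_left)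
  moreover have "tr \<tau> = \<mu> one" by (simp add: \<mu>_def mult_one_left)
  ultimately have 1: "2 * of_nat r = of_nat n + \<mu> one" "2 * of_nat m = of_nat n - \<mu> one"
    unfolding r[symmetric] m[symmetric] P_def P'_def tr_scale tr_add by simp_all
  have "2 * of_nat r2 = of_nat r1 + inverse (of_nat n) * \<mu> one"
    unfolding r2[symmetric] r1[symmetric] unfolding P_def e_def tr_scale tr_add
    by (simp add: lin_scale[OF lin_\<tau>] tr_scale tr_Q_\<tau> flip: Q_\<tau>)
  then have 2: "\<mu> one = of_nat n * (2 * of_nat r2 - of_nat r1)" using n by (simp add: field_simps)
  \<comment> \<open>The trace of \<open>\<tau>\<close> on the image of \<open>e\<close>: the fixed
    part has dimension \<open>r2\<close>, the part with eigenvalue -1 has dimension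
    \<open>r1 - r2\<close>.\<close>
  define k where "k = 2 * int r2 - int r1"
  have \<mu>: "\<mu> one = of_int (int n * k)" by (simp add: 2 k_def)
  have "of_int (2 * int r) = (of_int (int n + int n * k) :: 'f)"
    "of_int (2 * int m) = (of_int (int n - int n * k) :: 'f)"
    using 1 by (simp_all add: \<mu>)
  then have rm: "2 * int r = int n * (1 + k)" "2 * int m = int n * (1 - k)"
    unfolding of_int_eq_iff by (simp_all add: algebra_simps)
  have "r \<noteq> 0"
  proof
    assume "r = 0"
    then have "P one = 0" using r by (intro tr_idempotent_eq_0[OF l(2) PP(1)]) simp
    moreover have "P one = one" using half[of one] by (simp add: P_def \<tau>_def Si_one scale_right_distrib)
    ultimately show False using eps_one lf_0[OF lf_eps] by simp
  qed
  then have "int n * (1 + k) > 0" using rm(1) by linarith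
  then have "1 + k > 0" using n by (simp add: zero_less_mult_iff)
  moreover have "k \<noteq> 0" using \<mu> \<mu>_one_nonzero by auto
  ultimately have "1 - k \<le> 0" by simp
  then have "int n * (1 - k) \<le> 0" by (simp add: mult_nonneg_nonpos)
  then have "m = 0" using rm(2) by simp
  then have "P' x = 0" using m by (intro tr_idempotent_eq_0[OF l(3) PP(2)]) simp
  then have "x = \<tau> x" by (simp add: P'_def)
  then show ?thesis by (simp add: S_S_eq_\<tau>)
qed

end

section \<open>Existence of integrals\<close>

lemma lookup_free_scale [simp]:
  "Poly_Mapping.lookup (free_scale c p) k = c * Poly_Mapping.lookup p k"
  unfolding free_scale_def by transfer (simp add: when_def)

interpretation free_vs: vector_space "free_scale :: 'f::field \<Rightarrow> ('k \<Rightarrow>\<^sub>0 'f) \<Rightarrow> ('k \<Rightarrow>\<^sub>0 'f)"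
  by unfold_locales (auto intro!: poly_mapping_eqI simp: lookup_add algebra_simps)

context vector_space
begin

lemma lin_ext_superset:
  assumes "finite K" "Poly_Mapping.keys p \<subseteq> K"
  shows "lin_ext scale f p = (\<Sum>k\<in>K. scale (Poly_Mapping.lookup p k) (f k))"
  unfolding lin_ext_def using assms by (intro sum.mono_neutral_left) (auto simp: in_keys_iff)

lemma lin_ext_add: "lin_ext scale f (p + q) = lin_ext scale f p + lin_ext scale f q"
proof -
  let ?K = "Poly_Mapping.keys p \<union> Poly_Mapping.keys q"
  have "finite ?K" "Poly_Mapping.keys (p + q) \<subseteq> ?K" by (simp_all add: keys_add)
  then show ?thesis
    by (simp add: lin_ext_superset[of ?K] lookup_add scale_left_distrib sum.distrib)
qed

lemma lin_ext_free_scale: "lin_ext scale f (free_scale c p) = scale c (lin_ext scale f p)"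
proof -
  have "Poly_Mapping.keys (free_scale c p) \<subseteq> Poly_Mapping.keys p" by (auto simp: in_keys_iff)
  then show ?thesis
    by (simp add: lin_ext_superset[of "Poly_Mapping.keys p"] scale_sum_right)
qed

lemma lin_ext_single [simp]: "lin_ext scale f (Poly_Mapping.single k c) = scale c (f k)"
  by (simp add: lin_ext_def)

lemma lin_ext_diff: "lin_ext scale f (p - q) = lin_ext scale f p - lin_ext scale f q"
  using lin_ext_add[of f "p - q" q] by simp

lemma lin_ext_0 [simp]: "lin_ext scale f 0 = 0"
  by (simp add: lin_ext_def)

lemma lin_ext_eq_0_on_span:
  assumes "p \<in> free_vs.span G" "\<And>p. p \<in> G \<Longrightarrow> lin_ext scale f p = 0"
  shows "lin_ext scale f p = 0"
  using assms(1)
  by (induction rule: free_vs.span_induct_alt) (simp_all add: lin_ext_add lin_ext_free_scale assms(2))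

end

lemma field_vector_space: "vector_space ((*) :: 'f::field \<Rightarrow> 'f \<Rightarrow> 'f)"
  by unfold_locales (simp_all add: algebra_simps)

lemmas field_lin_ext_add = vector_space.lin_ext_add[OF field_vector_space]
  and field_lin_ext_diff = vector_space.lin_ext_diff[OF field_vector_space]
  and field_lin_ext_free_scale = vector_space.lin_ext_free_scale[OF field_vector_space]
  and field_lin_ext_eq_0_on_span = vector_space.lin_ext_eq_0_on_span[OF field_vector_space]
  and field_lin_ext_single [simp] = vector_space.lin_ext_single[OF field_vector_space]
  and field_lin_ext_0 [simp] = vector_space.lin_ext_0[OF field_vector_space]

lemma lin_ext_sum_fun: "lin_ext (*) (\<lambda>k. \<Sum>i\<in>A. f i k) p = (\<Sum>i\<in>A. lin_ext (*) (f i) p)"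
  unfolding lin_ext_def sum_distrib_left by (rule sum.swap)

lemma lin_ext_multc: "lin_ext (*) (\<lambda>k. f k * c) p = lin_ext (*) f p * c"
  by (simp add: lin_ext_def sum_distrib_right mult.assoc)

lemma lin_ext_compose:
  assumes "\<And>x y. q (x + y) = q x + q y" "\<And>c x. q (s c x) = s' c (q x)" "q 0 = 0"
  shows "q (lin_ext s f p) = lin_ext s' (\<lambda>k. q (f k)) p"
  unfolding lin_ext_def sum_comp_morphism[of q "\<lambda>k. s (Poly_Mapping.lookup p k) (f k)", OF assms(3,1), symmetric]
  by (simp add: o_def assms(2))

lemma lin_ext_lin_ext:
  "lin_ext (*) T (lin_ext free_scale f p) = lin_ext (*) (\<lambda>k. lin_ext (*) T (f k)) p"
  by (rule lin_ext_compose) (simp_all add: field_lin_ext_add field_lin_ext_free_scale)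

text \<open>The universal property of the tensor product: the extension of a bilinear form vanishes
  on the generators of the relations. It makes evaluations of \<open>comult\<close> independent of
  the chosen representative.\<close>

lemma tensor2_eq_lin_ext:
  assumes "tensor2_eq scale p q"
    and "\<And>a a' b. F (a + a') b = F a b + F a' b" "\<And>a b b'. F a (b + b') = F a b + F a b'"
    and "\<And>r a b. F (scale r a) b = r * F a b" "\<And>r a b. F a (scale r b) = r * F a b"
  shows "lin_ext (*) (\<lambda>(a, b). F a b) p = lin_ext (*) (\<lambda>(a, b). F a b) q"
proof -
  have "lin_ext (*) (\<lambda>(a, b). F a b) (p - q) = 0"
    using assms(1) unfolding tensor2_eq_def tensor2_relations_def
    by (rule field_lin_ext_eq_0_on_span)
      (auto simp: field_lin_ext_diff field_lin_ext_free_scale assms(2-))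
  then show ?thesis by (simp add: field_lin_ext_diff)
qed

lemma tensor3_eq_lin_ext:
  assumes "tensor3_eq scale p q"
    and "\<And>a a' b c. F (a + a') b c = F a b c + F a' b c"
    and "\<And>a b b' c. F a (b + b') c = F a b c + F a b' c"
    and "\<And>a b c c'. F a b (c + c') = F a b c + F a b c'"
    and "\<And>r a b c. F (scale r a) b c = r * F a b c"
    and "\<And>r a b c. F a (scale r b) c = r * F a b c"
    and "\<And>r a b c. F a b (scale r c) = r * F a b c"
  shows "lin_ext (*) (\<lambda>(a, b, c). F a b c) p = lin_ext (*) (\<lambda>(a, b, c). F a b c) q"
proof -
  have "lin_ext (*) (\<lambda>(a, b, c). F a b c) (p - q) = 0"
    using assms(1) unfolding tensor3_eq_def tensor3_relations_def
    by (rule field_lin_ext_eq_0_on_span)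
      (auto simp: field_lin_ext_diff field_lin_ext_free_scale assms(2-))
  then show ?thesis by (simp add: field_lin_ext_diff)
qed

locale hopf_algebra_basis = hopf_algebra scale mult one comult counit antipode + fin_basis scale B
  for scale :: "'f::field \<Rightarrow> 'h::ab_group_add \<Rightarrow> 'h" (infixr \<open>*s\<close> 75)
    and mult :: "'h \<Rightarrow> 'h \<Rightarrow> 'h" (infixl \<open>\<cdot>\<close> 76) and one :: 'h
    and comult :: "'h \<Rightarrow> ('h \<times> 'h \<Rightarrow>\<^sub>0 'f)" and counit :: "'h \<Rightarrow> 'f"
    and antipode :: "'h \<Rightarrow> 'h" and B :: "'h set"
begin

definition sweedler :: "'h \<Rightarrow> ('h \<Rightarrow> 'h \<Rightarrow> 'f) \<Rightarrow> 'f" where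
  "sweedler h F = lin_ext (*) (\<lambda>(a, b). F a b) (comult h)"

text \<open>Coefficients of the tensor and not of the representative \<open>comult h\<close>, whose
  support need not lie in \<open>B \<times> B\<close>.\<close>

definition comult_coeff :: "'h \<Rightarrow> 'h \<Rightarrow> 'h \<Rightarrow> 'f" where
  "comult_coeff h a b = sweedler h (\<lambda>x y. coef x a * coef y b)"

lemma sweedler_cong_tensor:
  "tensor2_eq scale (comult h) p \<Longrightarrow> bil F \<Longrightarrow> sweedler h F = lin_ext (*) (\<lambda>(a, b). F a b) p"
  unfolding sweedler_def bil_def lf_def by (rule tensor2_eq_lin_ext) auto

lemma sweedler_eq_sum:
  assumes "bil F"
  shows "sweedler h F = (\<Sum>a\<in>B. \<Sum>b\<in>B. comult_coeff h a b * F a b)"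
proof -
  have "sweedler h F = lin_ext (*) (\<lambda>k. \<Sum>a\<in>B. \<Sum>b\<in>B. coef (fst k) a * coef (snd k) b * F a b) (comult h)"
    unfolding sweedler_def by (simp only: bil_expand[OF assms, symmetric] case_prod_unfold)
  then show ?thesis
    by (simp add: comult_coeff_def sweedler_def lin_ext_sum_fun lin_ext_multc case_prod_unfold)
qed

lemma bil_coef: "bil (\<lambda>x y. coef x a * coef y b)"
  by (intro bilI lf_intros)

lemma comult_coeff_add: "comult_coeff (x + y) a b = comult_coeff x a b + comult_coeff y a b"
  unfolding comult_coeff_def
  by (subst sweedler_cong_tensor[OF comult_add bil_coef])
    (simp add: field_lin_ext_add sweedler_def)

lemma comult_coeff_scale: "comult_coeff (c *s x) a b = c * comult_coeff x a b"
  unfolding comult_coeff_def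
  by (subst sweedler_cong_tensor[OF comult_scale bil_coef])
    (simp add: field_lin_ext_free_scale sweedler_def)

lemma mult_simps:
  "(x + y) \<cdot> z = x \<cdot> z + y \<cdot> z" "z \<cdot> (x + y) = z \<cdot> x + z \<cdot> y"
  "(c *s x) \<cdot> z = c *s (x \<cdot> z)" "z \<cdot> (c *s x) = c *s (z \<cdot> x)"
  using mult_linear_left mult_linear_right by (auto simp: Vector_Spaces.linear_iff)

lemma counit_simps: "counit (x + y) = counit x + counit y" "counit (c *s x) = c * counit x"
  using counit_linear by (auto simp: Vector_Spaces.linear_iff)

lemma comult_coeff_coassoc:
  assumes "p \<in> B" "q \<in> B" "r \<in> B"
  shows "(\<Sum>k\<in>B. comult_coeff h k r * comult_coeff k p q) =
    (\<Sum>k\<in>B. comult_coeff h p k * comult_coeff k q r)"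
proof -
  let ?c = coef
  let ?T = "\<lambda>(x, y, z). ?c x p * ?c y q * ?c z r"
  let ?l = "lin_ext free_scale (\<lambda>(a, b). lin_ext free_scale (\<lambda>(x, y). tens3 x y b) (comult a)) (comult h)"
  let ?r = "lin_ext free_scale (\<lambda>(a, b). lin_ext free_scale (\<lambda>(x, y). tens3 a x y) (comult b)) (comult h)"
  have "lin_ext (*) ?T ?l = sweedler h (\<lambda>a b. sweedler a (\<lambda>x y. ?c x p * ?c y q * ?c b r))"
    by (simp add: lin_ext_lin_ext case_prod_unfold sweedler_def)
  also have "\<dots> = sweedler h (\<lambda>a b. comult_coeff a p q * ?c b r)"
    by (simp add: comult_coeff_def sweedler_def lin_ext_def sum_distrib_right case_prod_unfold mult.assoc)
  also have "\<dots> = (\<Sum>a\<in>B. \<Sum>b\<in>B. comult_coeff h a b * (comult_coeff a p q * ?c b r))"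
    by (rule sweedler_eq_sum)
      (simp add: bil_def lf_def comult_coeff_add comult_coeff_scale coef_add coef_scale algebra_simps)
  also have "\<dots> = (\<Sum>k\<in>B. comult_coeff h k r * comult_coeff k p q)"
    using assms finite_B by (intro sum.cong[OF refl]) (simp add: coef_basis if_distrib[of "\<lambda>x. _ * x"] cong: if_cong)
  finally have l: "lin_ext (*) ?T ?l = (\<Sum>k\<in>B. comult_coeff h k r * comult_coeff k p q)" .
  have "lin_ext (*) ?T ?r = sweedler h (\<lambda>a b. sweedler b (\<lambda>x y. ?c a p * (?c x q * ?c y r)))"
    by (simp add: lin_ext_lin_ext case_prod_unfold sweedler_def mult.assoc)
  also have "\<dots> = sweedler h (\<lambda>a b. ?c a p * comult_coeff b q r)"
    by (simp add: comult_coeff_def sweedler_def lin_ext_def sum_distrib_left case_prod_unfold mult_ac)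
  also have "\<dots> = (\<Sum>a\<in>B. \<Sum>b\<in>B. comult_coeff h a b * (?c a p * comult_coeff b q r))"
    by (rule sweedler_eq_sum)
      (simp add: bil_def lf_def comult_coeff_add comult_coeff_scale coef_add coef_scale algebra_simps)
  also have "\<dots> = (\<Sum>k\<in>B. comult_coeff h p k * comult_coeff k q r)"
    using assms finite_B
    by (subst sum.swap, intro sum.cong[OF refl]) (simp add: coef_basis if_distrib[of "\<lambda>x. x * _"] if_distrib[of "\<lambda>x. _ * x"] cong: if_cong)
  finally have r: "lin_ext (*) ?T ?r = (\<Sum>k\<in>B. comult_coeff h p k * comult_coeff k q r)" .
  have "lin_ext (*) ?T ?l = lin_ext (*) ?T ?r"
    by (rule tensor3_eq_lin_ext[OF coassoc]) (simp_all add: coef_add coef_scale algebra_simps)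
  then show ?thesis by (simp only: l r)
qed

lemma lin_ext_form:
  assumes "\<And>x y. p (x + y) = p x + p y" "\<And>c x. p (c *s x) = c * p x"
  shows "p (lin_ext scale (\<lambda>(a, b). G a b) (comult h)) = sweedler h (\<lambda>a b. p (G a b))"
  unfolding sweedler_def using assms(2)[of 0 0]
  by (subst lin_ext_compose[of p scale "(*)"]) (simp_all add: assms case_prod_unfold)

lemma fin_bialgebra: "fin_bialgebra scale B mult one comult_coeff counit"
proof (intro fin_bialgebra.intro fin_bialgebra_axioms.intro fin_basis_axioms)
  let ?c = coef
  fix h p q x y
  show "(\<Sum>a\<in>B. comult_coeff h a p * counit a) = ?c h p" if "p \<in> B"
  proof -
    have "?c h p = sweedler h (\<lambda>a b. counit a * ?c b p)"
      by (subst counit_left[symmetric], subst lin_ext_form[of "\<lambda>x. ?c x p"]) (simp_all add: coef_add coef_scale)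
    also have "\<dots> = (\<Sum>a\<in>B. \<Sum>b\<in>B. comult_coeff h a b * (counit a * ?c b p))"
      by (rule sweedler_eq_sum) (simp add: bil_def lf_def counit_simps coef_add coef_scale algebra_simps)
    finally show ?thesis
      using that finite_B by (simp add: coef_basis if_distrib[of "\<lambda>x. _ * x"] cong: if_cong)
  qed
  show "(\<Sum>b\<in>B. comult_coeff h p b * counit b) = ?c h p" if "p \<in> B"
  proof -
    have "?c h p = sweedler h (\<lambda>a b. counit b * ?c a p)"
      by (subst counit_right[symmetric], subst lin_ext_form[of "\<lambda>x. ?c x p"]) (simp_all add: coef_add coef_scale)
    also have "\<dots> = (\<Sum>a\<in>B. \<Sum>b\<in>B. comult_coeff h a b * (counit b * ?c a p))"
      by (rule sweedler_eq_sum) (simp add: bil_def lf_def counit_simps coef_add coef_scale algebra_simps)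
    also have "\<dots> = (\<Sum>b\<in>B. \<Sum>a\<in>B. comult_coeff h a b * (counit b * ?c a p))"
      by (rule sum.swap)
    finally show ?thesis
      using that finite_B by (simp add: coef_basis if_distrib[of "\<lambda>x. _ * x"] cong: if_cong)
  qed
  show "comult_coeff one p q = ?c one p * ?c one q"
    unfolding comult_coeff_def
    by (subst sweedler_cong_tensor[OF comult_one bil_coef]) simp
  show "comult_coeff (x \<cdot> y) p q = (\<Sum>a\<in>B. \<Sum>b\<in>B. \<Sum>c\<in>B. \<Sum>d\<in>B.
      comult_coeff x a b * comult_coeff y c d * ?c (a \<cdot> c) p * ?c (b \<cdot> d) q)"
  proof -
    have "comult_coeff (x \<cdot> y) p q = sweedler x (\<lambda>a b. sweedler y (\<lambda>c d. ?c (a \<cdot> c) p * ?c (b \<cdot> d) q))"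
      unfolding comult_coeff_def
      by (subst sweedler_cong_tensor[OF comult_mult bil_coef])
        (simp add: lin_ext_lin_ext case_prod_unfold sweedler_def)
    also have "\<dots> = sweedler x (\<lambda>a b. \<Sum>c\<in>B. \<Sum>d\<in>B. comult_coeff y c d * (?c (a \<cdot> c) p * ?c (b \<cdot> d) q))"
      by (subst sweedler_eq_sum[of _ y])
        (simp_all add: bil_def lf_def mult_simps coef_add coef_scale algebra_simps)
    also have "\<dots> = (\<Sum>a\<in>B. \<Sum>b\<in>B. comult_coeff x a b *
        (\<Sum>c\<in>B. \<Sum>d\<in>B. comult_coeff y c d * (?c (a \<cdot> c) p * ?c (b \<cdot> d) q)))"
      by (rule sweedler_eq_sum)
        (simp add: bil_def lf_def mult_simps coef_add coef_scale algebra_simps sum.distrib sum_distrib_left)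
    finally show ?thesis by (simp add: sum_distrib_left mult.assoc)
  qed
qed (simp_all add: mult_simps mult_assoc mult_one_left mult_one_right comult_coeff_add
    comult_coeff_scale comult_coeff_coassoc counit_simps counit_mult counit_one)

sublocale FB: fin_bialgebra scale B mult one comult_coeff counit
  by (rule fin_bialgebra)

lemma sw_eq_sweedler: "bil F \<Longrightarrow> FB.sw h F = sweedler h F"
  by (simp add: FB.sw_def sweedler_eq_sum)

sublocale FH: fin_hopf scale B mult one comult_coeff counit antipode
proof (intro fin_hopf.intro fin_hopf_axioms.intro)
  show "fin_bialgebra scale B mult one comult_coeff counit" by (rule fin_bialgebra)
  show "Vector_Spaces.linear scale scale antipode" by (rule antipode_linear)
  fix p h assume p: "lf p"
  note lfp = lfD[OF p]
  note [lf_intros] = lf_comp[OF p] lin_compose[OF antipode_linear]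
  show "FB.sw h (\<lambda>a b. p (antipode a \<cdot> b)) = counit h * p one"
    using lin_ext_form[of p "\<lambda>a b. antipode a \<cdot> b" h] lfp
    by (subst sw_eq_sweedler) (intro bilI lf_intros, simp add: antipode_left)
  show "FB.sw h (\<lambda>a b. p (a \<cdot> antipode b)) = counit h * p one"
    using lin_ext_form[of p "\<lambda>a b. a \<cdot> antipode b" h] lfp
    by (subst sw_eq_sweedler) (intro bilI lf_intros, simp add: antipode_right)
qed

end

section \<open>Integrals in the semisimple and in the cosemisimple case\<close>

locale fin_hopf_char_0 = fin_hopf scale B mult one D eps S
  for scale :: "'f::field_char_0 \<Rightarrow> 'h::ab_group_add \<Rightarrow> 'h" (infixr \<open>*s\<close> 75)
    and B :: "'h set" and mult :: "'h \<Rightarrow> 'h \<Rightarrow> 'h" (infixl \<open>\<cdot>\<close> 76) and one :: 'h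
    and D :: "'h \<Rightarrow> 'h \<Rightarrow> 'h \<Rightarrow> 'f" and eps :: "'h \<Rightarrow> 'f" and S :: "'h \<Rightarrow> 'h"
begin

lemma S_S_if_integral:
  assumes "\<And>h. h \<cdot> t = eps h *s t" "\<And>h. t \<cdot> h = eps h *s t" "eps t = 1"
  shows "S (S x) = x"
proof -
  interpret hopf_with_integral scale B mult one D eps S t
    by (intro hopf_with_integral.intro hopf_with_integral_axioms.intro fin_hopf_axioms assms)
  show ?thesis by (rule S_S)
qed

text \<open>The element \<open>t\<close> representing \<open>l\<close> is an integral of the dual
  Hopf algebra, whose antipode \<open>dS\<close> is the transpose of \<open>S\<close>.\<close>

lemma S_S_if_dual_integral:
  assumes l: "lf l" "l one = 1"
    and left: "\<And>p h. lf p \<Longrightarrow> sw h (\<lambda>a b. p a * l b) = p one * l h"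
    and right: "\<And>p h. lf p \<Longrightarrow> sw h (\<lambda>a b. l a * p b) = l h * p one"
  shows "S (S x) = x"
proof -
  define t where "t = (\<Sum>b\<in>B. l b *s b)"
  have t: "pair t h = l h" for h unfolding t_def by (rule pair_sum_basis[OF l(1)])
  have dS: "dS (dS z) = z" for z
  proof (rule hopf_with_integral.S_S[OF hopf_with_integral.intro[OF dual_hopf hopf_with_integral_axioms.intro]])
    show "dmult z t = pair z one *s t" for z
      by (rule eqI_pair) (simp add: pair_dmult pair_scale t left lf_pair)
    show "dmult t z = pair z one *s t" for z
      by (rule eqI_pair) (simp only: pair_dmult pair_scale t right[OF lf_pair] mult.commute)
    show "pair t one = 1" by (simp add: t l(2))
  qed
  have "p (S (S x)) = p x" if p: "lf p" for p
  proof -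
    have "pair z (S (S x)) = pair z x" for z
      using dS[of z] by (simp flip: pair_dS)
    then show ?thesis using pair_sum_basis[OF p] by metis
  qed
  then show ?thesis by (rule eqI_lf)
qed

end

context fin_bialgebra
begin

lemma exists_lf_separating:
  assumes W: "subspace W" and v: "v \<notin> W"
  obtains p where "lf p" "p v = 1" "\<And>w. w \<in> W \<Longrightarrow> p w = 0"
proof -
  obtain C where C: "finite C" "independent C" "span C = W"
    using finite_basis_of_subspace[OF finite_B W] by (auto simp: span_B)
  have "independent (insert v C)" using v C by (simp add: independent_insert)
  then obtain q where q: "lin q" "\<And>b. b \<in> insert v C \<Longrightarrow> q b = (if b = v then one else 0)"
    using exists_lin_extension[of "insert v C" "\<lambda>b. if b = v then one else 0"] by metis
  have "q w = 0" if "w \<in> span C" for w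
    using that
  proof (induction rule: module.span_induct_alt[OF module_axioms, consumes 1, case_names base step])
    case base
    then show ?case by (rule lin_0[OF q(1)])
  next
    case (step c z y)
    then have "z \<noteq> v" using v C(3) span_base by blast
    then show ?case using step q(2)[of z] by (simp add: lin_add[OF q(1)] lin_scale[OF q(1)])
  qed
  then show ?thesis
    using C(3) q(2)[of v] by (intro that[of "\<lambda>x. eps (q x)"] lf_comp[OF lf_eps q(1)])
      (simp_all add: eps_one lf_0[OF lf_eps])
qed

definition star :: "('h \<Rightarrow> 'f) \<Rightarrow> ('h \<Rightarrow> 'f) \<Rightarrow> 'h \<Rightarrow> 'f" where
  "star p q h = sw h (\<lambda>a b. p a * q b)"

lemma lf_star: "lf (star p q)"
  unfolding star_def[abs_def] by (rule lf_sw)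

lemma star_assoc: "star (star p q) r = star p (star q r)"
proof
  fix h
  have "star (star p q) r h = sw h (\<lambda>x c. sw x (\<lambda>a b. p a * q b * r c))"
    by (simp add: star_def sw_multc)
  also have "\<dots> = star p (star q r) h"
    by (simp add: star_def sw_coassoc sw_cmult mult.assoc)
  finally show "star (star p q) r h = star p (star q r) h" .
qed

lemma star_one: "lf p \<Longrightarrow> lf q \<Longrightarrow> star p q one = p one * q one"
  unfolding star_def by (rule sw_one) (auto intro!: bilI lf_intros)

end

context hopf_algebra_basis
begin

text \<open>The component \<open>t\<close> of \<open>one\<close> in a complement of the augmentation
  ideal is a left integral. For the other side, each defect \<open>y\<close> of the right integral
  law is a left integral with counit 0, so \<open>y \<cdot> y = 0\<close>; a complement of the line
  spanned by \<open>y\<close> then contains \<open>y\<close>, which forces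
  \<open>y = 0\<close>.\<close>

lemma semisimple_integral:
  assumes semisimple_algebra
  obtains t where "\<And>h. h \<cdot> t = counit h *s t" "\<And>h. t \<cdot> h = counit h *s t" "counit t = 1"
proof -
  have complement: "\<exists>J. left_ideal J \<and> I \<inter> J = {0} \<and> (\<exists>x\<in>I. \<exists>y\<in>J. one = x + y)" if I: "left_ideal I" for I
  proof -
    obtain J where J: "left_ideal J" "I \<inter> J = {0}" "{x + y |x y. x \<in> I \<and> y \<in> J} = UNIV"
      using assms[unfolded semisimple_algebra_def, rule_format, OF I] by blast
    have "one \<in> {x + y |x y. x \<in> I \<and> y \<in> J}" unfolding J(3) by simp
    then show ?thesis using J(1,2) by blast
  qed
  have counit_0: "counit 0 = 0" using counit_simps(2)[of 0 0] by simp
  have "left_ideal {x. counit x = 0}"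
    by (auto simp: left_ideal_def subspace_def counit_simps counit_mult counit_0)
  then obtain J i t where J: "left_ideal J" "{x. counit x = 0} \<inter> J = {0}"
    and t: "counit i = 0" "t \<in> J" "one = i + t"
    using complement by blast
  have eps_t: "counit t = 1" using t counit_one by (simp add: counit_simps)
  have counit_diff: "counit (x - y) = counit x - counit y" for x y
    using counit_simps(1)[of "x - y" y] by simp
  have left: "h \<cdot> t = counit h *s t" for h
  proof -
    have "h \<cdot> t - counit h *s t \<in> J"
      using J(1) t(2) by (auto simp: left_ideal_def intro: subspace_diff subspace_scale)
    moreover have "counit (h \<cdot> t - counit h *s t) = 0"
      by (simp add: counit_diff counit_mult counit_simps eps_t)
    ultimately have "h \<cdot> t - counit h *s t \<in> {x. counit x = 0} \<inter> J" by simp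
    then show ?thesis unfolding J(2) by simp
  qed
  have right: "t \<cdot> h = counit h *s t" for h
  proof -
    define y where "y = t \<cdot> h - counit h *s t"
    have y: "h' \<cdot> y = counit h' *s y" for h'
    proof -
      have "h' \<cdot> y + h' \<cdot> (counit h *s t) = h' \<cdot> (t \<cdot> h)"
        by (simp add: y_def flip: mult_simps(2))
      then show ?thesis
        by (simp add: y_def scale_right_diff_distrib mult_simps left mult.commute eq_diff_eq flip: mult_assoc)
    qed
    have "y \<cdot> y = 0" unfolding y by (simp add: y_def counit_diff counit_mult counit_simps eps_t)
    have "h' \<cdot> (c *s y) = (c * counit h') *s y" for h' c
      using y[of h'] by (simp add: mult_simps)
    then have "left_ideal (span {y})"
      unfolding left_ideal_def using subspace_span[of "{y}"] by (auto simp: span_singleton)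
    then obtain J' c j where J': "left_ideal J'" "span {y} \<inter> J' = {0}" "j \<in> J'" "one = c *s y + j"
      using complement[of "span {y}"] by (auto simp: span_singleton)
    have "y = y \<cdot> (c *s y + j)" using mult_one_right[of y] J'(4) by simp
    then have "y = y \<cdot> j" by (simp add: mult_simps \<open>y \<cdot> y = 0\<close>)
    then have "y \<in> J'" using J'(1,3) unfolding left_ideal_def by metis
    then have "y = 0" using J'(2) span_base[of y "{y}"] by blast
    then show ?thesis by (simp add: y_def)
  qed
  show ?thesis by (rule that[OF left right eps_t])
qed

lemma sw_eq_0_subcoalgebra:
  assumes "subcoalgebra C" "c \<in> C" and F: "bil F" "\<And>a b. a \<in> C \<Longrightarrow> b \<in> C \<Longrightarrow> F a b = 0"
  shows "FB.sw c F = 0"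
proof -
  obtain p where p: "Poly_Mapping.keys p \<subseteq> C \<times> C" "tensor2_eq scale (comult c) p"
    using assms unfolding subcoalgebra_def by blast
  have "FB.sw c F = lin_ext (*) (\<lambda>(a, b). F a b) p"
    using sw_eq_sweedler[OF F(1)] sweedler_cong_tensor[OF p(2)] F(1) by simp
  also have "\<dots> = 0"
    unfolding lin_ext_def using p(1) F(2) by (intro sum.neutral) auto
  finally show ?thesis .
qed

lemma subcoalgebra_span_one: "subcoalgebra (span {one})"
  unfolding subcoalgebra_def
proof (intro conjI ballI)
  fix c assume "c \<in> span {one}"
  then obtain r where c: "c = r *s one" by (auto simp: span_singleton)
  let ?p = "free_scale r (tens2 one one)"
  have "tensor2_eq scale (comult c) ?p"
  proof -
    have "subspace' = free_vs.subspace \<Longrightarrow> subspace' (tensor2_relations scale)" for subspace'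
      by (simp add: tensor2_relations_def free_vs.subspace_span)
    then have sub: "free_vs.subspace (tensor2_relations scale)" by simp
    have "(comult c - free_scale r (comult one)) + free_scale r (comult one - tens2 one one)
        \<in> tensor2_relations scale"
      using comult_scale[of r one] comult_one unfolding c tensor2_eq_def
      by (intro free_vs.subspace_add[OF sub] free_vs.subspace_scale[OF sub])
    then show ?thesis by (simp add: tensor2_eq_def free_vs.scale_right_diff_distrib)
  qed
  moreover have "Poly_Mapping.keys ?p \<subseteq> span {one} \<times> span {one}"
    by (auto simp: in_keys_iff lookup_single when_def span_base split: if_splits)
  ultimately show "\<exists>p. Poly_Mapping.keys p \<subseteq> span {one} \<times> span {one} \<and> tensor2_eq scale (comult c) p"
    by blast
qed (rule subspace_span)

text \<open>The integral is 1 at \<open>one\<close> and vanishes on all simple subcoalgebras other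
  than the line of \<open>one\<close>. It exists because \<open>one\<close> lies outside their span,
  which is shown by convolution products of separating functionals: these are multiplicative at
  \<open>one\<close>.\<close>

lemma cosemisimple_integral:
  assumes cosemisimple_coalgebra
  obtains l where "lf l" "l one = 1"
    "\<And>p h. lf p \<Longrightarrow> FB.sw h (\<lambda>a b. p a * l b) = p one * l h"
    "\<And>p h. lf p \<Longrightarrow> FB.sw h (\<lambda>a b. l a * p b) = l h * p one"
proof -
  define U where "U = \<Union>{C. simple_subcoalgebra C \<and> C \<noteq> span {one}}"
  have bil: "bil (\<lambda>a b. p a * q b)" if "lf p" "lf q" for p q
    using that by (intro bilI lf_cmult lf_multc)
  have one_neq: "one \<noteq> 0" using counit_one counit_simps(2)[of 0 0] by auto
  have U: "\<exists>C. subcoalgebra C \<and> x \<in> C \<and> one \<notin> C \<and> C \<subseteq> U" if x: "x \<in> U" for x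
  proof -
    obtain C where C: "simple_subcoalgebra C" "C \<noteq> span {one}" "x \<in> C"
      using x unfolding U_def by blast
    then have sC: "subspace C" "subcoalgebra C" by (auto simp: simple_subcoalgebra_def subcoalgebra_def)
    have "one \<notin> C"
    proof
      assume "one \<in> C"
      then have "span {one} \<subseteq> C" using sC(1) by (intro span_minimal) auto
      then have "span {one} = {0}"
        using C(1,2) subcoalgebra_span_one by (auto simp: simple_subcoalgebra_def)
      then show False using one_neq span_base[of one "{one}"] by auto
    qed
    then show ?thesis using C sC by (intro exI[of _ C]) (auto simp: U_def)
  qed
  have span: "span (insert one U) = UNIV"
  proof -
    have "\<Union>{C. simple_subcoalgebra C} \<subseteq> span (insert one U)"
    proof
      fix x assume "x \<in> \<Union>{C. simple_subcoalgebra C}"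
      then consider "x \<in> U" | "x \<in> span {one}" unfolding U_def by blast
      then show "x \<in> span (insert one U)"
        using span_mono[of "{one}" "insert one U"] by cases (auto intro: span_base)
    qed
    then show ?thesis using assms span_minimal[OF _ subspace_span] unfolding cosemisimple_coalgebra_def by blast
  qed
  \<comment> \<open>The factors \<open>p'\<close> and \<open>q\<close> on both sides make the
    condition stable under products, so that the functionals found for individual simple
    subcoalgebras can be multiplied together.\<close>
  have "\<exists>p. lf p \<and> p one = 1 \<and> (\<forall>p' q. lf p' \<longrightarrow> lf q \<longrightarrow> FB.star p' (FB.star p q) x = 0)"
    if "x \<in> span U" for x
    using that
  proof (induction rule: module.span_induct_alt[OF module_axioms, consumes 1, case_names base step])
    case base
    show ?case using lf_0[OF FB.lf_star] counit_one FB.lf_eps by blast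
  next
    case (step c x y)
    obtain p where p: "lf p" "p one = 1" "\<And>p' q. lf p' \<Longrightarrow> lf q \<Longrightarrow> FB.star p' (FB.star p q) y = 0"
      using step.IH by blast
    obtain C where C: "subcoalgebra C" "x \<in> C" "one \<notin> C" using U step.hyps by blast
    then obtain r where r: "lf r" "r one = 1" "\<And>w. w \<in> C \<Longrightarrow> r w = 0"
      using FB.exists_lf_separating[of C one] by (auto simp: subcoalgebra_def)
    have rC: "FB.star r q w = 0" if "lf q" "w \<in> C" for q w
      unfolding FB.star_def using C(1) that by (intro sw_eq_0_subcoalgebra bil r) (auto simp: r(3))
    have "FB.star p' (FB.star r q) x = 0" if "lf p'" "lf q" for p' q
      unfolding FB.star_def[of p'] using C that
      by (intro sw_eq_0_subcoalgebra bil FB.lf_star) (auto simp: rC)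
    then have "FB.star p' (FB.star (FB.star r p) q) (c *s x + y) = 0" if "lf p'" "lf q" for p' q
      using that p(3)[of "FB.star p' r" q]
      by (simp add: lfD[OF FB.lf_star] FB.star_assoc FB.lf_star)
    then show ?case
      using FB.star_one[OF r(1) p(1)] r(2) p(2) FB.lf_star by (intro exI[of _ "FB.star r p"]) simp
  qed
  then have "one \<notin> span U"
    using FB.star_one FB.lf_star FB.lf_eps counit_one by (metis mult_1 zero_neq_one)
  then obtain l where l: "lf l" "l one = 1" "\<And>w. w \<in> span U \<Longrightarrow> l w = 0"
    using FB.exists_lf_separating[OF subspace_span] by blast
  \<comment> \<open>On a subcoalgebra inside \<open>U\<close> everything vanishes with
    \<open>l\<close>; at \<open>one\<close> the coproduct is
    \<open>one \<otimes> one\<close>.\<close>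
  have "FB.sw h (\<lambda>a b. p a * l b) = p one * l h \<and> FB.sw h (\<lambda>a b. l a * p b) = l h * p one"
    if p: "lf p" for p h
  proof -
    have "h \<in> span (insert one U)" by (simp add: span)
    then show ?thesis
    proof (induction rule: module.span_induct_alt[OF module_axioms, consumes 1, case_names base step])
      case base
      then show ?case by (simp add: lf_0[OF FB.lf_sw] lf_0[OF l(1)])
    next
      case (step c x y)
      have "FB.sw x (\<lambda>a b. p a * l b) = p one * l x \<and> FB.sw x (\<lambda>a b. l a * p b) = l x * p one"
      proof (cases "x \<in> U")
        case True
        then obtain C where C: "subcoalgebra C" "x \<in> C" "C \<subseteq> U" using U by blast
        then have "l w = 0" if "w \<in> C" for w using that l(3) span_base by blast
        then show ?thesis
          using C(1,2) l(1) p by (simp add: sw_eq_0_subcoalgebra bil)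
      next
        case False
        then have "x = one" using step.hyps by simp
        then show ?thesis
          using FB.sw_one[OF bil[OF p l(1)]] FB.sw_one[OF bil[OF l(1) p]] by simp
      qed
      then show ?case
        using step.IH by (simp add: lfD[OF FB.lf_sw] lfD[OF l(1)] algebra_simps)
    qed
  qed
  then show ?thesis using that l(1,2) by blast
qed

end

lemma antipode_antipode:
  fixes scale :: "'f::field_char_0 \<Rightarrow> 'h::ab_group_add \<Rightarrow> 'h"
    and mult :: "'h \<Rightarrow> 'h \<Rightarrow> 'h" and one :: 'h
  assumes "hopf_algebra_basis scale mult one comult counit antipode B"
    and ss: "unital_algebra.semisimple_algebra scale mult \<or> coalgebra.cosemisimple_coalgebra scale comult"
  shows "antipode (antipode x) = x"
proof -
  interpret hopf_algebra_basis scale mult one comult counit antipode B by fact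
  interpret c: fin_hopf_char_0 scale B mult one comult_coeff counit antipode ..
  from ss show ?thesis
  proof
    assume semisimple_algebra
    then show ?thesis using semisimple_integral c.S_S_if_integral by metis
  next
    assume cosemisimple_coalgebra
    then obtain l where "lf l" "l one = 1"
      "\<And>p h. lf p \<Longrightarrow> FB.sw h (\<lambda>a b. p a * l b) = p one * l h"
      "\<And>p h. lf p \<Longrightarrow> FB.sw h (\<lambda>a b. l a * p b) = l h * p one"
      using cosemisimple_integral by blast
    then show ?thesis by (rule c.S_S_if_dual_integral)
  qed
qed

section \<open>The radicals of a Lie algebra\<close>

locale lie_algebra_basis = lie_algebra scale bracket + fin_basis scale E
  for scale :: "'f::field_char_0 \<Rightarrow> 'l::ab_group_add \<Rightarrow> 'l" (infixr \<open>*s\<close> 75)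
    and bracket :: "'l \<Rightarrow> 'l \<Rightarrow> 'l" (\<open>\<lbrace>_, _\<rbrace>\<close>) and E :: "'l set"
begin

lemmas basis = finite_B independent_B span_B

sublocale finite_dimensional_vector_space scale E
  by unfold_locales (rule basis)+

lemma br_simps:
  "\<lbrace>a + b, c\<rbrace> = \<lbrace>a, c\<rbrace> + \<lbrace>b, c\<rbrace>" "\<lbrace>c, a + b\<rbrace> = \<lbrace>c, a\<rbrace> + \<lbrace>c, b\<rbrace>"
  "\<lbrace>r *s a, c\<rbrace> = r *s \<lbrace>a, c\<rbrace>" "\<lbrace>c, r *s a\<rbrace> = r *s \<lbrace>c, a\<rbrace>"
  using bracket_linear_left bracket_linear_right by (auto simp: Vector_Spaces.linear_iff)

lemma br_0 [simp]: "\<lbrace>0, a\<rbrace> = 0" "\<lbrace>a, 0\<rbrace> = 0"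
  using br_simps(3)[of 0 0 a] br_simps(4)[of a 0 0] by simp_all

lemma br_anticommute: "\<lbrace>b, a\<rbrace> = (- 1) *s \<lbrace>a, b\<rbrace>"
proof -
  have "\<lbrace>a, b\<rbrace> + \<lbrace>b, a\<rbrace> = 0"
    using bracket_self[of "a + b", unfolded br_simps] by (simp add: bracket_self add.commute)
  then show ?thesis by (simp add: eq_neg_iff_add_eq_0 add.commute)
qed

lemma br_br: "\<lbrace>\<lbrace>a, b\<rbrace>, x\<rbrace> = \<lbrace>a, \<lbrace>b, x\<rbrace>\<rbrace> - \<lbrace>b, \<lbrace>a, x\<rbrace>\<rbrace>"
proof -
  have "\<lbrace>x, \<lbrace>a, b\<rbrace>\<rbrace> = - \<lbrace>\<lbrace>a, b\<rbrace>, x\<rbrace>" "\<lbrace>b, \<lbrace>x, a\<rbrace>\<rbrace> = - \<lbrace>b, \<lbrace>a, x\<rbrace>\<rbrace>"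
    using br_anticommute[of x "\<lbrace>a, b\<rbrace>"] br_anticommute[of x a] br_simps(4)[of b "- 1" "\<lbrace>a, x\<rbrace>"] by simp_all
  then have "- \<lbrace>\<lbrace>a, b\<rbrace>, x\<rbrace> + \<lbrace>a, \<lbrace>b, x\<rbrace>\<rbrace> + - \<lbrace>b, \<lbrace>a, x\<rbrace>\<rbrace> = 0" using jacobi[of x a b] by simp
  then show ?thesis by (simp add: algebra_simps)
qed

section \<open>Words in adjoint operators and their traces\<close>

primrec word :: "'l list \<Rightarrow> 'l \<Rightarrow> 'l" where
  "word [] x = x"
| "word (a # w) x = \<lbrace>a, word w x\<rbrace>"

lemma word_append: "word (v @ w) x = word v (word w x)"
  by (induction v) simp_all

lemma word_Cons: "word (a # w) = (\<lambda>x. \<lbrace>a, word w x\<rbrace>)"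
  by (simp add: fun_eq_iff)

lemma lin_word: "lin (word w)"
  by (induction w) (simp_all add: lin_iff br_simps)

lemma lin_br: "lin (bracket a)"
  by (simp add: lin_iff br_simps)

lemma tr_word_rotate: "tr (word (v @ w)) = tr (word (w @ v))"
proof -
  have "tr (\<lambda>x. word v (word w x)) = tr (\<lambda>x. word w (word v x))"
    by (rule trc_compose_commute) (auto simp: basis lin_word)
  then show ?thesis by (simp add: word_append[abs_def])
qed

text \<open>The elements whose adjoint operator lies in the radical of the trace form on the associative
  algebra generated by all adjoint operators.\<close>

definition N :: "'l set" where
  "N = {a. \<forall>w. tr (word (a # w)) = 0}"

lemma tr_word_N: "a \<in> N \<Longrightarrow> tr (word (v @ a # w)) = 0"
  using tr_word_rotate[of v "a # w"] by (simp add: N_def)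

lemma tr_word_br: "tr (word (v @ \<lbrace>a, b\<rbrace> # w)) = tr (word (v @ a # b # w)) - tr (word (v @ b # a # w))"
proof -
  have "word (v @ \<lbrace>a, b\<rbrace> # w) x = word (v @ a # b # w) x + (- 1) *s word (v @ b # a # w) x" for x
    using lin_word[of v] by (simp add: word_append br_br lin_iff flip: lin_scale[OF lin_word])
      (metis (no_types, lifting) add_diff_cancel diff_add_cancel diff_conv_add_uminus)
  then have "word (v @ \<lbrace>a, b\<rbrace> # w) = (\<lambda>x. word (v @ a # b # w) x + (- 1) *s word (v @ b # a # w) x)"
    by (rule ext)
  then have "tr (word (v @ \<lbrace>a, b\<rbrace> # w)) = tr (word (v @ a # b # w)) + (- 1) * tr (word (v @ b # a # w))"
    by (simp only: tr_add tr_scale)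
  then show ?thesis by simp
qed

lemma lie_ideal_N: "lie_ideal N"
  unfolding lie_ideal_def subspace_def
proof (intro conjI ballI allI)
  show "0 \<in> N" using tr_scale[of 0] by (simp add: N_def word_Cons)
  show "a + b \<in> N" if "a \<in> N" "b \<in> N" for a b
    using that by (simp add: N_def word_Cons br_simps tr_add)
  show "c *s a \<in> N" if "a \<in> N" for a c
    using that by (simp add: N_def word_Cons br_simps tr_scale)
  show "\<lbrace>b, a\<rbrace> \<in> N" if a: "a \<in> N" for a b
    unfolding N_def
  proof (intro CollectI allI)
    fix w
    show "tr (word (\<lbrace>b, a\<rbrace> # w)) = 0"
      using tr_word_br[of "[]" b a w] tr_word_N[OF a, of "[b]"] tr_word_N[OF a, of "[]"] by simp
  qed
qed

lemma lie_idealD: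
  assumes "lie_ideal U"
  shows "subspace U" "a \<in> U \<Longrightarrow> \<lbrace>b, a\<rbrace> \<in> U" "a \<in> U \<Longrightarrow> \<lbrace>a, b\<rbrace> \<in> U" "a \<in> U \<Longrightarrow> word w a \<in> U"
proof -
  show *: "subspace U" "\<And>b. a \<in> U \<Longrightarrow> \<lbrace>b, a\<rbrace> \<in> U" for a using assms by (auto simp: lie_ideal_def)
  show "a \<in> U \<Longrightarrow> \<lbrace>a, b\<rbrace> \<in> U"
    using *(2) subspace_scale[OF *(1), of "\<lbrace>b, a\<rbrace>" "- 1"] br_anticommute[of a b] by simp
  show "a \<in> U \<Longrightarrow> word w a \<in> U" by (induction w) (simp_all add: *)
qed

lemma lie_ideal_br_sym: "lie_ideal U \<Longrightarrow> \<lbrace>a, b\<rbrace> \<in> U \<Longrightarrow> \<lbrace>b, a\<rbrace> \<in> U"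
  using subspace_scale[OF lie_idealD(1), of U "\<lbrace>a, b\<rbrace>" "- 1"] br_anticommute[of b a] by simp

lemma bracket_span_minimal:
  "subspace W \<Longrightarrow> (\<And>a b. a \<in> A \<Longrightarrow> b \<in> B \<Longrightarrow> \<lbrace>a, b\<rbrace> \<in> W) \<Longrightarrow> bracket_span A B \<subseteq> W"
  unfolding bracket_span_def by (rule span_minimal) auto

lemma bracket_span_memI: "a \<in> A \<Longrightarrow> b \<in> B \<Longrightarrow> \<lbrace>a, b\<rbrace> \<in> bracket_span A B"
  unfolding bracket_span_def by (rule span_base) auto

lemma lie_ideal_bracket_span:
  assumes A: "lie_ideal A" and B: "lie_ideal B"
  shows "lie_ideal (bracket_span A B)"
  unfolding lie_ideal_def
proof (intro conjI allI ballI)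
  show sub: "subspace (bracket_span A B)" unfolding bracket_span_def by (rule subspace_span)
  fix x y assume "y \<in> bracket_span A B"
  then show "\<lbrace>x, y\<rbrace> \<in> bracket_span A B"
    unfolding bracket_span_def
  proof (induction rule: module.span_induct_alt[OF module_axioms, consumes 1, case_names base step])
    case base
    then show ?case by (simp add: span_zero)
  next
    case (step c z y)
    then obtain a b where ab: "z = \<lbrace>a, b\<rbrace>" "a \<in> A" "b \<in> B" by blast
    have "\<lbrace>x, z\<rbrace> = \<lbrace>\<lbrace>x, a\<rbrace>, b\<rbrace> + \<lbrace>a, \<lbrace>x, b\<rbrace>\<rbrace>" using br_br[of x a b] by (simp add: ab(1))
    also have "\<dots> \<in> bracket_span A B"
      using ab(2,3) A B sub by (intro subspace_add bracket_span_memI) (auto intro: lie_idealD)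
    finally show ?case
      using step.IH unfolding bracket_span_def by (simp add: br_simps span_add span_scale)
  qed
qed

lemma lie_ideal_derived_series: "lie_ideal I \<Longrightarrow> lie_ideal (derived_series I n)"
  by (induction n) (simp_all add: lie_ideal_bracket_span)

lemma lie_ideal_lower_central_series: "lie_ideal I \<Longrightarrow> lie_ideal (lower_central_series I n)"
  by (induction n) (simp_all add: lie_ideal_bracket_span)

section \<open>The nilpotent radical\<close>

text \<open>Every letter preserves the terms of the lower central series of \<open>I\<close>, and
  \<open>a\<close> moves them one term down; so \<open>word (a # w)\<close> is nilpotent.\<close>

lemma nilpotent_ideal_subset_N:
  assumes "nilpotent_ideal I"
  shows "I \<subseteq> N"
proof
  fix a assume a: "a \<in> I"
  obtain n where I: "lie_ideal I" and n: "lower_central_series I n = {0}"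
    using assms by (auto simp: nilpotent_ideal_def)
  have "tr (word (a # w)) = 0" for w
  proof (rule trc_nilpotent)
    define f where "f = word (a # w)"
    have f: "f y \<in> lower_central_series I (Suc i)" if "y \<in> lower_central_series I i" for y i
      using that lie_idealD(4)[OF lie_ideal_lower_central_series[OF I]] by (simp add: f_def bracket_span_memI a)
    \<comment> \<open>The first application only carries an arbitrary \<open>x\<close> into
      \<open>I\<close>, hence the shift of the exponent.\<close>
    have "(f ^^ Suc i) x \<in> lower_central_series I i" for i x
    proof (induction i)
      case 0
      show ?case using lie_idealD(3)[OF I a] by (simp add: f_def)
    next
      case (Suc i)
      then show ?case using f[OF Suc] by simp
    qed
    from this[of n] show "(word (a # w) ^^ Suc n) x = 0" for x unfolding n f_def by blast
  qed (simp_all add: basis lin_word del: word.simps)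
  then show "a \<in> N" by (simp add: N_def)
qed

text \<open>The elements that \<open>b\<close> sends into an ideal form an ideal again; by \<open>ex\<close> the chain obtained in
  this way from \<open>0\<close> is strictly increasing and exhausts \<open>L\<close>.\<close>

lemma nilpotent_ideal_if_fixes_vectors:
  assumes b: "lie_ideal b"
    and ex: "\<And>U. lie_ideal U \<Longrightarrow> U \<noteq> UNIV \<Longrightarrow> \<exists>v. v \<notin> U \<and> (\<forall>a\<in>b. \<lbrace>a, v\<rbrace> \<in> U)"
  shows "nilpotent_ideal b"
proof -
  define K where "K = (\<lambda>U. {v. \<forall>a\<in>b. \<lbrace>a, v\<rbrace> \<in> U})"
  define U where "U = (\<lambda>k. (K ^^ k) {0})"
  have ideal_K: "lie_ideal (K W)" if W: "lie_ideal W" for W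
    unfolding lie_ideal_def
  proof (intro conjI allI ballI)
    show "subspace (K W)"
      using lie_idealD(1)[OF W] by (auto simp: subspace_def K_def br_simps)
    fix x v assume v: "v \<in> K W"
    show "\<lbrace>x, v\<rbrace> \<in> K W"
      unfolding K_def
    proof (intro CollectI ballI)
      fix a assume a: "a \<in> b"
      have "\<lbrace>\<lbrace>a, x\<rbrace>, v\<rbrace> + \<lbrace>x, \<lbrace>a, v\<rbrace>\<rbrace> \<in> W"
        using v a lie_idealD(3)[OF b a] lie_idealD(2)[OF W]
        by (intro subspace_add[OF lie_idealD(1)[OF W]]) (auto simp: K_def)
      then show "\<lbrace>a, \<lbrace>x, v\<rbrace>\<rbrace> \<in> W" by (simp add: br_br)
    qed
  qed
  have ideal_U: "lie_ideal (U k)" for k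
    unfolding U_def
    by (induction k) (simp_all add: ideal_K, simp add: lie_ideal_def)
  have K_superset: "W \<subseteq> K W" if "lie_ideal W" for W
    using lie_idealD(2)[OF that] by (auto simp: K_def)
  have U_Suc: "U (Suc k) = K (U k)" for k by (simp add: U_def)
  obtain d where d: "U d = UNIV"
  proof (rule ccontr)
    assume "\<not> thesis"
    then have neq: "U k \<noteq> UNIV" for k using that by blast
    have "k \<le> dim (U k)" for k
    proof (induction k)
      case (Suc k)
      obtain v where "v \<notin> U k" "v \<in> U (Suc k)"
        using ex[OF ideal_U[of k] neq] unfolding U_Suc K_def by blast
      then have "U k \<noteq> U (Suc k)" by blast
      moreover have "U k = U (Suc k)" if "dim (U (Suc k)) \<le> dim (U k)"
        using K_superset[OF ideal_U[of k]] that
        by (intro subspace_dim_equal lie_idealD(1)[OF ideal_U]) (simp_all add: U_Suc)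
      ultimately have "\<not> dim (U (Suc k)) \<le> dim (U k)" by blast
      then show ?case using Suc by simp
    qed simp
    from this[of "Suc dimension"] show False using dim_subset_UNIV[of "U (Suc dimension)"] by simp
  qed
  \<comment> \<open>Truncated subtraction: beyond \<open>d\<close> the bound stays at
    \<open>U 0 = {0}\<close>.\<close>
  have "lower_central_series b i \<subseteq> U (d - i)" for i
  proof (induction i)
    case (Suc i)
    show ?case
    proof (cases "i < d")
      case True
      then have "U (d - i) = K (U (d - Suc i))" using U_Suc[of "d - Suc i"] by (simp add: Suc_diff_Suc)
      then have "bracket_span b (lower_central_series b i) \<subseteq> U (d - Suc i)"
        using Suc by (intro bracket_span_minimal lie_idealD(1)[OF ideal_U]) (auto simp: K_def)
      then show ?thesis by simp
    next
      case False
      then have "lower_central_series b i \<subseteq> {0}" using Suc by (simp add: U_def)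
      then have "bracket_span b (lower_central_series b i) \<subseteq> U (d - Suc i)"
        using False by (intro bracket_span_minimal lie_idealD(1)[OF ideal_U]) (auto simp: U_def)
      then show ?thesis by simp
    qed
  qed (simp add: d)
  from this[of d] have "lower_central_series b d \<subseteq> {0}" by (simp add: U_def)
  then have "lower_central_series b d = {0}"
    using subspace_0[OF lie_idealD(1)[OF lie_ideal_lower_central_series[OF b]]] by auto
  then show ?thesis using b by (auto simp: nilpotent_ideal_def)
qed

text \<open>The two-sided ideal generated by the adjoint operators of \<open>N\<close> in the
  associative algebra of words. It is closed under composition, so the traces of all positive powers
  vanish and every member is nilpotent, over the given field.\<close>

inductive_set nil_ops :: "('l \<Rightarrow> 'l) set" where
  word: "n \<in> N \<Longrightarrow> word (v @ n # w) \<in> nil_ops"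
| add: "f \<in> nil_ops \<Longrightarrow> g \<in> nil_ops \<Longrightarrow> (\<lambda>x. f x + g x) \<in> nil_ops"
| scale: "f \<in> nil_ops \<Longrightarrow> (\<lambda>x. c *s f x) \<in> nil_ops"

lemma nil_ops_lin: "f \<in> nil_ops \<Longrightarrow> lin f"
proof (induction rule: nil_ops.induct)
  case (word n v w)
  show ?case by (rule lin_word)
qed (simp_all add: lin_iff algebra_simps)

lemma nil_ops_tr: "f \<in> nil_ops \<Longrightarrow> tr f = 0"
  by (induction rule: nil_ops.induct) (simp_all add: tr_word_N tr_add tr_scale)

lemma nil_ops_compose_word: "f \<in> nil_ops \<Longrightarrow> (\<lambda>x. f (word u x)) \<in> nil_ops"
proof (induction rule: nil_ops.induct)
  case (word n v w)
  then show ?case using nil_ops.word[of n v "w @ u"] by (simp add: word_append[abs_def])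
qed (simp_all add: nil_ops.intros)

lemma nil_ops_compose:
  assumes "f \<in> nil_ops" "g \<in> nil_ops"
  shows "(\<lambda>x. f (g x)) \<in> nil_ops"
  using assms(2)
  by induction (simp_all add: lin_add[OF nil_ops_lin[OF assms(1)]] lin_scale[OF nil_ops_lin[OF assms(1)]]
      nil_ops.intros nil_ops_compose_word[OF assms(1)])

lemma nil_ops_nilpotent:
  assumes f: "f \<in> nil_ops"
  obtains m where "\<And>x. (f ^^ m) x = 0"
proof -
  have "f ^^ Suc k \<in> nil_ops" for k
  proof (induction k)
    case (Suc k)
    then show ?case using nil_ops_compose[OF f] by (simp add: o_def)
  qed (simp add: f)
  then have "tr (f ^^ k) = 0" if "k > 0" for k using that by (cases k) (auto intro: nil_ops_tr)
  then show ?thesis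
    using nilpotent_if_trc_powers_0[of E f] nil_ops_lin[OF f] that basis by (metis UNIV_I of_nat_eq_0_iff top_greatest)
qed

text \<open>An Engel type argument: \<open>v\<close> is replaced by some \<open>f v\<close> outside
  \<open>U\<close> as long as this lowers the dimension of \<open>W v\<close>. If the dimension
  stays, some \<open>g\<close> in \<open>nil_ops\<close> reproduces \<open>f v\<close> modulo
  \<open>U\<close>, and the nilpotency of \<open>g\<close> puts \<open>f v\<close> into
  \<open>U\<close>.\<close>

lemma N_fixes_vector:
  assumes U: "lie_ideal U" "U \<noteq> UNIV"
  shows "\<exists>v. v \<notin> U \<and> (\<forall>f\<in>nil_ops. f v \<in> U)"
proof -
  note sub = lie_idealD(1)[OF U(1)]
  define W where "W = (\<lambda>v. {f v + x |f x. f \<in> nil_ops \<and> x \<in> U})"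
  have zero: "(\<lambda>x. 0) \<in> nil_ops"
    using nil_ops.scale[OF nil_ops.word, of 0 0 "[]" "[]"] lie_idealD(1)[OF lie_ideal_N] by (simp add: subspace_0)
  have stable: "f x \<in> U" if "f \<in> nil_ops" "x \<in> U" for f x
    using that by (induction arbitrary: x) (simp_all add: lie_idealD(4)[OF U(1)] subspace_add[OF sub] subspace_scale[OF sub] del: word.simps)
  have sub_W: "subspace (W v)" for v
    unfolding subspace_def
  proof (intro conjI ballI allI)
    show "0 \<in> W v" unfolding W_def using zero subspace_0[OF sub] by force
    show "a + b \<in> W v" if "a \<in> W v" "b \<in> W v" for a b
    proof -
      obtain f x g y where "a = f v + x" "b = g v + y" "f \<in> nil_ops" "g \<in> nil_ops" "x \<in> U" "y \<in> U"
        using \<open>a \<in> W v\<close> \<open>b \<in> W v\<close> unfolding W_def by blast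
      then show ?thesis
        unfolding W_def using nil_ops.add[of f g] subspace_add[OF sub, of x y]
        by (intro CollectI exI[of _ "\<lambda>x. f x + g x"] exI[of _ "x + y"]) (simp add: algebra_simps)
    qed
    show "c *s a \<in> W v" if "a \<in> W v" for a c
    proof -
      obtain f x where "a = f v + x" "f \<in> nil_ops" "x \<in> U"
        using \<open>a \<in> W v\<close> unfolding W_def by blast
      then show ?thesis
        unfolding W_def using nil_ops.scale[of f c] subspace_scale[OF sub, of x c]
        by (intro CollectI exI[of _ "\<lambda>x. c *s f x"] exI[of _ "c *s x"]) (simp add: scale_right_distrib)
    qed
  qed
  have "\<exists>v. v \<notin> U \<and> (\<forall>f\<in>nil_ops. f v \<in> U)" if "v \<notin> U" for v
    using that
  proof (induction "dim (W v)" arbitrary: v rule: less_induct)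
    case less
    show ?case
    proof (cases "\<forall>f\<in>nil_ops. f v \<in> U")
      case True
      then show ?thesis using less.prems by blast
    next
      case False
      then obtain f where f: "f \<in> nil_ops" "f v \<notin> U" by blast
      have W_sub: "W (f v) \<subseteq> W v"
      proof
        fix y assume "y \<in> W (f v)"
        then obtain g x where "y = g (f v) + x" "g \<in> nil_ops" "x \<in> U" unfolding W_def by blast
        then show "y \<in> W v"
          unfolding W_def using nil_ops_compose[of g f] f(1)
          by (intro CollectI exI[of _ "\<lambda>x. g (f x)"] exI[of _ x]) simp
      qed
      show ?thesis
      proof (cases "dim (W (f v)) < dim (W v)")
        case True
        then show ?thesis using less.hyps f(2) by blast
      next
        case False
        then have "W (f v) = W v" using W_sub by (intro subspace_dim_equal sub_W) simp_all
        moreover have "f v \<in> W v" unfolding W_def using f(1) subspace_0[OF sub] by force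
        ultimately obtain g x where g: "g \<in> nil_ops" "x \<in> U" "f v = g (f v) + x"
          unfolding W_def by blast
        obtain m where m: "\<And>x. (g ^^ m) x = 0" using nil_ops_nilpotent[OF g(1)] by blast
        have "f v - (g ^^ i) (f v) \<in> U" for i
        proof (induction i)
          case (Suc i)
          have "g (f v) - g ((g ^^ i) (f v)) = g (f v - (g ^^ i) (f v))"
            using lin_add[OF nil_ops_lin[OF g(1)], of "f v - (g ^^ i) (f v)" "(g ^^ i) (f v)"] by (simp add: algebra_simps)
          also have "\<dots> \<in> U" by (rule stable[OF g(1) Suc])
          finally have *: "(g (f v) - g ((g ^^ i) (f v))) + x \<in> U" using g(2) by (rule subspace_add[OF sub])
          have "f v - g ((g ^^ i) (f v)) = (g (f v) - g ((g ^^ i) (f v))) + x"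
            using g(3) by (metis add.commute add_diff_eq)
          with * show ?case by (simp only: funpow.simps o_apply)
        qed (simp add: subspace_0[OF sub])
        from this[of m] show ?thesis using f(2) by (simp add: m)
      qed
    qed
  qed
  then show ?thesis using U(2) by blast
qed

lemma N_fixes_vector':
  assumes "lie_ideal U" "U \<noteq> UNIV"
  shows "\<exists>v. v \<notin> U \<and> (\<forall>a\<in>N. \<lbrace>a, v\<rbrace> \<in> U)"
proof -
  obtain v where v: "v \<notin> U" "\<And>f. f \<in> nil_ops \<Longrightarrow> f v \<in> U" using N_fixes_vector[OF assms] by blast
  have "\<lbrace>a, v\<rbrace> \<in> U" if "a \<in> N" for a
    using v(2)[OF nil_ops.word[OF that, of "[]" "[]"]] by simp
  then show ?thesis using v(1) by blast
qed

lemma nilpotent_ideal_N: "nilpotent_ideal N"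
  by (rule nilpotent_ideal_if_fixes_vectors[OF lie_ideal_N N_fixes_vector'])

lemma nilpotent_radical_eq: "nilpotent_radical = N"
  unfolding nilpotent_radical_def
  by (rule Greatest_equality) (auto dest: nilpotent_ideal_subset_N intro: nilpotent_ideal_N)

section \<open>The solvable radical\<close>

text \<open>Engel's theorem for operators commuting modulo \<open>N\<close>. The vectors sent into
  \<open>U\<close> by \<open>N\<close> and by the basis elements treated so far are preserved by the
  next basis element \<open>x\<close>, so \<open>x\<close> can be applied until just before
  \<open>U\<close> is entered.\<close>

lemma commutative_nilpotent_subset_N:
  assumes b: "lie_ideal b" and comm: "\<And>x y. x \<in> b \<Longrightarrow> y \<in> b \<Longrightarrow> \<lbrace>x, y\<rbrace> \<in> N"
    and nilp: "\<And>x. x \<in> b \<Longrightarrow> \<exists>m. \<forall>y. (bracket x ^^ m) y = 0"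
  shows "b \<subseteq> N"
proof (rule nilpotent_ideal_subset_N[OF nilpotent_ideal_if_fixes_vectors[OF b]])
  fix U assume U: "lie_ideal U" "U \<noteq> UNIV"
  note sub = lie_idealD(1)[OF U(1)]
  obtain T where T: "finite T" "independent T" "span T = b"
    using finite_basis_of_subspace[OF basis(1) lie_idealD(1)[OF b]] basis(3) by auto
  have "\<exists>v. v \<notin> U \<and> (\<forall>a\<in>N. \<lbrace>a, v\<rbrace> \<in> U) \<and> (\<forall>a\<in>C. \<lbrace>a, v\<rbrace> \<in> U)" if "finite C" "C \<subseteq> b" for C
    using that
  proof (induction C rule: finite_induct)
    case empty
    show ?case using N_fixes_vector'[OF U] by simp
  next
    case (insert x C)
    then obtain v where v: "v \<notin> U" "\<forall>a\<in>N. \<lbrace>a, v\<rbrace> \<in> U" "\<forall>a\<in>C. \<lbrace>a, v\<rbrace> \<in> U" by auto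
    have x: "x \<in> b" using insert.prems by simp
    have N: "\<lbrace>a, (bracket x ^^ i) v\<rbrace> \<in> U" if "a \<in> N" for a i
      using that
    proof (induction i arbitrary: a)
      case (Suc i)
      have "\<lbrace>\<lbrace>a, x\<rbrace>, (bracket x ^^ i) v\<rbrace> + \<lbrace>x, \<lbrace>a, (bracket x ^^ i) v\<rbrace>\<rbrace> \<in> U"
        using Suc lie_idealD(3)[OF lie_ideal_N] lie_idealD(2)[OF U(1)] by (intro subspace_add[OF sub]) auto
      then show ?case by (simp add: br_br)
    qed (simp add: v)
    have C: "\<lbrace>a, (bracket x ^^ i) v\<rbrace> \<in> U" if "a \<in> C" for a i
    proof (induction i)
      case (Suc i)
      have "\<lbrace>\<lbrace>a, x\<rbrace>, (bracket x ^^ i) v\<rbrace> + \<lbrace>x, \<lbrace>a, (bracket x ^^ i) v\<rbrace>\<rbrace> \<in> U"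
        using Suc comm[of a x] that insert.prems N lie_idealD(2)[OF U(1)] by (intro subspace_add[OF sub]) auto
      then show ?case by (simp add: br_br)
    qed (simp add: v that)
    obtain m where "(bracket x ^^ m) v = 0" using nilp[OF x] by blast
    then have ex: "(bracket x ^^ m) v \<in> U" by (simp add: subspace_0[OF sub])
    \<comment> \<open>\<open>k\<close> is positive because \<open>v\<close> is outside
      \<open>U\<close>; the vector for the preceding exponent is still outside and is sent into
      \<open>U\<close> by \<open>x\<close>.\<close>
    define k where "k = (LEAST k. (bracket x ^^ k) v \<in> U)"
    have k: "(bracket x ^^ k) v \<in> U" unfolding k_def by (rule LeastI) (rule ex)
    then obtain j where j: "k = Suc j" using v(1) by (cases k) auto
    then have "(bracket x ^^ j) v \<notin> U" using not_less_Least[of j "\<lambda>k. (bracket x ^^ k) v \<in> U"] by (simp add: k_def)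
    then show ?case using N C k j by (intro exI[of _ "(bracket x ^^ j) v"]) auto
  qed
  from this[OF T(1)] obtain v where v: "v \<notin> U" "\<And>a. a \<in> T \<Longrightarrow> \<lbrace>a, v\<rbrace> \<in> U"
    using T(3) span_superset by blast
  have "\<lbrace>a, v\<rbrace> \<in> U" if "a \<in> span T" for a
    using that
    by (induction rule: module.span_induct_alt[OF module_axioms, consumes 1])
      (simp_all add: br_simps subspace_0[OF sub] subspace_add[OF sub] subspace_scale[OF sub] v(2))
  then show "\<exists>v. v \<notin> U \<and> (\<forall>a\<in>b. \<lbrace>a, v\<rbrace> \<in> U)" using v(1) T(3) by blast
qed

text \<open>If \<open>a\<close> commutes with \<open>b\<close> modulo \<open>N\<close>, then \<open>tr ([x, a] b^m) = tr (x [a, b^m]) = 0\<close>; summing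
  up, the powers of \<open>b\<close> have trace zero.\<close>

lemma br_nilpotent:
  assumes b: "b \<in> span {\<lbrace>x, a\<rbrace> |x a. \<lbrace>a, b\<rbrace> \<in> N}"
  shows "\<exists>m. \<forall>y. (bracket b ^^ m) y = 0"
proof -
  have word_b: "word (replicate k b) = bracket b ^^ k" for k
    by (induction k) (simp_all add: fun_eq_iff)
  have move: "tr (word (x # replicate i b @ a # replicate j b)) = tr (word (x # a # replicate (i + j) b))"
    if a: "\<lbrace>a, b\<rbrace> \<in> N" for x a i j
  proof (induction i arbitrary: j)
    case (Suc i)
    have "tr (word ((x # replicate i b) @ \<lbrace>a, b\<rbrace> # replicate j b)) = 0" by (rule tr_word_N[OF a])
    then have "tr (word (x # replicate i b @ a # b # replicate j b)) = tr (word (x # replicate i b @ b # a # replicate j b))"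
      unfolding tr_word_br by simp
    moreover have "replicate i b @ b # l = b # replicate i b @ l" for l by (induction i) simp_all
    ultimately show ?case using Suc[of "Suc j"] by (simp del: word.simps)
  qed simp
  have "tr (word (c # replicate k b)) = 0" if "c \<in> span {\<lbrace>x, a\<rbrace> |x a. \<lbrace>a, b\<rbrace> \<in> N}" for c k
    using that
  proof (induction rule: module.span_induct_alt[OF module_axioms, consumes 1, case_names base step])
    case base
    show ?case using tr_scale[of 0] by simp
  next
    case (step r c d)
    then obtain x a where c: "c = \<lbrace>x, a\<rbrace>" "\<lbrace>a, b\<rbrace> \<in> N" by blast
    have "tr (word (a # x # replicate k b)) = tr (word (x # replicate k b @ [a]))"
      using tr_word_rotate[of "[a]" "x # replicate k b"] by simp
    then have "tr (word (c # replicate k b)) = 0"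
      using tr_word_br[of "[]" x a "replicate k b"] move[OF c(2), of x k 0] by (simp add: c(1))
    then show ?case using step.IH by (simp add: word_Cons br_simps tr_add tr_scale)
  qed
  from this[OF b] have "tr (word (replicate (Suc k) b)) = 0" for k
    by (simp del: word.simps)
  then have "tr (bracket b ^^ k) = 0" if "k > 0" for k
    using that unfolding word_b by (cases k) blast+
  then show ?thesis
    using nilpotent_if_trc_powers_0[of E "bracket b"] lin_br basis by (metis UNIV_I of_nat_eq_0_iff top_greatest)
qed

definition R :: "'l set" where
  "R = {a. \<forall>b. \<lbrace>a, b\<rbrace> \<in> N}"

lemma lie_ideal_R: "lie_ideal R"
  unfolding lie_ideal_def
proof (intro conjI allI ballI)
  show "subspace R"
    using lie_idealD(1)[OF lie_ideal_N] by (auto simp: subspace_def R_def br_simps)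
  fix b a assume "a \<in> R"
  then have "\<lbrace>b, a\<rbrace> \<in> N"
    by (simp add: R_def lie_ideal_br_sym[OF lie_ideal_N])
  then show "\<lbrace>b, a\<rbrace> \<in> R" using lie_idealD(3)[OF lie_ideal_N] by (simp add: R_def)
qed

text \<open>Since \<open>[R, R]\<close> lies in the nilpotent ideal \<open>N\<close>, the derived
  series is bounded, with a shift by one, by the lower central series of \<open>N\<close>.\<close>

lemma solvable_ideal_R: "solvable_ideal R"
proof -
  have "derived_series R (Suc n) \<subseteq> lower_central_series N n" for n
  proof (induction n)
    case 0
    show ?case
      by (simp, intro bracket_span_minimal lie_idealD(1)[OF lie_ideal_N]) (simp add: R_def)
  next
    case (Suc n)
    have "lower_central_series N n \<subseteq> N"
      by (cases n) (simp_all add: bracket_span_minimal lie_idealD[OF lie_ideal_N])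
    then show ?case
      using Suc lie_idealD(1)[OF lie_ideal_lower_central_series[OF lie_ideal_N, of "Suc n"]]
      unfolding derived_series.simps(2)[of R "Suc n"] lower_central_series.simps
      by (intro bracket_span_minimal bracket_span_memI) blast+
  qed
  moreover obtain n where "lower_central_series N n = {0}"
    using nilpotent_ideal_N by (auto simp: nilpotent_ideal_def)
  ultimately have "derived_series R (Suc n) \<subseteq> {0}" by metis
  then have "derived_series R (Suc n) = {0}"
    using subspace_0[OF lie_idealD(1)[OF lie_ideal_derived_series[OF lie_ideal_R]]] by blast
  then show ?thesis using lie_ideal_R unfolding solvable_ideal_def by blast
qed

text \<open>Descent along the derived series, last term first. If \<open>[a k, a k]\<close> is in
  \<open>R\<close>, then \<open>br_nilpotent\<close> and the Engel argument place it in
  \<open>N\<close>; so \<open>a k\<close> is commutative modulo \<open>N\<close>, and the same two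
  lemmas place \<open>[L, a k]\<close> in \<open>N\<close>. This stands in for Lie's theorem, which
  would require eigenvalues in the field.\<close>

lemma solvable_ideal_subset_R:
  assumes "solvable_ideal I"
  shows "I \<subseteq> R"
proof -
  obtain n where I: "lie_ideal I" and n: "derived_series I n = {0}"
    using assms by (auto simp: solvable_ideal_def)
  define a where "a = derived_series I"
  have a: "lie_ideal (a k)" "a (Suc k) = bracket_span (a k) (a k)" for k
    using lie_ideal_derived_series[OF I] by (simp_all add: a_def)
  have UNIV: "lie_ideal UNIV" by (simp add: lie_ideal_def)
  have step: "a k \<subseteq> R" if k: "a (Suc k) \<subseteq> R" for k
  proof -
    have "a (Suc k) \<subseteq> N"
    proof (rule commutative_nilpotent_subset_N[OF a(1)])
      show "\<lbrace>x, y\<rbrace> \<in> N" if "x \<in> a (Suc k)" for x y using that k by (auto simp: R_def)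
      show "\<exists>m. \<forall>y. (bracket b ^^ m) y = 0" if b: "b \<in> a (Suc k)" for b
      proof (rule br_nilpotent)
        have "\<lbrace>y, b\<rbrace> \<in> N" for y
          using b k by (intro lie_ideal_br_sym[OF lie_ideal_N, of b y]) (auto simp: R_def)
        then show "b \<in> span {\<lbrace>x, y\<rbrace> |x y. \<lbrace>y, b\<rbrace> \<in> N}"
          using b unfolding a(2) bracket_span_def by (elim rev_subsetD, intro span_mono) blast
      qed
    qed
    then have comm: "\<lbrace>x, y\<rbrace> \<in> N" if "x \<in> a k" "y \<in> a k" for x y
      using bracket_span_memI[OF that] a(2)[of k] by blast
    have sub: "bracket_span UNIV (a k) \<subseteq> a k"
      by (intro bracket_span_minimal lie_idealD[OF a(1)])
    have "bracket_span UNIV (a k) \<subseteq> N"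
    proof (rule commutative_nilpotent_subset_N[OF lie_ideal_bracket_span[OF UNIV a(1)]])
      show "\<lbrace>x, y\<rbrace> \<in> N" if "x \<in> bracket_span UNIV (a k)" "y \<in> bracket_span UNIV (a k)" for x y
        using that sub comm by blast
      show "\<exists>m. \<forall>y. (bracket b ^^ m) y = 0" if b: "b \<in> bracket_span UNIV (a k)" for b
      proof (rule br_nilpotent)
        show "b \<in> span {\<lbrace>x, y\<rbrace> |x y. \<lbrace>y, b\<rbrace> \<in> N}"
          using b comm sub unfolding bracket_span_def by (elim rev_subsetD, intro span_mono) blast
      qed
    qed
    then have "\<lbrace>y, x\<rbrace> \<in> N" if "x \<in> a k" for x y using bracket_span_memI[of y UNIV x "a k"] that by blast
    then show ?thesis
      using lie_ideal_br_sym[OF lie_ideal_N] by (auto simp: R_def)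
  qed
  have "a (n - i) \<subseteq> R" for i
  proof (induction i)
    case 0
    show ?case using n subspace_0[OF lie_idealD(1)[OF lie_ideal_R]] by (simp add: a_def)
  next
    case (Suc i)
    show ?case
    proof (cases "i < n")
      case True
      then show ?thesis using Suc step[of "n - Suc i"] by (simp add: Suc_diff_Suc)
    qed (use Suc in simp)
  qed
  from this[of n] show ?thesis by (simp add: a_def)
qed

lemma solvable_radical_eq: "solvable_radical = R"
  unfolding solvable_radical_def
  by (rule Greatest_equality) (auto dest: solvable_ideal_subset_R intro: solvable_ideal_R)

end

section \<open>Invariance of the radicals\<close>

text \<open>Of (co)semisimplicity only \<open>S_S\<close> enters from here on. The module law
  \<open>act_bracket\<close> is composed with scalar functionals \<open>q\<close> because
  \<open>H.sw\<close> takes scalar values.\<close>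

locale involutive_hopf_lie = H: fin_hopf scaleH B mult one D eps S + L: lie_algebra_basis scaleL bracket E
  for scaleH :: "'f::field_char_0 \<Rightarrow> 'h::ab_group_add \<Rightarrow> 'h"
    and B :: "'h set" and mult :: "'h \<Rightarrow> 'h \<Rightarrow> 'h" (infixl \<open>\<cdot>\<close> 76) and one :: 'h
    and D :: "'h \<Rightarrow> 'h \<Rightarrow> 'h \<Rightarrow> 'f" and eps :: "'h \<Rightarrow> 'f" and S :: "'h \<Rightarrow> 'h"
    and scaleL :: "'f \<Rightarrow> 'l::ab_group_add \<Rightarrow> 'l"
    and bracket :: "'l \<Rightarrow> 'l \<Rightarrow> 'l" (\<open>\<lbrace>_, _\<rbrace>\<close>) and E :: "'l set" +
  fixes act :: "'h \<Rightarrow> 'l \<Rightarrow> 'l"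
  assumes act_lin: "act h (a + b) = act h a + act h b" "act h (scaleL r a) = scaleL r (act h a)"
    and act_lin_left: "act (h + k) a = act h a + act k a" "act (scaleH r h) a = scaleL r (act h a)"
    and act_one: "act one a = a"
    and act_mult: "act (h \<cdot> k) a = act h (act k a)"
    and act_bracket: "\<lbrakk>\<And>x y. q (x + y) = q x + q y; \<And>r x. q (scaleL r x) = r * q x\<rbrakk> \<Longrightarrow>
      q (act h \<lbrace>a, b\<rbrace>) = H.sw h (\<lambda>x y. q \<lbrace>act x a, act y b\<rbrace>)"
    and S_S: "S (S h) = h"
begin

definition linHL :: "('h \<Rightarrow> 'l) \<Rightarrow> bool" where
  "linHL f \<longleftrightarrow> (\<forall>x y. f (x + y) = f x + f y) \<and> (\<forall>r x. f (scaleH r x) = scaleL r (f x))"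

lemma lf_functional: "L.lf q \<Longrightarrow> linHL f \<Longrightarrow> H.lf (\<lambda>x. q (f x))"
  by (simp add: L.lf_def linHL_def H.lf_def)

lemma linHL_intros [H.lf_intros]:
  "H.lin g \<Longrightarrow> linHL (\<lambda>x. act (g x) a)"
  "linHL f \<Longrightarrow> linHL (\<lambda>x. act h (f x))"
  "linHL f \<Longrightarrow> linHL (\<lambda>x. \<lbrace>a, f x\<rbrace>)"
  "linHL f \<Longrightarrow> linHL (\<lambda>x. \<lbrace>f x, a\<rbrace>)"
  by (simp_all add: linHL_def H.lin_iff act_lin act_lin_left L.br_simps)

lemma linHL_word [H.lf_intros]: "linHL f \<Longrightarrow> linHL (\<lambda>x. L.word w (f x))"
  by (simp add: linHL_def L.lin_add[OF L.lin_word] L.lin_scale[OF L.lin_word])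

lemma lf_trL [H.lf_intros]: "(\<And>v. linHL (\<lambda>x. F x v)) \<Longrightarrow> H.lf (\<lambda>x. L.tr (F x))"
  unfolding L.trc_def by (intro H.lf_intros lf_functional[OF L.lf_coef])

lemma act_bracket_functional:
  "L.lf q \<Longrightarrow> q (act h \<lbrace>a, b\<rbrace>) = H.sw h (\<lambda>x y. q \<lbrace>act x a, act y b\<rbrace>)"
  by (rule act_bracket) (simp_all add: L.lf_def)

lemma sw_trL: "H.sw h (\<lambda>x y. L.tr (F x y)) =
    (\<Sum>e\<in>E. H.sw h (\<lambda>x y. L.coef (F x y e) e))"
  by (simp add: L.trc_def H.sw_sum)

text \<open>The module law turns the right hand side into brackets of \<open>h1 a\<close> with
  \<open>h2 S(h3) b\<close>, and the antipode law collapses the latter.\<close>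

lemma act_left_bracket:
  assumes q: "L.lf q"
  shows "q \<lbrace>act h a, b\<rbrace> = H.sw h (\<lambda>x y. q (act x \<lbrace>a, act (S y) b\<rbrace>))"
proof -
  note [H.lf_intros] = lf_functional[OF q]
  have "H.sw h (\<lambda>x y. q (act x \<lbrace>a, act (S y) b\<rbrace>)) =
      H.sw h (\<lambda>z y. H.sw z (\<lambda>x w. q \<lbrace>act x a, act (w \<cdot> S y) b\<rbrace>))"
    by (simp add: act_bracket_functional[OF q] act_mult)
  also have "\<dots> = H.sw h (\<lambda>x z. H.sw z (\<lambda>w y. q \<lbrace>act x a, act (w \<cdot> S y) b\<rbrace>))"
    by (rule H.sw_coassoc)
  also have "\<dots> = H.sw h (\<lambda>x z. eps z * q \<lbrace>act x a, act one b\<rbrace>)"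
    by (subst H.sw_antipode_right[where p = "\<lambda>k. q \<lbrace>act _ a, act k b\<rbrace>"]) (intro H.lf_intros, rule refl)
  also have "\<dots> = q \<lbrace>act h a, act one b\<rbrace>"
    by (rule H.sw_counit_right) (intro H.lf_intros)
  finally show ?thesis by (simp add: act_one)
qed

lemma lin_act: "L.lin (act h)"
  by (simp add: L.lin_iff act_lin)

text \<open>Moving \<open>S h\<^sub>(\<^sub>2\<^sub>)\<close> through \<open>w\<close> until it meets \<open>h\<^sub>(\<^sub>1\<^sub>)\<close>; here \<open>S\<^sup>2 = id\<close> is needed in the form
  \<open>S h\<^sub>(\<^sub>2\<^sub>) h\<^sub>(\<^sub>1\<^sub>) = \<epsilon>(h)\<close>.\<close>

lemma sw_tr_word_eq_0:
  assumes a: "a \<in> L.N"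
  shows "H.sw h (\<lambda>x y. L.tr (\<lambda>v. \<lbrace>a, L.word p (act (S y) (L.word w (act x v)))\<rbrace>)) = 0"
proof (induction w arbitrary: p h)
  case Nil
  let ?q = "\<lambda>k. L.tr (\<lambda>v. \<lbrace>a, L.word p (act k v)\<rbrace>)"
  have q: "H.lf ?q" by (intro H.lf_intros)
  \<comment> \<open>As \<open>S\<close> is an involution, the product \<open>S y \<cdot> x\<close>
    in the wrong order equals \<open>S (S x \<cdot> y)\<close>, to which the antipode law
    applies.\<close>
  have "H.sw h (\<lambda>x y. ?q (S y \<cdot> x)) = H.sw h (\<lambda>x y. ?q (S (S x \<cdot> y)))"
    by (simp only: H.S_mult S_S)
  also have "\<dots> = eps h * ?q (S one)"
    by (rule H.sw_antipode_left) (intro H.lf_intros)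
  also have "?q (S one) = 0"
    using a by (simp add: H.S_one act_one L.N_def flip: L.word_Cons)
  finally show ?case by (simp add: act_mult)
next
  case (Cons b w)
  have "L.tr (\<lambda>v. \<lbrace>a, L.word p (act (S y) (L.word (b # w) (act x v)))\<rbrace>) =
      H.sw y (\<lambda>y1 y2. L.tr (\<lambda>v. \<lbrace>a, L.word (p @ [act (S y2) b]) (act (S y1) (L.word w (act x v)))\<rbrace>))" for x y
  proof -
    have "L.coef \<lbrace>a, L.word p (act (S y) \<lbrace>b, L.word w (act x e)\<rbrace>)\<rbrace> e =
        H.sw y (\<lambda>y1 y2. L.coef \<lbrace>a, L.word p \<lbrace>act (S y2) b, act (S y1) (L.word w (act x e))\<rbrace>\<rbrace> e)"
      for e
    proof -
      define q where "q = (\<lambda>z. L.coef \<lbrace>a, L.word p z\<rbrace> e)"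
      have q: "L.lf q"
        using L.lf_coef by (simp add: q_def L.lf_def L.lin_add[OF L.lin_word] L.lin_scale[OF L.lin_word] L.br_simps)
      note [H.lf_intros] = lf_functional[OF q]
      have "q (act (S y) \<lbrace>b, L.word w (act x e)\<rbrace>) =
          H.sw (S y) (\<lambda>y2 y1. q \<lbrace>act y2 b, act y1 (L.word w (act x e))\<rbrace>)"
        by (rule act_bracket_functional[OF q])
      also have "\<dots> = H.sw y (\<lambda>y1 y2. q \<lbrace>act (S y2) b, act (S y1) (L.word w (act x e))\<rbrace>)"
        by (rule H.sw_S) (intro H.bilI H.lf_intros)
      finally show ?thesis by (simp add: q_def)
    qed
    then show ?thesis unfolding sw_trL by (simp add: L.trc_def L.word_append)
  qed
  then have "H.sw h (\<lambda>x y. L.tr (\<lambda>v. \<lbrace>a, L.word p (act (S y) (L.word (b # w) (act x v)))\<rbrace>)) =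
      H.sw h (\<lambda>x y. H.sw y (\<lambda>y1 y2. L.tr (\<lambda>v. \<lbrace>a, L.word (p @ [act (S y2) b]) (act (S y1) (L.word w (act x v)))\<rbrace>)))"
    by simp
  \<comment> \<open>For fixed \<open>y2\<close> the inner sum is the induction hypothesis with the
    letter \<open>act (S y2) b\<close> appended to \<open>p\<close>; this is why \<open>p\<close>
    and \<open>h\<close> are arbitrary in the induction.\<close>
  also have "\<dots> = H.sw h (\<lambda>z y2. H.sw z (\<lambda>x y1. L.tr (\<lambda>v. \<lbrace>a, L.word (p @ [act (S y2) b]) (act (S y1) (L.word w (act x v)))\<rbrace>)))"
    by (rule H.sw_coassoc[symmetric])
  also have "\<dots> = 0" unfolding Cons.IH by (rule H.sw_zero)
  finally show ?case .
qed

lemma lf_tr_word: "L.lf (\<lambda>c. L.tr (L.word (c # w)))"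
  by (simp add: L.lf_def L.word_Cons L.br_simps L.tr_add L.tr_scale)

lemma act_N: "a \<in> L.N \<Longrightarrow> act h a \<in> L.N"
proof -
  assume a: "a \<in> L.N"
  have "L.tr (L.word (act h a # w)) = 0" for w
  proof -
    have "L.tr (L.word (act h a # w)) = H.sw h (\<lambda>x y. L.tr (\<lambda>v. act x \<lbrace>a, act (S y) (L.word w v)\<rbrace>))"
      unfolding sw_trL by (simp add: L.trc_def act_left_bracket[OF L.lf_coef])
    also have "\<dots> = H.sw h (\<lambda>x y. L.tr (\<lambda>v. \<lbrace>a, L.word [] (act (S y) (L.word w (act x v)))\<rbrace>))"
    proof -
      have "L.tr (\<lambda>v. act x \<lbrace>a, act (S y) (L.word w v)\<rbrace>) = L.tr (\<lambda>v. \<lbrace>a, act (S y) (L.word w (act x v))\<rbrace>)" for x y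
        by (rule L.tr_compose_commute[OF lin_act]) (intro L.lin_compose[OF L.lin_br] L.lin_compose[OF lin_act] L.lin_word)
      then show ?thesis by simp
    qed
    also have "\<dots> = 0" by (rule sw_tr_word_eq_0[OF a])
    finally show ?thesis .
  qed
  then show ?thesis by (simp add: L.N_def)
qed

text \<open>\<open>[h a, b]\<close> is a combination of elements \<open>x [a, S(y) b]\<close> whose
  inner brackets lie in \<open>N\<close>, so the invariance of \<open>N\<close> suffices.\<close>

lemma act_R:
  assumes "a \<in> L.R"
  shows "act h a \<in> L.R"
proof -
  have "L.tr (L.word (\<lbrace>act h a, b\<rbrace> # w)) = 0" for b w
  proof -
    have "L.tr (L.word (act x \<lbrace>a, act (S y) b\<rbrace> # w)) = 0" for x y
      using act_N[of "\<lbrace>a, act (S y) b\<rbrace>" x] assms by (simp add: L.R_def L.N_def)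
    then show ?thesis
      by (subst act_left_bracket[OF lf_tr_word]) (simp only: H.sw_zero)
  qed
  then show ?thesis by (simp add: L.R_def L.N_def)
qed

end

theorem theorem1:
  fixes scaleH :: "'f::field_char_0 \<Rightarrow> 'h::ab_group_add \<Rightarrow> 'h"
    and mult :: "'h \<Rightarrow> 'h \<Rightarrow> 'h" and one :: 'h
    and comult :: "'h \<Rightarrow> ('h \<times> 'h \<Rightarrow>\<^sub>0 'f)" and counit :: "'h \<Rightarrow> 'f"
    and antipode :: "'h \<Rightarrow> 'h"
    and scaleL :: "'f \<Rightarrow> 'l::ab_group_add \<Rightarrow> 'l"
    and bracket :: "'l \<Rightarrow> 'l \<Rightarrow> 'l"
    and act :: "'h \<Rightarrow> 'l \<Rightarrow> 'l"
  assumes "hopf_algebra scaleH mult one comult counit antipode"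
    and "finite_dimensional scaleH"
    and "unital_algebra.semisimple_algebra scaleH mult
      \<or> coalgebra.cosemisimple_coalgebra scaleH comult"
    and "module_lie_algebra scaleH mult one comult counit antipode scaleL bracket act"
    and "finite_dimensional scaleL"
  shows "module_lie_algebra.H_submodule scaleL act (lie_algebra.solvable_radical scaleL bracket)
    \<and> module_lie_algebra.H_submodule scaleL act (lie_algebra.nilpotent_radical scaleL bracket)"
proof -
  obtain B where B: "finite_dimensional_vector_space scaleH B"
    using assms(2) by (auto simp: finite_dimensional_def)
  obtain E where E: "finite_dimensional_vector_space scaleL E"
    using assms(5) by (auto simp: finite_dimensional_def)
  interpret M: module_lie_algebra scaleH mult one comult counit antipode scaleL bracket act by fact
  interpret H: hopf_algebra_basis scaleH mult one comult counit antipode B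
    using B by (intro hopf_algebra_basis.intro fin_basis.intro fin_basis_axioms.intro trace_space.intro assms(1) M.H.vector_space_axioms)
      (simp_all add: finite_dimensional_vector_space_def finite_dimensional_vector_space_axioms_def)
  interpret L: lie_algebra_basis scaleL bracket E
    using E by (intro lie_algebra_basis.intro fin_basis.intro fin_basis_axioms.intro trace_space.intro M.L.lie_algebra_axioms M.L.vector_space_axioms)
      (simp_all add: finite_dimensional_vector_space_def finite_dimensional_vector_space_axioms_def)
  interpret A: involutive_hopf_lie scaleH B mult one H.comult_coeff counit antipode scaleL bracket E act
  proof (intro involutive_hopf_lie.intro involutive_hopf_lie_axioms.intro H.FH.fin_hopf_axioms L.lie_algebra_basis_axioms)
    fix h k a b r
    show "act h (a + b) = act h a + act h b" "act h (scaleL r a) = scaleL r (act h a)"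
      using M.act_linear_right by (auto simp: Vector_Spaces.linear_iff)
    show "act (h + k) a = act h a + act k a" "act (scaleH r h) a = scaleL r (act h a)"
      using M.act_linear_left by (auto simp: Vector_Spaces.linear_iff)
    show "act one a = a" "act (mult h k) a = act h (act k a)" by (rule M.act_one M.act_mult)+
    show "antipode (antipode h) = h"
      by (rule antipode_antipode[OF H.hopf_algebra_basis_axioms assms(3)])
    fix q :: "'l \<Rightarrow> 'f"
    assume q: "\<And>x y. q (x + y) = q x + q y" "\<And>r x. q (scaleL r x) = r * q x"
    have "q 0 = 0" using q(2)[of 0 0] by simp
    then have "q (act h (bracket a b)) = H.sweedler h (\<lambda>x y. q (bracket (act x a) (act y b)))"
      unfolding M.act_bracket H.sweedler_def
      by (subst lin_ext_compose[of q scaleL "(*)"]) (simp_all add: q case_prod_unfold)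
    also have "\<dots> = H.FB.sw h (\<lambda>x y. q (bracket (act x a) (act y b)))"
      using M.act_linear_left
      by (intro H.sw_eq_sweedler[symmetric])
        (simp add: H.bil_def H.lf_def Vector_Spaces.linear_iff L.br_simps q)
    finally show "q (act h (bracket a b)) = H.FB.sw h (\<lambda>x y. q (bracket (act x a) (act y b)))" .
  qed
  show ?thesis
    unfolding L.solvable_radical_eq L.nilpotent_radical_eq M.H_submodule_def
    using A.act_R A.act_N L.lie_idealD(1)[OF L.lie_ideal_R] L.lie_idealD(1)[OF L.lie_ideal_N] by blast
qed

end
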